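(* Let $\Gamma$ be a finitely generated word hyperbolic group and let $\{\rho_t\}_{t\in(-1,1)}$ be an analytic one parameter family of representations of $\Gamma$ in $\mathsf{G}=\mathsf{SO}_0(n,n)$ such that $\rho=\rho_0$ takes values in $\mathsf{G}_0$ and is Anosov in $\mathsf{G}_0$ with respect to the stabilizer $\mathsf{P}_0^\pm$ of an $n$-dimensional null subspace of $\mathbb{R}^{n,n-1}$. Let $U$ be the tangent vector to $\{\rho_t\}$ at $\rho$ and $u=Ue_{2n}$. Suppose $(\rho,u)$ is a Margulis spacetime. Then there exists $\epsilon>0$ such that for all $t$ with $|t|\in(0,\epsilon)$, $\rho_t(\Gamma)$ acts properly on $\mathbb{H}^{n,n-1}$.
   Context: Linear setting. Let $n\ge2$. On $\mathbb{R}^{2n}$ with standard basis $e_1,\dots,e_{2n}$ put $\langle v\mid w\rangle=v^tI_{n,n}w$, $I_{n,n}=\mathrm{diag}(I_n,-I_n)$. $\mathsf{G}=\mathsf{SO}_0(n,n)$ is the identity component of $\mathsf{SO}(n,n)$; $\mathsf{G}_0=\{g\in\mathsf{G}:ge_{2n}=e_{2n}\}\cong\mathsf{SO}_0(n,n-1)$; $\mathbb{R}^{n,n-1}=\mathbb{R}^{2n-1}=\mathrm{span}(e_1,\dots,e_{2n-1})$; $\mathbb{H}^{n,n-1}=\mathsf{G}e_{2n}\subset\mathbb{R}^{2n}$; $\mathsf{G}_a=\mathsf{G}_0\ltimes\mathbb{R}^{2n-1}$ acts affinely on $\mathbb{R}^{2n-1}$. A null subspace of $\mathbb{R}^{n,n-1}$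 is an $n$-dimensional subspace whose orthogonal in $\mathbb{R}^{2n-1}$ is maximal isotropic. Let $W_\pm=\mathrm{span}\{e_j\pm e_{n+j}:1\le j\le n-1\}$ and $\mathsf{P}_0^\pm=\mathrm{Stab}_{\mathsf{G}_0}(W_\pm)=\mathrm{Stab}_{\mathsf{G}_0}(W_\pm^\perp\cap\mathbb{R}^{2n-1})$. Tangent vector: $U(\gamma)=\left.\frac{d}{dt}\right|_{t=0}\rho_t(\gamma)\rho(\gamma)^{-1}$, $u(\gamma)=U(\gamma)e_{2n}\in\mathbb{R}^{2n-1}$, and $(\rho,u)(\gamma)=(\rho(\gamma),u(\gamma))$, a homomorphism $\Gamma\to\mathsf{G}_a$. Analytic family: $t\mapsto\rho_t(\gamma)$ is analytic for each $\gamma$. An injective homomorphism $(\rho,u):\Gamma\to\mathsf{G}_a$ is called a Margulis spacetime if $(\rho,u)(\Gamma)\backslash\mathbb{R}^{2n-1}$ is a manifold, i.e. $(\rho,u)(\Gamma)$ acts properly discontinuously and freely on $\mathbb{R}^{2n-1}$. Gromov flow. $\partial_\infty\Gamma$ is the Gromov boundary, $\partial_\infty\Gamma^{(2)}=\{(p_+,p_-): p_+\ne p_-\}$, and $\widetilde{\mathsf{U}\Gamma}=\partial_\infty\Gamma^{(2)}\times\mathbb{R}$ with flow $\phi_t(p_+,p_-,p_0)=(p_+,p_-,p_0+t)$. It carries Gromov's proper cocompact $\Gamma$-action, commuting with $\phi$ and inducing the diagonal action on $\partial_\infty\Gamma^{(2)}$, together with a metric (well defined up to H\"older equivalence) for which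 $\Gamma$ acts by isometries, $\phi_t$ acts by Lipschitz homeomorphisms and flow orbits are quasi-isometric embeddings. For each infinite order $\gamma$ with attracting/repelling points $\gamma^\pm$ there is $l(\gamma)>0$ with $\gamma(\gamma^+,\gamma^-,t)=\phi_{l(\gamma)}(\gamma^+,\gamma^-,t)$. Anosov. $\rho:\Gamma\to\mathsf{G}_0$ is Anosov with respect to $\mathsf{P}_0^\pm$ if there are continuous injective $\rho(\Gamma)$-equivariant maps $\xi^\pm:\partial_\infty\Gamma\to\mathsf{G}_0/\mathsf{P}_0^\pm$ with $\xi(p)=(\xi^+(p_+),\xi^-(p_-))\in\mathsf{G}_0/(\mathsf{P}_0^+\cap\mathsf{P}_0^-)\subset\mathsf{G}_0/\mathsf{P}_0^+\times\mathsf{G}_0/\mathsf{P}_0^-$ for all $p=(p_+,p_-,t)\in\widetilde{\mathsf{U}\Gamma}$, and constants $C,c>0$ and a continuous $\rho(\Gamma)$-equivariant family of Euclidean norms $\|\cdot\|_p$ on $T_{\xi(p)}(\mathsf{G}_0/(\mathsf{P}_0^+\cap\mathsf{P}_0^-))$ with $\|v^\pm\|_{\phi_{\mp t}p}\le Ce^{-ct}\|v^\pm\|_p$ for $v^\pm\in T_{\xi^\pm(p_\pm)}\mathsf{G}_0/\mathsf{P}_0^\pm$, $t\ge0$. *)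

theory Defs
  imports
    "HOL-Analysis.Analysis"
    "HOL-Algebra.Left_Coset"
    "HOL-Algebra.Generated_Groups"
    "HOL-Algebra.Group_Action"
begin

section \<open>Hyperbolic groups and their Gromov boundary\<close>

definition word_length :: "('g, 'm) monoid_scheme \<Rightarrow> 'g set \<Rightarrow> 'g \<Rightarrow> nat" where
  "word_length \<Gamma> S g =
     (LEAST k. \<exists>ws. length ws = k \<and> set ws \<subseteq> S \<union> m_inv \<Gamma> ` S \<and> foldr (mult \<Gamma>) ws (one \<Gamma>) = g)"

definition word_dist :: "('g, 'm) monoid_scheme \<Rightarrow> 'g set \<Rightarrow> 'g \<Rightarrow> 'g \<Rightarrow> real" where
  "word_dist \<Gamma> S g h = real (word_length \<Gamma> S (inv\<^bsub>\<Gamma>\<^esub> g \<otimes>\<^bsub>\<Gamma>\<^esub> h))"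

definition gromov_prod :: "('g, 'm) monoid_scheme \<Rightarrow> 'g set \<Rightarrow> 'g \<Rightarrow> 'g \<Rightarrow> 'g \<Rightarrow> real" where
  "gromov_prod \<Gamma> S w x y =
     (word_dist \<Gamma> S w x + word_dist \<Gamma> S w y - word_dist \<Gamma> S x y) / 2"

text \<open>The group \<open>\<Gamma>\<close> is finitely generated by \<open>S\<close>, and the word metric of \<open>S\<close> is hyperbolic
  in the sense of Gromov (four-point condition).\<close>

definition word_hyperbolic :: "('g, 'm) monoid_scheme \<Rightarrow> 'g set \<Rightarrow> bool" where
  "word_hyperbolic \<Gamma> S \<longleftrightarrow>
     group \<Gamma> \<and> finite S \<and> S \<subseteq> carrier \<Gamma> \<and> generate \<Gamma> S = carrier \<Gamma> \<and>
     (\<exists>\<delta>. \<forall>w\<in>carrier \<Gamma>. \<forall>x\<in>carrier \<Gamma>. \<forall>y\<in>carrier \<Gamma>. \<forall>z\<in>carrier \<Gamma>.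
        min (gromov_prod \<Gamma> S w x y) (gromov_prod \<Gamma> S w y z) - \<delta> \<le> gromov_prod \<Gamma> S w x z)"

text \<open>\<open>(x\<^sub>i | y\<^sub>j) \<rightarrow> \<infinity>\<close> as \<open>i, j \<rightarrow> \<infinity>\<close>. A sequence converges at infinity if it is related to
  itself; two such sequences have the same limit if they are related to each other.\<close>

definition same_end :: "('g, 'm) monoid_scheme \<Rightarrow> 'g set \<Rightarrow> (nat \<Rightarrow> 'g) \<Rightarrow> (nat \<Rightarrow> 'g) \<Rightarrow> bool" where
  "same_end \<Gamma> S x y \<longleftrightarrow> (\<forall>r. \<exists>N. \<forall>i\<ge>N. \<forall>j\<ge>N. r \<le> gromov_prod \<Gamma> S \<one>\<^bsub>\<Gamma>\<^esub> (x i) (y j))"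

definition gromov_seqs :: "('g, 'm) monoid_scheme \<Rightarrow> 'g set \<Rightarrow> (nat \<Rightarrow> 'g) set" where
  "gromov_seqs \<Gamma> S = {x. range x \<subseteq> carrier \<Gamma> \<and> same_end \<Gamma> S x x}"

definition end_class :: "('g, 'm) monoid_scheme \<Rightarrow> 'g set \<Rightarrow> (nat \<Rightarrow> 'g) \<Rightarrow> (nat \<Rightarrow> 'g) set" where
  "end_class \<Gamma> S x = {y \<in> gromov_seqs \<Gamma> S. same_end \<Gamma> S x y}"

definition boundary :: "('g, 'm) monoid_scheme \<Rightarrow> 'g set \<Rightarrow> (nat \<Rightarrow> 'g) set set" where
  "boundary \<Gamma> S = end_class \<Gamma> S ` gromov_seqs \<Gamma> S"

text \<open>The usual neighbourhoods of \<open>p\<close>: boundary points \<open>q\<close> such that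
  \<open>liminf (x\<^sub>i | y\<^sub>j)\<close> is large for some representatives \<open>x\<close> of \<open>p\<close> and \<open>y\<close> of \<open>q\<close>.\<close>

definition boundary_nbhd ::
  "('g, 'm) monoid_scheme \<Rightarrow> 'g set \<Rightarrow> real \<Rightarrow> (nat \<Rightarrow> 'g) set \<Rightarrow> (nat \<Rightarrow> 'g) set set" where
  "boundary_nbhd \<Gamma> S r p =
     {q \<in> boundary \<Gamma> S. \<exists>x\<in>p. \<exists>y\<in>q. \<exists>N. \<forall>i\<ge>N. \<forall>j\<ge>N.
        r \<le> gromov_prod \<Gamma> S \<one>\<^bsub>\<Gamma>\<^esub> (x i) (y j)}"

definition boundary_topology ::
  "('g, 'm) monoid_scheme \<Rightarrow> 'g set \<Rightarrow> (nat \<Rightarrow> 'g) set topology" where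
  "boundary_topology \<Gamma> S =
     topology (\<lambda>U. U \<subseteq> boundary \<Gamma> S \<and> (\<forall>p\<in>U. \<exists>r. boundary_nbhd \<Gamma> S r p \<subseteq> U))"

lemma openin_boundary_topology:
  "openin (boundary_topology \<Gamma> S) U \<longleftrightarrow>
     U \<subseteq> boundary \<Gamma> S \<and> (\<forall>p\<in>U. \<exists>r. boundary_nbhd \<Gamma> S r p \<subseteq> U)"
proof -
  let ?P = "\<lambda>U. U \<subseteq> boundary \<Gamma> S \<and> (\<forall>p\<in>U. \<exists>r. boundary_nbhd \<Gamma> S r p \<subseteq> U)"
  have mono: "boundary_nbhd \<Gamma> S r p \<subseteq> boundary_nbhd \<Gamma> S s p" if "s \<le> r" for r s p
    using that unfolding boundary_nbhd_def by (auto; meson order_trans)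
  have "?P (U \<inter> V)" if U: "?P U" and V: "?P V" for U V
  proof (intro conjI ballI)
    show "U \<inter> V \<subseteq> boundary \<Gamma> S" using U by blast
    fix p assume "p \<in> U \<inter> V"
    then obtain r s where "boundary_nbhd \<Gamma> S r p \<subseteq> U" "boundary_nbhd \<Gamma> S s p \<subseteq> V"
      using U V by blast
    then have "boundary_nbhd \<Gamma> S (max r s) p \<subseteq> U \<inter> V"
      using mono[of r "max r s" p] mono[of s "max r s" p] by auto
    then show "\<exists>r. boundary_nbhd \<Gamma> S r p \<subseteq> U \<inter> V" by blast
  qed
  moreover have "?P (\<Union>\<K>)" if K: "\<forall>K\<in>\<K>. ?P K" for \<K>
    using K by (auto; meson Union_upper order_trans)
  ultimately have "istopology ?P"
    unfolding istopology_def by blast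
  then show ?thesis
    unfolding boundary_topology_def by simp
qed

lemma topspace_boundary_topology: "topspace (boundary_topology \<Gamma> S) = boundary \<Gamma> S"
proof -
  have "openin (boundary_topology \<Gamma> S) (boundary \<Gamma> S)"
    unfolding openin_boundary_topology boundary_nbhd_def by blast
  then show ?thesis
    by (metis openin_boundary_topology openin_subset openin_topspace subset_antisym)
qed

definition boundary_act :: "('g, 'm) monoid_scheme \<Rightarrow> 'g \<Rightarrow> (nat \<Rightarrow> 'g) set \<Rightarrow> (nat \<Rightarrow> 'g) set" where
  "boundary_act \<Gamma> \<gamma> p = (\<lambda>x i. \<gamma> \<otimes>\<^bsub>\<Gamma>\<^esub> x i) ` p"

text \<open>\<open>\<gamma>\<^sup>+ = lim \<gamma>\<^sup>i\<close> and \<open>\<gamma>\<^sup>- = lim \<gamma>\<^sup>-\<^sup>i\<close>, for \<open>\<gamma>\<close> of infinite order.\<close>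

definition attracting :: "('g, 'm) monoid_scheme \<Rightarrow> 'g set \<Rightarrow> 'g \<Rightarrow> (nat \<Rightarrow> 'g) set" where
  "attracting \<Gamma> S \<gamma> = end_class \<Gamma> S (\<lambda>i. \<gamma> [^]\<^bsub>\<Gamma>\<^esub> i)"

definition repelling :: "('g, 'm) monoid_scheme \<Rightarrow> 'g set \<Rightarrow> 'g \<Rightarrow> (nat \<Rightarrow> 'g) set" where
  "repelling \<Gamma> S \<gamma> = end_class \<Gamma> S (\<lambda>i. (inv\<^bsub>\<Gamma>\<^esub> \<gamma>) [^]\<^bsub>\<Gamma>\<^esub> i)"


section \<open>Proper and free actions\<close>

text \<open>\<open>H\<close> is regarded as a discrete group acting on \<open>X\<close> through \<open>a\<close>.\<close>

definition acts_properly :: "'h set \<Rightarrow> 'x topology \<Rightarrow> ('h \<Rightarrow> 'x \<Rightarrow> 'x) \<Rightarrow> bool" where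
  "acts_properly H X a \<longleftrightarrow> (\<forall>K. compactin X K \<longrightarrow> finite {h \<in> H. a h ` K \<inter> K \<noteq> {}})"

definition acts_freely :: "('h, 'm) monoid_scheme \<Rightarrow> 'h set \<Rightarrow> 'x set \<Rightarrow> ('h \<Rightarrow> 'x \<Rightarrow> 'x) \<Rightarrow> bool" where
  "acts_freely G H X a \<longleftrightarrow> (\<forall>h\<in>H. \<forall>x\<in>X. a h x = x \<longrightarrow> h = \<one>\<^bsub>G\<^esub>)"


section \<open>The Gromov flow\<close>

type_synonym 'g flow_pt = "((nat \<Rightarrow> 'g) set \<times> (nat \<Rightarrow> 'g) set) \<times> real"

definition boundary_pairs ::
  "('g, 'm) monoid_scheme \<Rightarrow> 'g set \<Rightarrow> ((nat \<Rightarrow> 'g) set \<times> (nat \<Rightarrow> 'g) set) set" where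
  "boundary_pairs \<Gamma> S = {(p, q). p \<in> boundary \<Gamma> S \<and> q \<in> boundary \<Gamma> S \<and> p \<noteq> q}"

definition flow_topology :: "('g, 'm) monoid_scheme \<Rightarrow> 'g set \<Rightarrow> 'g flow_pt topology" where
  "flow_topology \<Gamma> S =
     prod_topology
       (subtopology (prod_topology (boundary_topology \<Gamma> S) (boundary_topology \<Gamma> S))
          (boundary_pairs \<Gamma> S))
       euclideanreal"

definition flow :: "real \<Rightarrow> 'g flow_pt \<Rightarrow> 'g flow_pt" where
  "flow t = (\<lambda>(p, s). (p, s + t))"

text \<open>\<open>act\<close> is an action of \<open>\<Gamma>\<close> with the properties of Gromov's action on
  \<open>\<partial>\<^sub>\<infinity>\<Gamma>\<^sup>(\<^sup>2\<^sup>) \<times> \<real>\<close>. The metric \<open>d\<close>, which is only well defined up to Hoelder equivalence,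
  is not part of the data.\<close>

definition gromov_flow ::
  "('g, 'm) monoid_scheme \<Rightarrow> 'g set \<Rightarrow> ('g \<Rightarrow> 'g flow_pt \<Rightarrow> 'g flow_pt) \<Rightarrow> bool" where
  "gromov_flow \<Gamma> S act \<longleftrightarrow>
     (let X = flow_topology \<Gamma> S in
        group_action \<Gamma> (topspace X) act \<and>
        (\<forall>\<gamma>\<in>carrier \<Gamma>. continuous_map X X (act \<gamma>)) \<and>
        acts_properly (carrier \<Gamma>) X act \<and>
        (\<exists>K. compactin X K \<and> (\<Union>\<gamma>\<in>carrier \<Gamma>. act \<gamma> ` K) = topspace X) \<and>
        (\<forall>\<gamma>\<in>carrier \<Gamma>. \<forall>x\<in>topspace X. \<forall>t. act \<gamma> (flow t x) = flow t (act \<gamma> x)) \<and>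
        (\<forall>\<gamma>\<in>carrier \<Gamma>. \<forall>p q s. ((p, q), s) \<in> topspace X \<longrightarrow>
           fst (act \<gamma> ((p, q), s)) = (boundary_act \<Gamma> \<gamma> p, boundary_act \<Gamma> \<gamma> q)) \<and>
        (\<forall>\<gamma>\<in>carrier \<Gamma>. (\<forall>k>0. \<gamma> [^]\<^bsub>\<Gamma>\<^esub> (k::nat) \<noteq> \<one>\<^bsub>\<Gamma>\<^esub>) \<longrightarrow>
           (\<exists>l>0. \<forall>t. act \<gamma> ((attracting \<Gamma> S \<gamma>, repelling \<Gamma> S \<gamma>), t) =
              flow l ((attracting \<Gamma> S \<gamma>, repelling \<Gamma> S \<gamma>), t))) \<and>
        (\<exists>d. Metric_space (topspace X) d \<and> Metric_space.mtopology (topspace X) d = X \<and>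
           (\<forall>\<gamma>\<in>carrier \<Gamma>. \<forall>x\<in>topspace X. \<forall>y\<in>topspace X. d (act \<gamma> x) (act \<gamma> y) = d x y) \<and>
           (\<forall>t. \<exists>L. \<forall>x\<in>topspace X. \<forall>y\<in>topspace X. d (flow t x) (flow t y) \<le> L * d x y) \<and>
           (\<forall>x\<in>topspace X. \<exists>A\<ge>1. \<exists>B\<ge>0. \<forall>s t.
              \<bar>s - t\<bar> / A - B \<le> d (flow s x) (flow t x) \<and>
              d (flow s x) (flow t x) \<le> A * \<bar>s - t\<bar> + B)))"


section \<open>The groups \<open>SO\<^sub>0(n,n)\<close> and \<open>SO\<^sub>0(n,n-1)\<close>\<close>

text \<open>Here \<open>n = CARD('n)\<close>. Listing the elements of \<open>'n\<close> in increasing order, the \<open>j\<close>-th one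
  gives the indices \<open>Inl j\<close> of \<open>e\<^sub>j\<close> and \<open>Inr j\<close> of \<open>e\<^sub>n\<^sub>+\<^sub>j\<close>, so \<open>e\<^sub>2\<^sub>n\<close> belongs to
  \<open>Inr (Max UNIV)\<close>.\<close>

type_synonym 'n dvec = "real ^ ('n + 'n)"
type_synonym 'n dmat = "real ^ ('n + 'n) ^ ('n + 'n)"

definition e2n :: "('n::{finite,linorder}) dvec" where
  "e2n = axis (Inr (Max UNIV)) 1"

definition Inn :: "('n::finite) dmat" where
  "Inn = (\<chi> i j. if i = j then (case i of Inl _ \<Rightarrow> 1 | Inr _ \<Rightarrow> -1) else 0)"

definition nnform :: "('n::finite) dvec \<Rightarrow> 'n dvec \<Rightarrow> real" where
  "nnform v w = v \<bullet> (Inn *v w)"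

definition SOnn :: "('n::finite) dmat set" where
  "SOnn = {g. (\<forall>v w. nnform (g *v v) (g *v w) = nnform v w) \<and> det g = 1}"

definition GG :: "('n::finite) dmat monoid" where
  "GG = \<lparr>carrier = connected_component_set SOnn (mat 1), mult = (**), one = mat 1\<rparr>"

definition G0 :: "('n::{finite,linorder}) dmat monoid" where
  "G0 = \<lparr>carrier = {g \<in> carrier GG. g *v e2n = e2n}, mult = (**), one = mat 1\<rparr>"

definition Hnn :: "('n::{finite,linorder}) dvec set" where
  "Hnn = (\<lambda>g. g *v e2n) ` carrier GG"

text \<open>\<open>\<real>\<^sup>2\<^sup>n\<^sup>-\<^sup>1\<close>, as a subspace of \<open>\<real>\<^sup>2\<^sup>n\<close>.\<close>

definition R0 :: "('n::{finite,linorder}) dvec set" where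
  "R0 = span {axis i 1 | i. i \<noteq> Inr (Max UNIV)}"

definition orth0 :: "('n::{finite,linorder}) dvec set \<Rightarrow> 'n dvec set" where
  "orth0 V = {x \<in> R0. \<forall>y\<in>V. nnform x y = 0}"

text \<open>\<open>W\<^sub>+ = Wsub 1\<close> and \<open>W\<^sub>- = Wsub (-1)\<close>.\<close>

definition Wsub :: "real \<Rightarrow> ('n::{finite,linorder}) dvec set" where
  "Wsub \<sigma> = span {axis (Inl j) 1 + \<sigma> *\<^sub>R axis (Inr j) 1 | j. j \<noteq> Max UNIV}"

definition stab0 :: "('n::{finite,linorder}) dvec set \<Rightarrow> 'n dmat set" where
  "stab0 V = {g \<in> carrier G0. (*v) g ` V = V}"

definition P0plus :: "('n::{finite,linorder}) dmat set" where
  "P0plus = stab0 (Wsub 1)"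

definition P0minus :: "('n::{finite,linorder}) dmat set" where
  "P0minus = stab0 (Wsub (-1))"

text \<open>\<open>P\<^sub>0\<^sup>\<plusminus>\<close> are the stabilizers of the null subspaces \<open>W\<^sub>\<plusminus>\<^sup>\<bottom> \<inter> \<real>\<^sup>2\<^sup>n\<^sup>-\<^sup>1\<close>, see
  \<open>null_subspace_orth0_Wsub\<close> and \<open>stab0_Wsub\<close> below.\<close>

definition isotropic0 :: "('n::{finite,linorder}) dvec set \<Rightarrow> bool" where
  "isotropic0 V \<longleftrightarrow> subspace V \<and> V \<subseteq> R0 \<and> (\<forall>x\<in>V. \<forall>y\<in>V. nnform x y = 0)"

definition null_subspace :: "('n::{finite,linorder}) dvec set \<Rightarrow> bool" where
  "null_subspace V \<longleftrightarrow> subspace V \<and> V \<subseteq> R0 \<and> dim V = CARD('n) \<and>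
     isotropic0 (orth0 V) \<and> (\<forall>I. isotropic0 I \<and> orth0 V \<subseteq> I \<longrightarrow> I = orth0 V)"

lemma nnform_eq:
  "nnform v w = (\<Sum>j\<in>UNIV. v $ Inl j * w $ Inl j) - (\<Sum>j\<in>UNIV. v $ Inr j * w $ Inr j)"
  for v :: "('n::finite) dvec"
proof -
  have mv: "(Inn *v w) $ i = (case i of Inl _ \<Rightarrow> 1 | Inr _ \<Rightarrow> -1) * w $ i" for i
    by (simp add: Inn_def matrix_vector_mult_def if_distrib[of "\<lambda>x. x * _"] sum.delta cong: if_cong)
  have "nnform v w = (\<Sum>i\<in>UNIV. v $ i * (Inn *v w) $ i)"
    by (simp add: nnform_def inner_vec_def)
  also have "\<dots> = (\<Sum>i\<in>UNIV. v $ i * ((case i of Inl _ \<Rightarrow> 1 | Inr _ \<Rightarrow> -1) * w $ i))"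
    by (simp only: mv)
  also have "\<dots> = (\<Sum>j\<in>UNIV. v $ Inl j * w $ Inl j) + (\<Sum>j\<in>UNIV. - (v $ Inr j * w $ Inr j))"
    unfolding UNIV_sum[where 'a='n and 'b='n]
    by (subst sum.union_disjoint) (auto simp: sum.reindex)
  finally show ?thesis by (simp add: sum_negf)
qed

lemma R0_eq: "R0 = {x :: ('n::{finite,linorder}) dvec. x $ Inr (Max UNIV) = 0}"
proof
  have "subspace {x :: 'n dvec. x $ Inr (Max UNIV) = 0}"
    by (simp add: subspace_def)
  moreover have "{axis i 1 | i. i \<noteq> Inr (Max UNIV)} \<subseteq> {x :: 'n dvec. x $ Inr (Max UNIV) = 0}"
    by (auto simp: axis_def)
  ultimately show "R0 \<subseteq> {x :: 'n dvec. x $ Inr (Max UNIV) = 0}"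
    unfolding R0_def by (rule span_minimal[rotated])
  show "{x :: 'n dvec. x $ Inr (Max UNIV) = 0} \<subseteq> R0"
  proof
    fix x :: "'n dvec" assume "x \<in> {x. x $ Inr (Max UNIV) = 0}"
    then have x0: "x $ Inr (Max UNIV) = 0" by simp
    have "(\<Sum>i\<in>UNIV. (x $ i) *\<^sub>R (axis i 1 :: 'n dvec)) \<in> R0"
    proof (rule subspace_sum)
      show "subspace (R0 :: 'n dvec set)" by (simp add: R0_def)
      show "(x $ i) *\<^sub>R axis i 1 \<in> R0" for i
        using x0 unfolding R0_def
        by (cases "i = Inr (Max UNIV)") (simp add: span_zero, blast intro: span_scale span_base)
    qed
    moreover have "(\<Sum>i\<in>UNIV. (x $ i) *\<^sub>R (axis i 1 :: 'n dvec)) = x"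
      by (simp add: vec_eq_iff axis_def if_distrib sum.delta cong: if_cong)
    ultimately show "x \<in> R0" by simp
  qed
qed

lemma Wsub_eq:
  "Wsub \<sigma> = {x :: ('n::{finite,linorder}) dvec.
     x $ Inl (Max UNIV) = 0 \<and> (\<forall>j. x $ Inr j = \<sigma> * x $ Inl j)}" (is "_ = ?W")
proof
  have "subspace ?W"
    by (simp add: subspace_def algebra_simps)
  moreover have "{axis (Inl j) 1 + \<sigma> *\<^sub>R axis (Inr j) 1 | j. j \<noteq> Max UNIV} \<subseteq> ?W"
    by (auto simp: axis_def)
  ultimately show "Wsub \<sigma> \<subseteq> ?W"
    unfolding Wsub_def by (rule span_minimal[rotated])
  show "?W \<subseteq> Wsub \<sigma>"
  proof
    fix x :: "'n dvec" assume x: "x \<in> ?W"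
    define b :: "'n \<Rightarrow> 'n dvec" where "b j = axis (Inl j) 1 + \<sigma> *\<^sub>R axis (Inr j) 1" for j
    have "(\<Sum>j\<in>UNIV. (x $ Inl j) *\<^sub>R b j) \<in> Wsub \<sigma>"
    proof (rule subspace_sum)
      show "subspace (Wsub \<sigma> :: 'n dvec set)" by (simp add: Wsub_def)
      show "(x $ Inl j) *\<^sub>R b j \<in> Wsub \<sigma>" for j
        using x unfolding Wsub_def b_def
        by (cases "j = Max UNIV") (simp add: span_zero, blast intro: span_scale span_base)
    qed
    moreover have "(\<Sum>j\<in>UNIV. (x $ Inl j) *\<^sub>R b j) $ i = x $ i" for i
      using x by (cases i)
        (auto simp: b_def axis_def if_distrib[of "\<lambda>z. _ * z"] sum.delta mult.commute cong: if_cong)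
    then have "(\<Sum>j\<in>UNIV. (x $ Inl j) *\<^sub>R b j) = x" by (simp add: vec_eq_iff)
    ultimately show "x \<in> Wsub \<sigma>" by simp
  qed
qed

lemma nnform_axis:
  "nnform x (axis (Inl j) a + axis (Inr k) b) = x $ Inl j * a - x $ Inr k * b"
  for x :: "('n::finite) dvec"
  unfolding nnform_eq
  by (simp add: axis_def if_distrib[of "\<lambda>z. _ * z"] sum.delta cong: if_cong)

lemma orth0_Wsub_eq:
  assumes "\<sigma> * \<sigma> = 1"
  shows "orth0 (Wsub \<sigma>) = {x :: ('n::{finite,linorder}) dvec.
     x $ Inr (Max UNIV) = 0 \<and> (\<forall>j. j \<noteq> Max UNIV \<longrightarrow> x $ Inr j = \<sigma> * x $ Inl j)}" (is "_ = ?N")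
proof
  have \<sigma>: "\<sigma> * (\<sigma> * a) = a" for a using assms by (simp add: mult.assoc[symmetric])
  show "orth0 (Wsub \<sigma>) \<subseteq> ?N"
  proof
    fix x :: "'n dvec" assume x: "x \<in> orth0 (Wsub \<sigma>)"
    have "x $ Inr j = \<sigma> * x $ Inl j" if j: "j \<noteq> Max UNIV" for j
    proof -
      have "axis (Inl j) 1 + axis (Inr j) \<sigma> \<in> Wsub \<sigma>"
        using j by (auto simp: Wsub_eq axis_def)
      then have "nnform x (axis (Inl j) 1 + axis (Inr j) \<sigma>) = 0"
        using x by (auto simp: orth0_def)
      then have "x $ Inl j = x $ Inr j * \<sigma>" by (simp add: nnform_axis)
      then have "\<sigma> * x $ Inl j = \<sigma> * (\<sigma> * x $ Inr j)" by (simp add: mult.commute)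
      then show ?thesis by (simp add: \<sigma>)
    qed
    then show "x \<in> ?N" using x by (auto simp: orth0_def R0_eq)
  qed
  show "?N \<subseteq> orth0 (Wsub \<sigma>)"
  proof
    fix x :: "'n dvec" assume x: "x \<in> ?N"
    have "nnform x y = 0" if y: "y \<in> Wsub \<sigma>" for y
    proof -
      have "x $ Inl j * y $ Inl j - x $ Inr j * y $ Inr j = 0" for j
      proof (cases "j = Max UNIV")
        case True then show ?thesis using x y by (simp add: Wsub_eq)
      next
        case False
        then have "x $ Inr j * y $ Inr j = (\<sigma> * \<sigma>) * (x $ Inl j * y $ Inl j)"
          using x y by (simp add: Wsub_eq)
        then show ?thesis by (simp add: assms)
      qed
      then show ?thesis
        unfolding nnform_eq by (simp add: sum_subtractf[symmetric])
    qed
    then show "x \<in> orth0 (Wsub \<sigma>)" using x by (auto simp: orth0_def R0_eq)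
  qed
qed

lemma orth0_orth0_Wsub:
  assumes "\<sigma> * \<sigma> = 1"
  shows "orth0 (orth0 (Wsub \<sigma>)) = (Wsub \<sigma> :: ('n::{finite,linorder}) dvec set)"
proof
  have \<sigma>: "\<sigma> * (\<sigma> * a) = a" for a using assms by (simp add: mult.assoc[symmetric])
  have sym: "nnform x y = nnform y x" for x y :: "'n dvec"
    by (simp add: nnform_eq mult.commute)
  have "Wsub \<sigma> \<subseteq> (R0 :: 'n dvec set)" by (auto simp: Wsub_eq R0_eq)
  then show "Wsub \<sigma> \<subseteq> (orth0 (orth0 (Wsub \<sigma>)) :: 'n dvec set)"
    unfolding orth0_def using sym by fastforce
  show "(orth0 (orth0 (Wsub \<sigma>)) :: 'n dvec set) \<subseteq> Wsub \<sigma>"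
  proof
    fix x :: "'n dvec" assume x: "x \<in> orth0 (orth0 (Wsub \<sigma>))"
    have x0: "x $ Inr (Max UNIV) = 0" using x by (simp add: orth0_def R0_eq)
    have *: "x $ Inl j - x $ Inr j * b = 0" if "b = (if j = Max UNIV then 0 else \<sigma>)" for j b
    proof -
      have "axis (Inl j) 1 + axis (Inr j) b \<in> (orth0 (Wsub \<sigma>) :: 'n dvec set)"
        using that by (auto simp: orth0_Wsub_eq[OF assms] axis_def)
      then have "nnform x (axis (Inl j) 1 + axis (Inr j) b) = 0"
        using x by (auto simp: orth0_def[of "orth0 _"])
      then show ?thesis by (simp add: nnform_axis)
    qed
    have l: "x $ Inl (Max UNIV) = 0" using *[of 0 "Max UNIV"] by simp
    have "x $ Inr j = \<sigma> * x $ Inl j" for j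
    proof (cases "j = Max UNIV")
      case False
      then have "x $ Inl j = \<sigma> * x $ Inr j" using *[of \<sigma> j] by (simp add: mult.commute)
      then show ?thesis by (simp add: \<sigma>)
    qed (simp add: l x0)
    with l show "x \<in> Wsub \<sigma>" by (simp add: Wsub_eq)
  qed
qed

lemma null_subspace_orth0_Wsub:
  assumes "\<sigma> * \<sigma> = 1"
  shows "null_subspace (orth0 (Wsub \<sigma>) :: ('n::{finite,linorder}) dvec set)"
proof -
  let ?N = "orth0 (Wsub \<sigma>) :: 'n dvec set"
  let ?m = "Max UNIV :: 'n"
  have sub: "subspace ?N"
    unfolding orth0_Wsub_eq[OF assms] by (simp add: subspace_def algebra_simps)
  define f :: "real ^ ('n::{finite,linorder}) \<Rightarrow> 'n dvec" where
    "f v = (\<chi> i. case i of Inl j \<Rightarrow> v $ j | Inr j \<Rightarrow> if j = ?m then 0 else \<sigma> * v $ j)" for v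
  have lin: "linear f"
    by (rule linearI) (auto simp: f_def vec_eq_iff algebra_simps split: sum.splits)
  have inj: "inj f"
  proof (rule injI)
    fix v w assume "f v = f w"
    then have "f v $ Inl j = f w $ Inl j" for j by simp
    then show "v = w" by (simp add: f_def vec_eq_iff)
  qed
  have "range f = ?N"
  proof
    show "range f \<subseteq> ?N" by (auto simp: f_def orth0_Wsub_eq[OF assms])
    show "?N \<subseteq> range f"
    proof
      fix x assume x: "x \<in> ?N"
      have "x = f (\<chi> j. x $ Inl j)"
        using x by (auto simp: f_def vec_eq_iff orth0_Wsub_eq[OF assms] split: sum.splits)
      then show "x \<in> range f" by blast
    qed
  qed
  then have dim: "dim ?N = CARD('n)"
    using dim_image_eq[OF lin, of UNIV] inj by (simp add: dim_UNIV)
  have form0: "nnform x y = 0" if "x \<in> ?N" "y \<in> Wsub \<sigma>" for x y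
    using that by (auto simp: orth0_def)
  have WN: "Wsub \<sigma> \<subseteq> ?N"
    unfolding orth0_Wsub_eq[OF assms] by (auto simp: Wsub_eq)
  have NR0: "?N \<subseteq> R0" unfolding orth0_def by blast
  have iso: "isotropic0 (Wsub \<sigma> :: 'n dvec set)"
  proof -
    have "subspace (Wsub \<sigma> :: 'n dvec set)" by (simp add: Wsub_def)
    then show ?thesis using WN NR0 form0 unfolding isotropic0_def by blast
  qed
  have max: "I = Wsub \<sigma>" if I: "isotropic0 I" "Wsub \<sigma> \<subseteq> I" for I :: "'n dvec set"
  proof
    show "I \<subseteq> Wsub \<sigma>"
    proof
      fix x assume x: "x \<in> I"
      have xN: "x \<in> ?N"
      proof -
        have "nnform x y = 0" if "y \<in> Wsub \<sigma>" for y
          using that x I unfolding isotropic0_def by (meson subsetD)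
        moreover have "x \<in> R0" using x I unfolding isotropic0_def by (meson subsetD)
        ultimately show ?thesis unfolding orth0_def by simp
      qed
      have "nnform x x = 0" using x I unfolding isotropic0_def by blast
      moreover have "nnform x x = x $ Inl ?m * x $ Inl ?m"
      proof -
        have "nnform x x = (\<Sum>j\<in>UNIV. x $ Inl j * x $ Inl j - x $ Inr j * x $ Inr j)"
          by (simp add: nnform_eq sum_subtractf)
        also have "\<dots> = (\<Sum>j\<in>UNIV. if j = ?m then x $ Inl j * x $ Inl j else 0)"
        proof (rule sum.cong[OF refl])
          fix j :: 'n
          show "x $ Inl j * x $ Inl j - x $ Inr j * x $ Inr j
              = (if j = ?m then x $ Inl j * x $ Inl j else 0)"
          proof (cases "j = ?m")
            case False
            then have "x $ Inr j * x $ Inr j = (\<sigma> * \<sigma>) * (x $ Inl j * x $ Inl j)"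
              using xN by (simp add: orth0_Wsub_eq[OF assms])
            then show ?thesis using False by (simp add: assms)
          qed (use xN in \<open>simp add: orth0_Wsub_eq[OF assms]\<close>)
        qed
        finally show ?thesis by simp
      qed
      ultimately have l: "x $ Inl ?m = 0" by simp
      moreover have "x $ Inr j = \<sigma> * x $ Inl j" for j
        using xN l by (cases "j = ?m") (auto simp: orth0_Wsub_eq[OF assms])
      ultimately show "x \<in> Wsub \<sigma>"
        by (simp add: Wsub_eq)
    qed
  qed (use I in blast)
  show ?thesis
    unfolding null_subspace_def orth0_orth0_Wsub[OF assms]
    by (intro conjI allI impI sub NR0 dim iso) (rule max; simp)
qed

lemma nnform_G0:
  assumes "g \<in> carrier (G0 :: ('n::{finite,linorder}) dmat monoid)"
  shows "nnform (g *v v) (g *v w) = nnform v w"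
  using assms connected_component_subset[of SOnn "mat 1"]
  by (auto simp: G0_def GG_def SOnn_def)

lemma image_orth0_G0:
  assumes g: "g \<in> carrier (G0 :: ('n::{finite,linorder}) dmat monoid)" and V: "(*v) g ` V = V"
  shows "(*v) g ` orth0 V = orth0 V"
proof -
  let ?m = "Inr (Max UNIV) :: 'n + 'n"
  have R0_iff: "x \<in> R0 \<longleftrightarrow> nnform x e2n = 0" for x :: "'n dvec"
  proof -
    have "axis (Inl undefined) 0 + axis (Inr (Max UNIV)) 1 = (e2n :: 'n dvec)"
      by (simp add: e2n_def axis_def vec_eq_iff)
    then have "nnform x e2n = - x $ Inr (Max UNIV)"
      using nnform_axis[of x undefined 0 "Max UNIV" 1] by simp
    then show ?thesis by (simp add: R0_eq)
  qed
  have ge: "g *v e2n = e2n" using g by (simp add: G0_def)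
  have R0_g: "g *v x \<in> R0 \<longleftrightarrow> x \<in> R0" for x
    using nnform_G0[OF g, of x e2n] by (simp add: R0_iff ge)
  have "det g = 1"
    using g connected_component_subset[of SOnn "mat 1"] by (auto simp: G0_def GG_def SOnn_def)
  then have "invertible g" by (simp add: invertible_det_nz)
  then have "g ** matrix_inv g = mat 1"
    unfolding invertible_def matrix_inv_def by (rule someI2_ex) blast
  then have surj: "g *v (matrix_inv g *v x) = x" for x
    by (simp add: matrix_vector_mul_assoc)
  have orth_g: "g *v x \<in> orth0 V \<longleftrightarrow> x \<in> orth0 V" for x
  proof -
    have "(\<forall>y\<in>V. nnform (g *v x) y = 0) \<longleftrightarrow> (\<forall>y\<in>(*v) g ` V. nnform (g *v x) y = 0)"
      by (simp only: V)
    also have "\<dots> \<longleftrightarrow> (\<forall>y\<in>V. nnform x y = 0)" by (simp add: nnform_G0[OF g])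
    finally show ?thesis by (simp add: orth0_def R0_g)
  qed
  show ?thesis
  proof
    show "(*v) g ` orth0 V \<subseteq> orth0 V" using orth_g by blast
    show "orth0 V \<subseteq> (*v) g ` orth0 V"
    proof
      fix x assume "x \<in> orth0 V"
      then have "matrix_inv g *v x \<in> orth0 V" using orth_g[of "matrix_inv g *v x"] surj by simp
      then show "x \<in> (*v) g ` orth0 V" using surj[of x] by (metis imageI)
    qed
  qed
qed

lemma stab0_Wsub:
  assumes "\<sigma> * \<sigma> = 1"
  shows "stab0 (Wsub \<sigma>) = (stab0 (orth0 (Wsub \<sigma>)) :: ('n::{finite,linorder}) dmat set)"
  using image_orth0_G0[of _ "Wsub \<sigma>"] image_orth0_G0[of _ "orth0 (Wsub \<sigma>)"]
  unfolding stab0_def orth0_orth0_Wsub[OF assms] by blast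


section \<open>Homogeneous spaces and Anosov representations\<close>

text \<open>The quotient topology on \<open>H/P\<close>.\<close>

definition coset_topology ::
  "'x::topological_space monoid \<Rightarrow> 'x set \<Rightarrow> 'x set topology" where
  "coset_topology H P =
     topology (\<lambda>U. U \<subseteq> lcosets\<^bsub>H\<^esub> P \<and>
        openin (top_of_set (carrier H)) {h \<in> carrier H. h <#\<^bsub>H\<^esub> P \<in> U})"

lemma openin_coset_topology:
  "openin (coset_topology H P) U \<longleftrightarrow>
     U \<subseteq> lcosets\<^bsub>H\<^esub> P \<and> openin (top_of_set (carrier H)) {h \<in> carrier H. h <#\<^bsub>H\<^esub> P \<in> U}"
proof -
  let ?Q = "\<lambda>U. {h \<in> carrier H. h <#\<^bsub>H\<^esub> P \<in> U}"
  have int: "?Q (U \<inter> V) = ?Q U \<inter> ?Q V" for U V by blast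
  have un: "?Q (\<Union>\<K>) = \<Union> (?Q ` \<K>)" for \<K> by blast
  have "istopology (\<lambda>U. U \<subseteq> lcosets\<^bsub>H\<^esub> P \<and> openin (top_of_set (carrier H)) (?Q U))"
    unfolding istopology_def int un by (blast intro: openin_Int openin_Union)
  then show ?thesis
    unfolding coset_topology_def by simp
qed

text \<open>The Lie algebra of a closed matrix group.\<close>

definition lie_algebra :: "(real ^ 'k ^ 'k::finite) set \<Rightarrow> (real ^ 'k ^ 'k) set" where
  "lie_algebra H = {X. \<exists>c. (\<forall>t::real. c t \<in> H) \<and> c 0 = mat 1 \<and> (c has_vector_derivative X) (at 0)}"

definition coset_stab :: "'x monoid \<Rightarrow> 'x set \<Rightarrow> 'x set" where
  "coset_stab H x = {h \<in> carrier H. h <#\<^bsub>H\<^esub> x = x}"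

text \<open>\<open>N\<close> is the pullback to \<open>V\<close> of a Euclidean norm on the quotient space \<open>V/W\<close>.
  (Every symmetric bilinear form on a subspace extends to the whole space.)\<close>

definition euclidean_norm_mod ::
  "'v::real_vector set \<Rightarrow> 'v set \<Rightarrow> ('v \<Rightarrow> real) \<Rightarrow> bool" where
  "euclidean_norm_mod V W N \<longleftrightarrow>
     (\<exists>B :: 'v \<Rightarrow> 'v \<Rightarrow> real. bilinear B \<and> (\<forall>x y. B x y = B y x) \<and>
        (\<forall>x\<in>V. B x x \<ge> 0 \<and> N x = sqrt (B x x) \<and> (B x x = 0 \<longleftrightarrow> x \<in> W)))"

text \<open>The tangent space of a homogeneous space of \<open>H\<close> at a point \<open>x\<close> is
  \<open>lie_algebra H / lie_algebra (Stab x)\<close>, the class of \<open>X\<close> being the velocity at \<open>0\<close> of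
  \<open>t \<mapsto> exp (tX) x\<close>; then \<open>h \<in> H\<close> maps \<open>T\<^sub>x\<close> to \<open>T\<^sub>h\<^sub>x\<close> by \<open>X \<mapsto> hXh\<^sup>-\<^sup>1\<close>. The isotropy group of
  the point \<open>(x\<^sup>+, x\<^sup>-)\<close> of \<open>H/(P\<^sup>+ \<inter> P\<^sup>-) \<subseteq> H/P\<^sup>+ \<times> H/P\<^sup>-\<close> is \<open>Stab x\<^sup>+ \<inter> Stab x\<^sup>-\<close>, and a vector
  tangent to the factor \<open>H/P\<^sup>+\<close> is one with zero component in \<open>H/P\<^sup>-\<close>, that is, the class of
  some \<open>X \<in> lie_algebra (Stab x\<^sup>-)\<close>; and similarly with the signs exchanged.
  \<open>N ((p, q), s)\<close> is the norm on the tangent space at \<open>(\<xi>\<^sup>+(p), \<xi>\<^sup>-(q))\<close>, as a function on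
  \<open>lie_algebra H\<close>.\<close>

definition anosov ::
  "('g, 'm) monoid_scheme \<Rightarrow> 'g set \<Rightarrow> ('g \<Rightarrow> 'g flow_pt \<Rightarrow> 'g flow_pt) \<Rightarrow>
   (real ^ 'k ^ 'k::finite) monoid \<Rightarrow> (real ^ 'k ^ 'k) set \<Rightarrow> (real ^ 'k ^ 'k) set \<Rightarrow>
   ('g \<Rightarrow> real ^ 'k ^ 'k) \<Rightarrow> bool" where
  "anosov \<Gamma> S act H Pplus Pminus \<rho> \<longleftrightarrow>
     (\<exists>\<xi>plus \<xi>minus.
        continuous_map (boundary_topology \<Gamma> S) (coset_topology H Pplus) \<xi>plus \<and>
        continuous_map (boundary_topology \<Gamma> S) (coset_topology H Pminus) \<xi>minus \<and>
        inj_on \<xi>plus (boundary \<Gamma> S) \<and> inj_on \<xi>minus (boundary \<Gamma> S) \<and>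
        (\<forall>\<gamma>\<in>carrier \<Gamma>. \<forall>p\<in>boundary \<Gamma> S.
           \<xi>plus (boundary_act \<Gamma> \<gamma> p) = \<rho> \<gamma> <#\<^bsub>H\<^esub> \<xi>plus p \<and>
           \<xi>minus (boundary_act \<Gamma> \<gamma> p) = \<rho> \<gamma> <#\<^bsub>H\<^esub> \<xi>minus p) \<and>
        (\<forall>(p, q)\<in>boundary_pairs \<Gamma> S. \<exists>h\<in>carrier H.
           \<xi>plus p = h <#\<^bsub>H\<^esub> Pplus \<and> \<xi>minus q = h <#\<^bsub>H\<^esub> Pminus) \<and>
        (\<exists>C>0. \<exists>c>0. \<exists>N.
           (\<forall>p q s. ((p, q), s) \<in> topspace (flow_topology \<Gamma> S) \<longrightarrow>
              euclidean_norm_mod (lie_algebra (carrier H))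
                (lie_algebra (coset_stab H (\<xi>plus p) \<inter> coset_stab H (\<xi>minus q)))
                (N ((p, q), s))) \<and>
           (\<forall>X\<in>lie_algebra (carrier H).
              continuous_map (flow_topology \<Gamma> S) euclideanreal (\<lambda>x. N x X)) \<and>
           (\<forall>\<gamma>\<in>carrier \<Gamma>. \<forall>x\<in>topspace (flow_topology \<Gamma> S). \<forall>X\<in>lie_algebra (carrier H).
              N (act \<gamma> x) (\<rho> \<gamma> ** X ** matrix_inv (\<rho> \<gamma>)) = N x X) \<and>
           (\<forall>p q s. ((p, q), s) \<in> topspace (flow_topology \<Gamma> S) \<longrightarrow>
              (\<forall>X\<in>lie_algebra (coset_stab H (\<xi>minus q)). \<forall>t\<ge>0.
                 N (flow (- t) ((p, q), s)) X \<le> C * exp (- c * t) * N ((p, q), s) X) \<and>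
              (\<forall>X\<in>lie_algebra (coset_stab H (\<xi>plus p)). \<forall>t\<ge>0.
                 N (flow t ((p, q), s)) X \<le> C * exp (- c * t) * N ((p, q), s) X))))"


section \<open>Analytic families and Margulis spacetimes\<close>

definition real_analytic_on :: "(real \<Rightarrow> 'v::real_normed_vector) \<Rightarrow> real set \<Rightarrow> bool" where
  "real_analytic_on f I \<longleftrightarrow>
     (\<forall>x\<in>I. \<exists>a. \<exists>r>0. \<forall>y\<in>I. \<bar>y - x\<bar> < r \<longrightarrow> (\<lambda>k. (y - x) ^ k *\<^sub>R a k) sums f y)"

definition tangent_vector ::
  "(real \<Rightarrow> 'g \<Rightarrow> ('n::finite) dmat) \<Rightarrow> 'g \<Rightarrow> 'n dmat" where
  "tangent_vector \<rho> \<gamma> = vector_derivative (\<lambda>t. \<rho> t \<gamma> ** matrix_inv (\<rho> 0 \<gamma>)) (at 0)"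

text \<open>\<open>G0 \<ltimes> \<real>\<^sup>2\<^sup>n\<^sup>-\<^sup>1\<close>; the pair \<open>(g, v)\<close> acts by \<open>x \<mapsto> gx + v\<close>.\<close>

definition Ga :: "(('n::{finite,linorder}) dmat \<times> 'n dvec) monoid" where
  "Ga = \<lparr>carrier = carrier G0 \<times> R0,
         mult = (\<lambda>(g, v) (h, w). (g ** h, g *v w + v)),
         one = (mat 1, 0)\<rparr>"

definition affine_act :: "('n::finite) dmat \<times> 'n dvec \<Rightarrow> 'n dvec \<Rightarrow> 'n dvec" where
  "affine_act = (\<lambda>(g, v) x. g *v x + v)"

definition margulis_spacetime ::
  "('g, 'm) monoid_scheme \<Rightarrow> ('g \<Rightarrow> ('n::{finite,linorder}) dmat \<times> 'n dvec) \<Rightarrow> bool" where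
  "margulis_spacetime \<Gamma> \<tau> \<longleftrightarrow>
     \<tau> \<in> hom \<Gamma> Ga \<and> inj_on \<tau> (carrier \<Gamma>) \<and>
     acts_properly (\<tau> ` carrier \<Gamma>) (top_of_set R0) affine_act \<and>
     acts_freely Ga (\<tau> ` carrier \<Gamma>) R0 affine_act"

end

theory Submission
  imports Defs "HOL-Library.Diagonal_Subsequence"
begin

text \<open>An element \<open>\<gamma>\<close> of \<open>\<Gamma>\<close> far from the identity is followed along an orbit of the Gromov flow. There
  \<open>\<real>\<^sup>2\<^sup>n\<close> splits into \<open>W\<^sub>+\<close>, \<open>W\<^sub>-\<close> and the plane spanned by the neutral vector \<open>\<nu>\<close> and \<open>e\<^sub>2\<^sub>n\<close>; going
  forward, \<open>\<rho> 0\<close> contracts \<open>W\<^sub>+\<close>, expands \<open>W\<^sub>-\<close> and is the identity on the plane. To first order in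
  \<open>t\<close>, \<open>\<rho> t\<close> multiplies the two null lines of the plane by \<open>1 - tf\<close> and \<open>1 + tf\<close>, where
  \<open>f = \<langle>u | \<nu>\<rangle>\<close> is the Margulis cocycle. If the affine action of \<open>(\<rho> 0, u)\<close> is proper, then \<open>f\<close> is
  bounded away from \<open>0\<close> over all sufficiently long orbit segments, with constant sign along each
  orbit. Hence for small \<open>t \<noteq> 0\<close> there is an invariant expanding cone: the norm of a vector with
  \<open>\<langle>v | v\<rangle> = -1\<close> first decreases and then increases geometrically along the orbit. If both \<open>v\<close> and
  \<open>\<rho> t \<gamma> v\<close> lie in a fixed compact set, the length of the orbit segment, and with it \<open>\<gamma>\<close>, is
  therefore restricted to a finite set.\<close>


section \<open>Linear algebra of the form\<close>

text \<open>Properness only makes |f| large on long segments. The component of u in W_- is bounded,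
  and so is that in W_+ once carried back by the inverse of \<rho> 0 \<gamma>, since both are
  geometric series of contracted unit steps. If the neutral component were bounded as well, a point
  of bounded norm would have a bounded image under the affine action. This leaves finitely many
  \<gamma>, and these cannot contract W_+ arbitrarily. The sign of f may differ between orbits,
  which is harmless: each \<gamma> is treated on one orbit, where the sign decides which null line
  is contracted. It cannot change there, because sums of f over a sliding window move by bounded
  amounts. The obstacle to a perturbation argument is that the neutral plane moves at rate |t| only,
  the order at which W_+ and W_- couple into it. Measuring these summands with a large weight k that
  does not depend on t makes the coupling a small fraction of |t|, and they have a fixed gap to
  spare. The condition on \<langle>v | v\<rangle> keeps the norm of every translate at least 1,
  which ends the decreasing phase.\<close>

lemma matrix_inv_unique:
  fixes A B :: "real ^ 'n::finite ^ 'n"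
  assumes "B ** A = mat 1"
  shows "matrix_inv A = B"
proof -
  have AB: "A ** B = mat 1" using assms by (simp add: matrix_left_right_inverse)
  show ?thesis unfolding matrix_inv_def
  proof (rule some_equality)
    show "A ** B = mat 1 \<and> B ** A = mat 1" using AB assms by simp
    fix M assume M: "A ** M = mat 1 \<and> M ** A = mat 1"
    have "M = M ** (A ** B)" using AB by simp
    also have "\<dots> = B" using M by (simp only: matrix_mul_assoc) simp
    finally show "M = B" .
  qed
qed

lemma norm_matrix_vector_le: "norm (A *v x) \<le> norm A * norm x"
  for A :: "real ^ 'n::finite ^ 'm::finite"
proof -
  have "\<bar>(A *v x) $ i\<bar> \<le> norm (A $ i) * norm x" for i
  proof -
    have "(A *v x) $ i = A $ i \<bullet> x"
      by (simp add: matrix_vector_mult_def inner_vec_def)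
    then show ?thesis by (simp add: Cauchy_Schwarz_ineq2)
  qed
  then have "norm (A *v x) \<le> L2_set (\<lambda>i. norm (A $ i) * norm x) UNIV"
    unfolding norm_vec_def[of "A *v x"] by (intro L2_set_mono) auto
  also have "\<dots> = norm A * norm x"
    by (simp add: norm_vec_def[of A] L2_set_left_distrib)
  finally show ?thesis .
qed

lemma norm_matrix_vector_bound:
  fixes A :: "real ^ 'n::finite ^ 'm::finite"
  shows "norm A \<le> a \<Longrightarrow> norm x \<le> r \<Longrightarrow> norm (A *v x) \<le> a * r"
  by (rule order_trans[OF norm_matrix_vector_le mult_mono'[OF _ _ norm_ge_zero norm_ge_zero]])

lemma bounded_bilinear_matrix_vector: "bounded_bilinear ((*v) :: real ^ 'n::finite ^ 'm::finite \<Rightarrow> _)"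
  by (rule bounded_bilinear.intro)
    (auto simp: matrix_vector_mult_add_rdistrib matrix_vector_right_distrib matrix_vector_mult_scaleR
      scaleR_matrix_vector_assoc[symmetric] intro!: exI[of _ 1] norm_matrix_vector_le)

lemma bounded_bilinear_matrix_mult:
  "bounded_bilinear ((**) :: real ^ 'n::finite ^ 'm::finite \<Rightarrow> real ^ 'k::finite ^ 'n \<Rightarrow> _)"
proof -
  have "bilinear ((**) :: real ^ 'n::finite ^ 'm::finite \<Rightarrow> real ^ 'k::finite ^ 'n \<Rightarrow> _)"
    unfolding bilinear_def
    by (intro conjI allI linearI)
      (simp_all add: matrix_matrix_mult_def vec_eq_iff sum.distrib sum_distrib_left algebra_simps)
  then show ?thesis by (simp add: bilinear_conv_bounded_bilinear)
qed

lemmas tendsto_matrix_vector [tendsto_intros] =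
  bounded_bilinear.tendsto[OF bounded_bilinear_matrix_vector]
lemmas tendsto_matrix_mult [tendsto_intros] =
  bounded_bilinear.tendsto[OF bounded_bilinear_matrix_mult]
lemmas continuous_on_matrix_mult [continuous_intros] =
  bounded_bilinear.continuous_on[OF bounded_bilinear_matrix_mult]
lemmas has_vector_derivative_matrix_mult =
  bounded_bilinear.has_vector_derivative[OF bounded_bilinear_matrix_mult]
lemmas has_vector_derivative_matrix_vector =
  bounded_bilinear.has_vector_derivative[OF bounded_bilinear_matrix_vector]

lemma norm_Inn [simp]: "norm (Inn *v w) = norm w" for w :: "('n::finite) dvec"
proof -
  have "(Inn *v w) $ i = (case i of Inl _ \<Rightarrow> 1 | Inr _ \<Rightarrow> -1) * w $ i" for i
    by (simp add: Inn_def matrix_vector_mult_def if_distrib[of "\<lambda>x. x * _"] sum.delta cong: if_cong)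
  then have "\<bar>(Inn *v w) $ i\<bar> = \<bar>w $ i\<bar>" for i by (cases i) auto
  then show ?thesis by (simp add: norm_vec_def)
qed

lemma abs_nnform_le: "\<bar>nnform v w\<bar> \<le> norm v * norm w"
  using Cauchy_Schwarz_ineq2[of v "Inn *v w"] by (simp add: nnform_def)

lemma abs_nnform_bound: "norm v \<le> a \<Longrightarrow> norm w \<le> r \<Longrightarrow> \<bar>nnform v w\<bar> \<le> a * r"
  by (rule order_trans[OF abs_nnform_le mult_mono'[OF _ _ norm_ge_zero norm_ge_zero]])

lemma bounded_bilinear_nnform: "bounded_bilinear (nnform :: ('n::finite) dvec \<Rightarrow> _)"
  by (rule bounded_bilinear.intro)
    (auto simp: nnform_def inner_add_left inner_add_right matrix_vector_right_distrib
      matrix_vector_mult_scaleR abs_nnform_le[unfolded nnform_def] intro!: exI[of _ 1])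

lemmas nnform_add_left = bounded_bilinear.add_left[OF bounded_bilinear_nnform]
lemmas nnform_add_right = bounded_bilinear.add_right[OF bounded_bilinear_nnform]
lemmas nnform_diff_left = bounded_bilinear.diff_left[OF bounded_bilinear_nnform]
lemmas nnform_diff_right = bounded_bilinear.diff_right[OF bounded_bilinear_nnform]
lemmas nnform_minus_left = bounded_bilinear.minus_left[OF bounded_bilinear_nnform]
lemmas nnform_minus_right = bounded_bilinear.minus_right[OF bounded_bilinear_nnform]
lemmas nnform_scaleR_left = bounded_bilinear.scaleR_left[OF bounded_bilinear_nnform]
lemmas nnform_scaleR_right = bounded_bilinear.scaleR_right[OF bounded_bilinear_nnform]
lemmas nnform_zero_left [simp] = bounded_bilinear.zero_left[OF bounded_bilinear_nnform]
lemmas nnform_zero_right [simp] = bounded_bilinear.zero_right[OF bounded_bilinear_nnform]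
lemmas nnform_simps = nnform_add_left nnform_add_right nnform_diff_left nnform_diff_right
  nnform_minus_left nnform_minus_right nnform_scaleR_left nnform_scaleR_right
lemmas tendsto_nnform [tendsto_intros] = bounded_bilinear.tendsto[OF bounded_bilinear_nnform]

lemma nnform_sym: "nnform v w = nnform w v"
  by (simp add: nnform_eq mult.commute)

lemma nnform_e2n_right: "nnform x e2n = - x $ Inr (Max UNIV)"
  unfolding nnform_eq e2n_def by (simp add: axis_def if_distrib[of "\<lambda>z. _ * z"] cong: if_cong)

lemma nnform_e2n [simp]: "nnform e2n e2n = -1"
  unfolding nnform_e2n_right by (simp add: e2n_def)

lemma norm_e2n [simp]: "norm (e2n :: ('n::{finite,linorder}) dvec) = 1"
  by (simp add: e2n_def norm_eq_sqrt_inner inner_axis_axis)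

lemma R0_iff: "x \<in> R0 \<longleftrightarrow> nnform x e2n = 0"
  by (simp add: R0_eq nnform_e2n_right)

lemma nnform_nondeg:
  assumes "\<And>w. nnform v w = 0" shows "v = (0 :: ('n::finite) dvec)"
proof -
  have "nnform v (Inn *v v) = v \<bullet> v"
  proof -
    have "Inn *v (Inn *v v) = v"
      by (simp add: vec_eq_iff Inn_def matrix_vector_mult_def if_distrib[of "\<lambda>x. x * _"] sum.delta
          split: sum.split cong: if_cong)
    then show ?thesis by (simp add: nnform_def)
  qed
  with assms show ?thesis by simp
qed

text \<open>The form of the two moving vectors is constant near 0, and the product rule at
  \<open>A 0 = mat 1\<close> splits its zero derivative into two terms.\<close>

lemma skew_derivative:
  fixes A :: "real \<Rightarrow> ('n::finite) dmat"
  assumes form: "\<And>t v w. t \<in> {-1<..<1} \<Longrightarrow> nnform (A t *v v) (A t *v w) = nnform v w"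
    and A0: "A 0 = mat 1" and der: "(A has_vector_derivative U) (at 0)"
  shows "nnform (U *v v) w + nnform v (U *v w) = 0"
proof -
  have d: "((\<lambda>t. A t *v x) has_vector_derivative U *v x) (at 0)" for x
    using has_vector_derivative_matrix_vector[OF der has_vector_derivative_const[of x]]
    by (simp add: matrix_vector_mult_0_right)
  have "((\<lambda>t. nnform (A t *v v) (A t *v w)) has_vector_derivative
      nnform (A 0 *v v) (U *v w) + nnform (U *v v) (A 0 *v w)) (at 0)"
    by (rule bounded_bilinear.has_vector_derivative[OF bounded_bilinear_nnform d d])
  moreover have "((\<lambda>t. nnform (A t *v v) (A t *v w)) has_vector_derivative 0) (at 0)"
    by (rule has_vector_derivative_transform_within_open[where S = "{-1<..<1}" and f = "\<lambda>_. nnform v w"])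
      (auto simp: form)
  ultimately show ?thesis
    using vector_derivative_unique_at[of _ 0] by (fastforce simp: A0)
qed

section \<open>Neutral dynamics\<close>

text \<open>A resolution of the identity: the last two terms are the orthogonal projections to the
  lines of \<nu> and \<open>e2n\<close>, the minus sign coming from
  \<open>nnform e2n e2n = -1\<close>. It fixes \<nu> only up to sign, and the statements below hold
  for either choice.\<close>

definition neutral :: "('n::{finite,linorder}) dmat \<Rightarrow> 'n dmat \<Rightarrow> 'n dvec \<Rightarrow> bool" where
  "neutral P Q \<nu> \<longleftrightarrow> nnform \<nu> \<nu> = 1 \<and> nnform \<nu> e2n = 0 \<and>
     (\<forall>v. P *v v + Q *v v + nnform v \<nu> *\<^sub>R \<nu> - nnform v e2n *\<^sub>R e2n = v)"

lemma neutral_decomp: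
  "neutral P Q \<nu> \<Longrightarrow> P *v v + Q *v v + nnform v \<nu> *\<^sub>R \<nu> - nnform v e2n *\<^sub>R e2n = v"
  unfolding neutral_def by simp

lemma neutral_transport:
  assumes n: "neutral P Q \<nu>" and inv: "\<And>v. h *v (k *v v) = v"
    and form: "\<And>v w. nnform (h *v v) (h *v w) = nnform v w" and e: "h *v e2n = e2n"
    and P: "\<And>v. P' *v (h *v v) = h *v (P *v v)" and Q: "\<And>v. Q' *v (h *v v) = h *v (Q *v v)"
  shows "neutral P' Q' (h *v \<nu>)"
proof -
  have form_e: "nnform (h *v v) e2n = nnform v e2n" for v using form[of v e2n] by (simp add: e)
  have "P' *v v + Q' *v v + nnform v (h *v \<nu>) *\<^sub>R (h *v \<nu>) - nnform v e2n *\<^sub>R e2n = v" for v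
  proof -
    let ?w = "k *v v"
    have "h *v (P *v ?w + Q *v ?w + nnform ?w \<nu> *\<^sub>R \<nu> - nnform ?w e2n *\<^sub>R e2n) = h *v ?w"
      using neutral_decomp[OF n, of ?w] by (rule arg_cong)
    then have "P' *v (h *v ?w) + Q' *v (h *v ?w) + nnform (h *v ?w) (h *v \<nu>) *\<^sub>R (h *v \<nu>)
        - nnform (h *v ?w) e2n *\<^sub>R e2n = h *v ?w"
      by (simp add: P Q form form_e e matrix_vector_right_distrib matrix_vector_mult_diff_distrib
          matrix_vector_mult_scaleR)
    then show ?thesis by (simp only: inv)
  qed
  then show ?thesis using n unfolding neutral_def by (intro conjI allI) (simp_all add: form form_e)
qed

section \<open>Two facts on real sequences\<close>

text \<open>A discrete intermediate value argument: two values outside \<open>[-B, B]\<close> with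
  opposite signs differ by more than \<open>2 * B\<close>, which a step of size at most
  \<open>B\<close> cannot bridge.\<close>

lemma const_sign:
  fixes F :: "nat \<Rightarrow> real"
  assumes B: "0 \<le> B"
    and "\<And>k. k \<le> n \<Longrightarrow> B < \<bar>F k\<bar>" "\<And>k. k < n \<Longrightarrow> \<bar>F (Suc k) - F k\<bar> \<le> B"
  shows "0 < F 0 * F n"
proof -
  have "0 < F 0 * F k" if "k \<le> n" for k
    using that
  proof (induction k)
    case 0
    then show ?case using assms(2)[of 0] B
      by (auto simp: zero_less_mult_iff)
  next
    case (Suc k)
    have "B < \<bar>F k\<bar>" "B < \<bar>F (Suc k)\<bar>" "\<bar>F (Suc k) - F k\<bar> \<le> B"
      using Suc.prems assms by auto
    moreover have "0 < F 0 * F k" using Suc by simp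
    ultimately show ?case by (auto simp: zero_less_mult_iff)
  qed
  then show ?thesis by simp
qed

text \<open>Here \<open>p\<close> stands for the contracted size and \<open>q\<close> for the
  expanded one. While \<open>q < p\<close>, \<open>p\<close> decays by the factor
  \<open>1 - l\<close>; as soon as \<open>p \<le> q\<close>, this persists and \<open>q\<close>
  grows by \<open>1 + l\<close>. The lower bound \<open>c0\<close> ends the decay and the bound
  \<open>R\<close> at the last index ends the growth, so \<open>N\<close> depends on
  \<open>l\<close>, \<open>c0\<close> and \<open>R\<close> only.\<close>

lemma cone_sequence_length:
  fixes l c0 R :: real
  assumes "0 < l" "l < 1" "0 < c0"
  obtains N :: nat where "\<forall>p q m. (\<forall>j\<le>m. c0 \<le> max (p j) (q j)) \<longrightarrow>
      (\<forall>j<m. p (Suc j) \<le> (1 - l) * max (p j) (q j)) \<longrightarrow>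
      (\<forall>j<m. p j \<le> q j \<longrightarrow> (1 + l) * q j \<le> q (Suc j)) \<longrightarrow>
      max (p 0) (q 0) \<le> R \<longrightarrow> max (p m) (q m) \<le> R \<longrightarrow> m \<le> N"
proof -
  \<comment> \<open>\<open>R\<close> may be zero or negative, hence \<open>max 1 R\<close>, which
    keeps the quotient positive.\<close>
  obtain n where "(1 - l) ^ n < c0 / max 1 R"
    using real_arch_pow_inv[of "c0 / max 1 R" "1 - l"] assms by auto
  then have "(1 - l) ^ n * max 1 R < c0" by (simp add: pos_less_divide_eq)
  moreover have "(1 - l) ^ n * R \<le> (1 - l) ^ n * max 1 R" using assms by (intro mult_left_mono) auto
  ultimately have n: "(1 - l) ^ n * R < c0" by linarith
  obtain n' where "R / c0 < (1 + l) ^ n'"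
    using real_arch_pow[of "1 + l" "R / c0"] assms by auto
  then have n': "R < (1 + l) ^ n' * c0" using assms by (simp add: pos_divide_less_eq)
  show thesis
  proof (rule that[of "n + n'"], intro allI impI, rule ccontr)
    fix p q :: "nat \<Rightarrow> real" and m
    assume lo': "\<forall>j\<le>m. c0 \<le> max (p j) (q j)"
      and P': "\<forall>j<m. p (Suc j) \<le> (1 - l) * max (p j) (q j)"
      and Q': "\<forall>j<m. p j \<le> q j \<longrightarrow> (1 + l) * q j \<le> q (Suc j)"
      and R0: "max (p 0) (q 0) \<le> R" and Rm: "max (p m) (q m) \<le> R" and "\<not> m \<le> n + n'"
    note lo = lo'[rule_format] and P = P'[rule_format] and Q = Q'[rule_format]
    from \<open>\<not> m \<le> n + n'\<close> have m: "n + n' < m" by simp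
    have grow: "p (i + k) \<le> q (i + k) \<and> (1 + l) ^ k * c0 \<le> q (i + k)" if i: "p i \<le> q i" "i + k \<le> m" for i k
      using i(2)
    proof (induction k)
      case 0
      then show ?case using i lo[of i] by simp
    next
      case (Suc k)
      then have IH: "p (i + k) \<le> q (i + k)" "(1 + l) ^ k * c0 \<le> q (i + k)" and lt: "i + k < m" by auto
      have q0: "0 < q (i + k)" using lo[of "i + k"] IH(1) lt assms by simp
      have "p (Suc (i + k)) \<le> (1 - l) * q (i + k)" using P[OF lt] IH by (simp add: max_def)
      also have "\<dots> \<le> (1 + l) * q (i + k)" using q0 assms by simp
      finally have "p (Suc (i + k)) \<le> (1 + l) * q (i + k)" .
      moreover have "(1 + l) * q (i + k) \<le> q (Suc (i + k))" using Q[OF lt IH(1)] .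
      moreover have "(1 + l) * ((1 + l) ^ k * c0) \<le> (1 + l) * q (i + k)"
        using IH(2) assms by (intro mult_left_mono) auto
      ultimately show ?case by (simp add: mult.assoc)
    qed
    show False
    proof (cases "p n \<le> q n")
      case True
      then have "(1 + l) ^ (m - n) * c0 \<le> q m" using grow[of n "m - n"] m by simp
      moreover have "(1 + l) ^ n' * c0 \<le> (1 + l) ^ (m - n) * c0"
        using assms m by (intro mult_right_mono power_increasing) auto
      ultimately show False using n' Rm by simp
    next
      case False
      have pq: "q i < p i" if "i \<le> n" for i
      proof (rule ccontr)
        assume "\<not> q i < p i"
        then have "p i \<le> q i" by simp
        moreover have "i + (n - i) = n" using that by simp
        ultimately show False using grow[of i "n - i"] False m by simp
      qed
      have "p i \<le> (1 - l) ^ i * R" if "i \<le> n" for i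
        using that
      proof (induction i)
        case 0 then show ?case using R0 by simp
      next
        case (Suc i)
        have "p (Suc i) \<le> (1 - l) * p i" using P[of i] pq[of i] Suc.prems m by (simp add: max_def)
        also have "\<dots> \<le> (1 - l) * ((1 - l) ^ i * R)" using Suc assms by (intro mult_left_mono) auto
        finally show ?case by (simp add: mult.assoc)
      qed
      then have "p n \<le> (1 - l) ^ n * R" by simp
      moreover have "c0 \<le> p n" using lo[of n] pq[of n] m by simp
      ultimately show False using n by simp
    qed
  qed
qed

text \<open>\<open>E T y g y'\<close> says that the flow for time \<open>T\<close> carries the point \<open>y\<close> of a compact fundamental set to
  the \<open>g\<close>-translate of \<open>y'\<close>; \<open>Pi 1\<close> and \<open>Pi (-1)\<close> project onto the contracted and the expanded
  summand of the splitting.\<close>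

locale neutral_dynamics = group \<Gamma> for \<Gamma> :: "('g, 'm) monoid_scheme" (structure) +
  fixes \<rho> :: "real \<Rightarrow> 'g \<Rightarrow> ('n::{finite,linorder}) dmat"
    and K :: "'x set" and E :: "real \<Rightarrow> 'x \<Rightarrow> 'g \<Rightarrow> 'x \<Rightarrow> bool"
    and Pi :: "real \<Rightarrow> 'x \<Rightarrow> 'n dmat" and C c b :: real
  assumes rho_mult: "\<lbrakk>t \<in> {-1<..<1}; g \<in> carrier \<Gamma>; h \<in> carrier \<Gamma>\<rbrakk> \<Longrightarrow> \<rho> t (g \<otimes> h) = \<rho> t g ** \<rho> t h"
    and rho_one: "t \<in> {-1<..<1} \<Longrightarrow> \<rho> t \<one> = mat 1"
    and rho_form: "\<lbrakk>t \<in> {-1<..<1}; g \<in> carrier \<Gamma>\<rbrakk> \<Longrightarrow> nnform (\<rho> t g *v v) (\<rho> t g *v w) = nnform v w"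
    and rho_e: "g \<in> carrier \<Gamma> \<Longrightarrow> \<rho> 0 g *v e2n = e2n"
    and rho_diff: "g \<in> carrier \<Gamma> \<Longrightarrow> (\<lambda>t. \<rho> t g) differentiable at 0"
    and u_R0: "g \<in> carrier \<Gamma> \<Longrightarrow> tangent_vector \<rho> g *v e2n \<in> R0"
    and u_mult: "\<lbrakk>g \<in> carrier \<Gamma>; h \<in> carrier \<Gamma>\<rbrakk> \<Longrightarrow> tangent_vector \<rho> (g \<otimes> h) *v e2n =
      \<rho> 0 g *v (tangent_vector \<rho> h *v e2n) + tangent_vector \<rho> g *v e2n"
    and affine_proper: "finite {g \<in> carrier \<Gamma>. \<exists>z\<in>R0. norm z \<le> R \<and>
      norm (\<rho> 0 g *v z + tangent_vector \<rho> g *v e2n) \<le> R}"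
    and E_carrier: "E T y g y' \<Longrightarrow> g \<in> carrier \<Gamma> \<and> y \<in> K \<and> y' \<in> K"
    and E_refl: "y \<in> K \<Longrightarrow> E 0 y \<one> y"
    and E_ex: "y \<in> K \<Longrightarrow> \<exists>g y'. E T y g y'"
    and E_div: "\<lbrakk>E T y g y'; E T' y h y''\<rbrakk> \<Longrightarrow> E (T' - T) y' (inv g \<otimes> h) y''"
    and finite_E: "finite {g. \<exists>T\<in>{T0..T1}. \<exists>y y'. E T y g y'}"
    and E_all: "finite {g \<in> carrier \<Gamma>. \<not> (\<exists>T y y'. E T y g y')}"
    and pos: "0 < c" "1 \<le> C" "1 \<le> b"
    and Pi_e: "\<lbrakk>\<sigma> \<in> {1, -1}; y \<in> K\<rbrakk> \<Longrightarrow> nnform (Pi \<sigma> y *v v) e2n = 0"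
    and Pi_bound: "\<lbrakk>\<sigma> \<in> {1, -1}; y \<in> K\<rbrakk> \<Longrightarrow> norm (Pi \<sigma> y *v v) \<le> b * norm v"
    and Pi_nonzero: "y \<in> K \<Longrightarrow> \<exists>v. Pi 1 y *v v \<noteq> 0"
    and Pi_equiv: "\<lbrakk>\<sigma> \<in> {1, -1}; E T y g y'\<rbrakk> \<Longrightarrow> Pi \<sigma> y *v (\<rho> 0 g *v v) = \<rho> 0 g *v (Pi \<sigma> y' *v v)"
    and contraction: "\<lbrakk>\<sigma> \<in> {1, -1}; E T y g y'; 0 \<le> \<sigma> * T\<rbrakk> \<Longrightarrow>
      norm (\<rho> 0 (inv g) *v (Pi \<sigma> y *v v)) \<le> C * exp (- c * \<bar>T\<bar>) * norm (Pi \<sigma> y *v v)"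
    and neutral_ex: "y \<in> K \<Longrightarrow> \<exists>\<nu>. neutral (Pi 1 y) (Pi (-1) y) \<nu>"
    and neutral_bound: "\<lbrakk>y \<in> K; neutral (Pi 1 y) (Pi (-1) y) \<nu>\<rbrakk> \<Longrightarrow> norm \<nu> \<le> b"
begin

section \<open>The affine cocycle along an orbit\<close>

abbreviation u :: "'g \<Rightarrow> 'n dvec" where "u g \<equiv> tangent_vector \<rho> g *v e2n"
abbreviation neutral_at :: "'x \<Rightarrow> 'n dvec \<Rightarrow> bool" where "neutral_at y \<equiv> neutral (Pi 1 y) (Pi (-1) y)"

lemma rho_inv: 
  assumes "t \<in> {-1<..<1}" "g \<in> carrier \<Gamma>"
  shows "\<rho> t (inv g) *v (\<rho> t g *v v) = v" "\<rho> t g *v (\<rho> t (inv g) *v v) = v"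
    "\<rho> t (inv g) ** \<rho> t g = mat 1" "\<rho> t g ** \<rho> t (inv g) = mat 1"
proof -
  show 1: "\<rho> t (inv g) ** \<rho> t g = mat 1" "\<rho> t g ** \<rho> t (inv g) = mat 1"
    using rho_mult[OF assms(1), of "inv g" g] rho_mult[OF assms(1), of g "inv g"] rho_one[OF assms(1)] assms
    by simp_all
  show "\<rho> t (inv g) *v (\<rho> t g *v v) = v" "\<rho> t g *v (\<rho> t (inv g) *v v) = v"
    by (simp_all only: matrix_vector_mul_assoc 1 matrix_vector_mul_lid)
qed

lemma rho0_inv [simp]:
  assumes "g \<in> carrier \<Gamma>"
  shows "\<rho> 0 (inv g) *v (\<rho> 0 g *v v) = v" "\<rho> 0 g *v (\<rho> 0 (inv g) *v v) = v"
  using rho_inv[of 0] assms by auto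

lemma E_neg: "E T y g y' \<Longrightarrow> E (- T) y' (inv g) y"
  using E_div[of T y g y' 0 \<one> y] E_refl[of y] E_carrier[of T y g y'] by simp

lemma E_comp: "E T y g y' \<Longrightarrow> E T' y' h y'' \<Longrightarrow> E (T + T') y (g \<otimes> h) y''"
  using E_div[OF E_neg, of T y g y' T' h y''] E_carrier[of T y g y'] by (simp add: add.commute)

lemma neutral_equiv:
  assumes E: "E T y g y'" and n: "neutral_at y \<nu>"
  shows "neutral_at y' (\<rho> 0 (inv g) *v \<nu>)"
proof -
  have g: "g \<in> carrier \<Gamma>" using E_carrier E by blast
  have P: "Pi \<sigma> y' *v (\<rho> 0 (inv g) *v v) = \<rho> 0 (inv g) *v (Pi \<sigma> y *v v)" if "\<sigma> \<in> {1, -1}" for \<sigma> v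
    using Pi_equiv[OF that E, of "\<rho> 0 (inv g) *v v"] g by simp
  show ?thesis
    by (rule neutral_transport[OF n, of _ "\<rho> 0 g"]) (use g P in \<open>simp_all add: rho_form rho_e\<close>)
qed

lemma u_bounded:
  obtains B where "0 \<le> B" "\<And>T y g y'. E T y g y' \<Longrightarrow> T \<in> {-1..1} \<Longrightarrow> norm (u g) \<le> B"
proof -
  define F where "F = {g. \<exists>T\<in>{-1..1}. \<exists>y y'. E T y g y'}"
  have "finite F" unfolding F_def by (rule finite_E)
  have le: "norm (u g) \<le> (\<Sum>h\<in>F. norm (u h))" if "g \<in> F" for g
    using \<open>finite F\<close> that by (intro member_le_sum) auto
  show thesis
  proof (rule that)
    show "0 \<le> (\<Sum>h\<in>F. norm (u h))" by (simp add: sum_nonneg)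
    show "norm (u g) \<le> (\<Sum>h\<in>F. norm (u h))" if "E T y g y'" "T \<in> {-1..1}" for T y g y'
    proof (rule le)
      show "g \<in> F" unfolding F_def using that by (intro CollectI bexI exI)
    qed
  qed
qed

text \<open>Cut the segment into unit steps. By the cocycle rule the component of \<open>u g\<close>
  is the sum of those of the steps, each carried to the far end of the segment, so contraction turns
  it into a geometric series. For \<open>Pi (-1)\<close> the same estimate is run along the reversed
  segment.\<close>

lemma Pi_u_bounded:
  obtains D where "0 \<le> D"
    "\<And>L y g y'. E (real L) y g y' \<Longrightarrow> norm (Pi (-1) y *v u g) \<le> D"
    "\<And>L y g y'. E (real L) y g y' \<Longrightarrow> norm (\<rho> 0 (inv g) *v (Pi 1 y *v u g)) \<le> D"
proof -
  obtain B where B: "0 \<le> B" "\<And>T y g y'. E T y g y' \<Longrightarrow> T \<in> {-1..1} \<Longrightarrow> norm (u g) \<le> B"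
    using u_bounded by blast
  \<comment> \<open>\<open>b * B\<close> bounds the component over one unit step, and
    \<open>C\<close> is the constant lost in the contraction.\<close>
  define D where "D = C * (b * B)"
  have D: "0 \<le> D" "b * B \<le> D" using B pos mult_right_mono[of 1 C "b * B"] by (auto simp: D_def)
  let ?S = "\<lambda>L. D * (1 + (\<Sum>j<L. exp (- c) ^ j))"
  have ex: "exp (- c * real L) = exp (- c) ^ L" for L
    by (metis exp_of_nat_mult mult.commute)
  have PB: "norm (Pi \<sigma> y *v u g) \<le> b * B" if "\<sigma> \<in> {1, -1}" "E T y g y'" "T \<in> {-1..1}" for \<sigma> T y g y'
    using Pi_bound[of \<sigma> y "u g"] B(2)[OF that(2,3)] that E_carrier[OF that(2)] pos
    by (smt (verit) mult_left_mono)
  \<comment> \<open>The sign \<sigma> is also the direction of travel, forward for 1 and backward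
    for -1; in both cases the image of \<open>Pi \<sigma>\<close> is contracted.\<close>
  have main: "norm (\<rho> 0 (inv g) *v (Pi \<sigma> y *v u g)) \<le> ?S L"
    if \<sigma>: "\<sigma> \<in> {1, -1}" and "E (\<sigma> * real L) y g y'" for \<sigma> L y g y'
    using that(2)
  proof (induction L arbitrary: g y)
    case 0
    have "norm (\<rho> 0 (inv g) *v (Pi \<sigma> y *v u g)) \<le> C * norm (Pi \<sigma> y *v u g)"
      using contraction[OF \<sigma> 0, of "u g"] by simp
    also have "\<dots> \<le> D" unfolding D_def using PB[OF \<sigma> 0] pos by (intro mult_left_mono) auto
    finally show ?case by simp
  next
    case (Suc L)
    have yK: "y \<in> K" using E_carrier Suc.prems by blast
    obtain g1 y1 where 1: "E \<sigma> y g1 y1" using E_ex yK by blast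
    define h where "h = inv g1 \<otimes> g"
    have "\<sigma> * real (Suc L) - \<sigma> = \<sigma> * real L" by (simp add: algebra_simps)
    then have h: "E (\<sigma> * real L) y1 h y'" using E_div[OF 1 Suc.prems] by (simp only: h_def)
    have g1: "g1 \<in> carrier \<Gamma>" "h \<in> carrier \<Gamma>" using E_carrier 1 h by blast+
    have gG: "g \<in> carrier \<Gamma>" using E_carrier Suc.prems by blast
    have g: "g = g1 \<otimes> h" using g1 E_carrier[OF Suc.prems] by (simp add: h_def m_assoc[symmetric])
    have "inv g = inv h \<otimes> inv g1" unfolding g using g1 by (simp add: inv_mult_group)
    then have rg: "\<rho> 0 (inv g) = \<rho> 0 (inv h) ** \<rho> 0 (inv g1)" using g1 by (simp add: rho_mult)
    have "Pi \<sigma> y *v u g = \<rho> 0 g1 *v (Pi \<sigma> y1 *v u h) + Pi \<sigma> y *v u g1"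
      unfolding g using g1 by (simp add: u_mult matrix_vector_right_distrib Pi_equiv[OF \<sigma> 1])
    then have "\<rho> 0 (inv g) *v (Pi \<sigma> y *v u g) =
        \<rho> 0 (inv h) *v (Pi \<sigma> y1 *v u h) + \<rho> 0 (inv g) *v (Pi \<sigma> y *v u g1)"
      using g1 by (simp add: matrix_vector_right_distrib) (simp add: rg matrix_vector_mul_assoc[symmetric])
    moreover have "norm (\<rho> 0 (inv g) *v (Pi \<sigma> y *v u g1)) \<le> D * exp (- c) ^ L"
    proof -
      have s: "0 \<le> \<sigma> * (\<sigma> * real (Suc L))" "\<bar>\<sigma> * real (Suc L)\<bar> = real (Suc L)" using \<sigma> by auto
      have "norm (\<rho> 0 (inv g) *v (Pi \<sigma> y *v u g1)) \<le> C * exp (- c * real (Suc L)) * norm (Pi \<sigma> y *v u g1)"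
        using contraction[OF \<sigma> Suc.prems s(1), of "u g1"] by (simp only: s(2))
      \<comment> \<open>One factor \<open>exp (- c)\<close> is given away so that the exponent
        matches the index of the sum.\<close>
      also have "\<dots> \<le> C * exp (- c * real L) * (b * B)"
        using PB[OF \<sigma> 1] \<sigma> pos by (intro mult_mono) (auto simp: algebra_simps)
      finally show ?thesis by (simp add: ex[simplified] D_def mult_ac)
    qed
    ultimately show ?case
      using Suc.IH[OF h] norm_triangle_ineq[of "\<rho> 0 (inv h) *v (Pi \<sigma> y1 *v u h)" "\<rho> 0 (inv g) *v (Pi \<sigma> y *v u g1)"]
      by (simp add: algebra_simps)
  qed
  have plus: "norm (\<rho> 0 (inv g) *v (Pi 1 y *v u g)) \<le> ?S L" if "E (real L) y g y'" for L y g y'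
    using main[of 1 L y g y'] that by simp
  have minus: "norm (Pi (-1) y *v u g) \<le> ?S L" if E: "E (real L) y g y'" for L y g y'
  proof -
    have g: "g \<in> carrier \<Gamma>" using E_carrier E by blast
    have "u \<one> = 0" using u_mult[of \<one> \<one>] rho_one[of 0] by simp
    \<comment> \<open>The cocycle over the reversed segment is \<open>u g\<close> seen from the
      other end, with a minus sign.\<close>
    then have "u g = - (\<rho> 0 g *v u (inv g))" using u_mult[of g "inv g"] g by (simp add: eq_neg_iff_add_eq_0 add.commute)
    then have "Pi (-1) y *v u g = - (\<rho> 0 g *v (Pi (-1) y' *v u (inv g)))"
      by (simp add: bounded_bilinear.minus_right[OF bounded_bilinear_matrix_vector] Pi_equiv[OF _ E])
    then show ?thesis using main[of "-1" L y' "inv g" y] E_neg[OF E] g by simp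
  qed
  have "?S L \<le> D * (1 + 1 / (1 - exp (- c)))" for L
  proof -
    have "(\<Sum>j<L. exp (- c) ^ j) \<le> (\<Sum>j. exp (- c) ^ j)"
      using pos by (intro sum_le_suminf summable_geometric) auto
    also have "\<dots> = 1 / (1 - exp (- c))" using pos by (intro suminf_geometric) auto
    finally show ?thesis using D by (intro mult_left_mono) auto
  qed
  moreover have "0 \<le> D * (1 + 1 / (1 - exp (- c)))" using D pos by simp
  ultimately show thesis using that minus plus by (meson order_trans)
qed

text \<open>Suppose the neutral component is at most \<open>M\<close>. Then \<open>z\<close>, the
  contracted part of \<open>u g\<close> carried back and negated, cancels that part under the affine
  map, so \<open>z\<close> and its image are bounded and \<open>g\<close> lies in a finite set. The
  finitely many \<open>\<rho> 0 g\<close> have bounded norm, whereas a long segment forces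
  \<open>\<rho> 0 (inv g)\<close> to contract the nonzero image of \<open>Pi 1\<close> as strongly
  as desired.\<close>

lemma drift:
  obtains L0 where "\<And>L y g y' \<nu>. \<lbrakk>L0 \<le> L; E (real L) y g y'; neutral_at y \<nu>\<rbrakk> \<Longrightarrow> M < \<bar>nnform (u g) \<nu>\<bar>"
proof -
  obtain D where D: "0 \<le> D"
    "\<And>L y g y'. E (real L) y g y' \<Longrightarrow> norm (Pi (-1) y *v u g) \<le> D"
    "\<And>L y g y'. E (real L) y g y' \<Longrightarrow> norm (\<rho> 0 (inv g) *v (Pi 1 y *v u g)) \<le> D"
    using Pi_u_bounded by blast
  define R where "R = D + \<bar>M\<bar> * b"
  define F where "F = {g \<in> carrier \<Gamma>. \<exists>z\<in>R0. norm z \<le> R \<and> norm (\<rho> 0 g *v z + u g) \<le> R}"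
  have "finite F" unfolding F_def by (rule affine_proper)
  define B where "B = (\<Sum>h\<in>F. norm (\<rho> 0 h))"
  have B: "norm (\<rho> 0 g) \<le> B" if "g \<in> F" for g
    unfolding B_def using \<open>finite F\<close> that by (intro member_le_sum) auto
  have inF: "g \<in> F" if e: "E (real L) y g y'" and n: "neutral_at y \<nu>" and le: "\<bar>nnform (u g) \<nu>\<bar> \<le> M" for L y g y' \<nu>
  proof -
    have g: "g \<in> carrier \<Gamma>" and y: "y \<in> K" using E_carrier[OF e] by auto
    define z where "z = - (\<rho> 0 (inv g) *v (Pi 1 y *v u g))"
    have "nnform (\<rho> 0 (inv g) *v (Pi 1 y *v u g)) (\<rho> 0 (inv g) *v e2n) = 0"
      using g y by (simp add: rho_form Pi_e del: rho0_inv)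
    then have zR0: "z \<in> R0" using g by (simp add: R0_iff z_def nnform_simps rho_e)
    have z: "norm z \<le> R"
    proof -
      have "norm z \<le> D" using D(3)[OF e] by (simp add: z_def)
      then show ?thesis using pos by (simp add: R_def add_increasing2)
    qed
    have dec: "Pi 1 y *v u g + Pi (-1) y *v u g + nnform (u g) \<nu> *\<^sub>R \<nu> = u g"
      using neutral_decomp[OF n, of "u g"] u_R0[OF g] by (simp add: R0_iff)
    have "\<rho> 0 g *v z = - (Pi 1 y *v u g)"
      using g by (simp add: z_def bounded_bilinear.minus_right[OF bounded_bilinear_matrix_vector])
    then have "\<rho> 0 g *v z + u g = Pi (-1) y *v u g + nnform (u g) \<nu> *\<^sub>R \<nu>"
      using arg_cong[OF dec, of "\<lambda>x. x - Pi 1 y *v u g"] by (simp add: algebra_simps)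
    also have "norm \<dots> \<le> D + \<bar>M\<bar> * b"
    proof (rule norm_triangle_le[OF add_mono])
      show "norm (Pi (-1) y *v u g) \<le> D" using D(2)[OF e] .
      show "norm (nnform (u g) \<nu> *\<^sub>R \<nu>) \<le> \<bar>M\<bar> * b"
        using le neutral_bound[OF y n] by (auto intro!: mult_mono)
    qed
    finally have "norm (\<rho> 0 g *v z + u g) \<le> R" by (simp add: R_def)
    then show ?thesis using g z zR0 unfolding F_def by blast
  qed
  have "(\<lambda>L. B * C * exp (- c) ^ L) \<longlonglongrightarrow> 0"
    using pos by (intro tendsto_mult_right_zero LIMSEQ_power_zero) auto
  then have "\<forall>\<^sub>F L in sequentially. B * C * exp (- c) ^ L < 1"
    by (intro order_tendstoD) auto
  then obtain L0 where L0: "\<And>L. L0 \<le> L \<Longrightarrow> B * C * exp (- c) ^ L < 1"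
    unfolding eventually_sequentially by blast
  show thesis
  proof (rule that[of L0], rule ccontr)
    fix L y g y' \<nu>
    assume L: "L0 \<le> L" and e: "E (real L) y g y'" and n: "neutral_at y \<nu>" and nle: "\<not> M < \<bar>nnform (u g) \<nu>\<bar>"
    have g: "g \<in> carrier \<Gamma>" and y: "y \<in> K" using E_carrier[OF e] by auto
    have gF: "g \<in> F" using inF[OF e n] nle by simp
    obtain v where v: "Pi 1 y *v v \<noteq> 0" using Pi_nonzero[OF y] by blast
    let ?a = "Pi 1 y *v v"
    have ex: "exp (- c * real L) = exp (- c) ^ L"
      by (metis exp_of_nat_mult mult.commute)
    have "norm ?a = norm (\<rho> 0 g *v (\<rho> 0 (inv g) *v ?a))" using g by simp
    also have "\<dots> \<le> norm (\<rho> 0 g) * norm (\<rho> 0 (inv g) *v ?a)" by (rule norm_matrix_vector_le)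
    also have "\<dots> \<le> B * (C * exp (- c * real L) * norm ?a)"
      using B[OF gF] contraction[OF _ e, of 1 v] by (intro mult_mono) (auto intro: order_trans[OF norm_ge_zero])
    also have "\<dots> = (B * C * exp (- c) ^ L) * norm ?a"
      unfolding ex by (simp add: mult_ac)
    also have "\<dots> < 1 * norm ?a" using L0[OF L] v by (intro mult_strict_right_mono) auto
    finally show False by simp
  qed
qed

text \<open>Pairing \<open>u\<close> with a fixed \<nu> gives a primitive of the Margulis cocycle
  along the orbit: over the piece from \<open>g\<close> to \<open>h\<close>, with \<nu> transported
  to the start of the piece, the cocycle is the difference of its values.\<close>

lemma nnform_u_diff:
  assumes "g \<in> carrier \<Gamma>" "h \<in> carrier \<Gamma>"
  shows "nnform (u (inv g \<otimes> h)) (\<rho> 0 (inv g) *v \<nu>) = nnform (u h) \<nu> - nnform (u g) \<nu>"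
proof -
  have "u (g \<otimes> (inv g \<otimes> h)) = \<rho> 0 g *v u (inv g \<otimes> h) + u g"
    using assms by (intro u_mult) auto
  moreover have "g \<otimes> (inv g \<otimes> h) = h" using assms by (simp add: m_assoc[symmetric])
  moreover have "nnform (\<rho> 0 g *v u (inv g \<otimes> h)) \<nu> = nnform (u (inv g \<otimes> h)) (\<rho> 0 (inv g) *v \<nu>)"
    using rho_form[of 0 g "u (inv g \<otimes> h)" "\<rho> 0 (inv g) *v \<nu>"] assms by simp
  ultimately show ?thesis by (simp add: nnform_simps)
qed

text \<open>The averages of the Margulis cocycle over two segments of an orbit that differ by a unit
  time shift differ by a bounded amount, so they cannot change sign once they are large.\<close>

lemma drift_sign:
  obtains L0 where "\<forall>L y g y' \<nu>. L0 \<le> L \<longrightarrow> E (real L) y g y' \<longrightarrow> neutral_at y \<nu> \<longrightarrow> 1 < \<bar>nnform (u g) \<nu>\<bar>"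
    "\<forall>L y g y' g' y'' \<nu>. L0 \<le> L \<longrightarrow> E (real L) y g y' \<longrightarrow> E (real L) y' g' y'' \<longrightarrow> neutral_at y \<nu> \<longrightarrow>
       0 < nnform (u g) \<nu> * nnform (u g') (\<rho> 0 (inv g) *v \<nu>)"
proof -
  obtain B where B: "0 \<le> B" "\<And>T y g y'. E T y g y' \<Longrightarrow> T \<in> {-1..1} \<Longrightarrow> norm (u g) \<le> B"
    using u_bounded by blast
  \<comment> \<open>\<open>2 * (B * b)\<close> bounds the change of a window of the primitive when
    both of its ends move by a unit step, each contributing at most \<open>B * b\<close>.\<close>
  obtain L0 where L0: "\<And>L y g y' \<nu>. \<lbrakk>L0 \<le> L; E (real L) y g y'; neutral_at y \<nu>\<rbrakk> \<Longrightarrow>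
      2 * (B * b) + 1 < \<bar>nnform (u g) \<nu>\<bar>" using drift by blast
  have Bb: "0 \<le> B * b" using B pos by simp
  show thesis
  \<comment> \<open>\<open>max 1\<close> makes \<open>0\<close>, \<open>L\<close> and
    \<open>L + L\<close> three different indices, so that the group elements there can be
    prescribed.\<close>
  proof (rule that[of "max 1 L0"]; intro allI impI)
    fix L y g y' \<nu> assume "max 1 L0 \<le> L" "E (real L) y g y'" "neutral_at y \<nu>"
    then show "1 < \<bar>nnform (u g) \<nu>\<bar>" using L0[of L y g y' \<nu>] Bb by simp
  next
    fix L y g y' g' y'' \<nu>
    assume L: "max 1 L0 \<le> L" and e: "E (real L) y g y'" and e': "E (real L) y' g' y''" and n: "neutral_at y \<nu>"
    have y: "y \<in> K" and g: "g \<in> carrier \<Gamma>" "g' \<in> carrier \<Gamma>" using E_carrier[OF e] E_carrier[OF e'] by auto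
    have "\<exists>p. E (real k) y (fst p) (snd p) \<and> (k = 0 \<longrightarrow> fst p = \<one>) \<and> (k = L \<longrightarrow> fst p = g) \<and>
        (k = L + L \<longrightarrow> fst p = g \<otimes> g')" for k
    proof -
      consider "k = 0" | "k = L" | "k = L + L" | "k \<noteq> 0" "k \<noteq> L" "k \<noteq> L + L" by blast
      then show ?thesis
      proof cases
        case 1 then show ?thesis using E_refl[OF y] L by (intro exI[of _ "(\<one>, y)"]) auto
      next
        case 2 then show ?thesis using e L by (intro exI[of _ "(g, y')"]) auto
      next
        case 3 then show ?thesis using E_comp[OF e e'] L by (intro exI[of _ "(g \<otimes> g', y'')"]) auto
      next
        case 4 then show ?thesis using E_ex[OF y, of "real k"] by auto
      qed
    qed
    then obtain p where p: "\<And>k. E (real k) y (fst (p k)) (snd (p k))" and "fst (p 0) = \<one>"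
      "fst (p L) = g" "fst (p (L + L)) = g \<otimes> g'" by metis
    define G Y where "G k = fst (p k)" and "Y k = snd (p k)" for k
    have GY: "E (real k) y (G k) (Y k)" for k using p by (simp add: G_def Y_def)
    have G: "G 0 = \<one>" "G L = g" "G (L + L) = g \<otimes> g'" using \<open>fst (p 0) = \<one>\<close> \<open>fst (p L) = g\<close>
      \<open>fst (p (L + L)) = g \<otimes> g'\<close> by (simp_all add: G_def)
    have Gc: "G k \<in> carrier \<Gamma>" for k using E_carrier[OF GY] by blast
    have Eij: "E (real j) (Y i) (inv (G i) \<otimes> G (i + j)) (Y (i + j))" for i j
    proof -
      have "real (i + j) - real i = real j" by simp
      then show ?thesis using E_div[OF GY[of i] GY[of "i + j"]] by (simp only:)
    qed
    have N: "neutral_at (Y i) (\<rho> 0 (inv (G i)) *v \<nu>)" for i using neutral_equiv[OF GY n] .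
    \<comment> \<open>The cocycle over the window of length \<open>L\<close> starting at time
      \<open>k\<close>; the windows at \<open>0\<close> and at \<open>L\<close> are the two given
      segments.\<close>
    define F where "F k = nnform (u (G (k + L))) \<nu> - nnform (u (G k)) \<nu>" for k
    have "0 < F 0 * F L"
    proof (rule const_sign[of "2 * (B * b)"])
      show "2 * (B * b) < \<bar>F k\<bar>" for k
        using L0[OF _ Eij N, of L k] L by (simp add: nnform_u_diff Gc F_def)
      have step: "\<bar>nnform (u (G (Suc k))) \<nu> - nnform (u (G k)) \<nu>\<bar> \<le> B * b" for k
      proof -
        have "\<bar>nnform (u (inv (G k) \<otimes> G (k + 1))) (\<rho> 0 (inv (G k)) *v \<nu>)\<bar>
            \<le> norm (u (inv (G k) \<otimes> G (k + 1))) * norm (\<rho> 0 (inv (G k)) *v \<nu>)" by (rule abs_nnform_le)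
        also have "\<dots> \<le> B * b"
          using B(2)[OF Eij[of 1 k]] neutral_bound[OF _ N[of k]] E_carrier[OF GY[of k]] B(1)
          by (intro mult_mono) auto
        finally show ?thesis by (simp add: nnform_u_diff Gc)
      qed
      show "\<bar>F (Suc k) - F k\<bar> \<le> 2 * (B * b)" for k
        using step[of k] step[of "k + L"] by (simp add: F_def abs_le_iff)
    qed (use Bb in simp)
    moreover have "u \<one> = 0" using u_mult[of \<one> \<one>] rho_one[of 0] by simp
    then have "F 0 = nnform (u g) \<nu>" by (simp add: F_def G)
    moreover have "F L = nnform (u g') (\<rho> 0 (inv g) *v \<nu>)"
      using nnform_u_diff[of g "g \<otimes> g'" \<nu>] g by (simp add: F_def G m_assoc[symmetric])
    ultimately show "0 < nnform (u g) \<nu> * nnform (u g') (\<rho> 0 (inv g) *v \<nu>)" by simp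
  qed
qed


section \<open>The perturbed representation over one segment\<close>

text \<open>The null directions of the neutral plane are \<open>\<nu> - s *\<^sub>R e2n\<close> and
  \<open>\<nu> + s *\<^sub>R e2n\<close>; the sign \<open>s\<close> will be chosen so that the
  pairing with the former shrinks. The weight \<open>k\<close> outweighs the first-order influence
  of the other summands on these two coordinates.\<close>

definition contr_size :: "real \<Rightarrow> real \<Rightarrow> 'x \<Rightarrow> 'n dvec \<Rightarrow> 'n dvec \<Rightarrow> real" where
  "contr_size k s y \<nu> v = max (k * norm (Pi 1 y *v v)) \<bar>nnform v (\<nu> - s *\<^sub>R e2n)\<bar>"

definition expan_size :: "real \<Rightarrow> real \<Rightarrow> 'x \<Rightarrow> 'n dvec \<Rightarrow> 'n dvec \<Rightarrow> real" where
  "expan_size k s y \<nu> v = max (k * norm (Pi (-1) y *v v)) \<bar>nnform v (\<nu> + s *\<^sub>R e2n)\<bar>"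

lemma perturbation_derivative:
  assumes "g \<in> carrier \<Gamma>"
  shows "((\<lambda>t. \<rho> t g ** \<rho> 0 (inv g)) has_vector_derivative tangent_vector \<rho> g) (at 0)"
proof -
  have "matrix_inv (\<rho> 0 g) = \<rho> 0 (inv g)"
    by (rule matrix_inv_unique) (use rho_inv(3)[of 0 g] assms in simp)
  moreover obtain D where "((\<lambda>t. \<rho> t g) has_vector_derivative D) (at 0)"
    using rho_diff[OF assms] by (auto simp: vector_derivative_works)
  then have "((\<lambda>t. \<rho> t g ** \<rho> 0 (inv g)) has_vector_derivative D ** \<rho> 0 (inv g)) (at 0)"
    using has_vector_derivative_matrix_mult[OF _ has_vector_derivative_const] by fastforce
  ultimately show ?thesis
    unfolding tangent_vector_def by (simp add: vector_derivative_at)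
qed

lemma perturbation_skew:
  assumes "g \<in> carrier \<Gamma>"
  shows "nnform (tangent_vector \<rho> g *v v) w + nnform v (tangent_vector \<rho> g *v w) = 0"
proof (rule skew_derivative[OF _ _ perturbation_derivative[OF assms]])
  show "nnform ((\<rho> t g ** \<rho> 0 (inv g)) *v v) ((\<rho> t g ** \<rho> 0 (inv g)) *v w) = nnform v w"
    if "t \<in> {-1<..<1}" for t v w
    using that assms rho_form[of t g] rho_form[of 0 "inv g"]
    by (simp add: matrix_vector_mul_assoc[symmetric] rho_form del: rho0_inv)
  show "\<rho> 0 g ** \<rho> 0 (inv g) = mat 1" using rho_inv(4)[of 0 g] assms by simp
qed

text \<open>On the null lines of the plane spanned by \<open>\<nu>\<close> and \<open>e2n\<close> the perturbed
  representation acts, to first order, by \<open>1 - s t f\<close> with \<open>f\<close> the Margulis cocycle.\<close>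

lemma null_coordinate_step:
  assumes g: "g \<in> carrier \<Gamma>" and n: "neutral (Pi 1 y) (Pi (-1) y) \<nu>" and s: "s * s = 1"
    and t: "t \<in> {-1<..<1}"
    and R: "R = \<rho> t g ** \<rho> 0 (inv g) - mat 1 - t *\<^sub>R tangent_vector \<rho> g"
  shows "nnform (\<rho> t (inv g) *v v) (\<rho> 0 (inv g) *v \<nu> - s *\<^sub>R e2n) =
    (1 - s * (t * nnform (u g) \<nu>)) * nnform v (\<nu> - s *\<^sub>R e2n)
    + t * nnform (Pi 1 y *v v + Pi (-1) y *v v) (tangent_vector \<rho> g *v (\<nu> - s *\<^sub>R e2n))
    + nnform v (R *v (\<nu> - s *\<^sub>R e2n))"
proof -
  let ?n = "\<nu> - s *\<^sub>R e2n" and ?U = "tangent_vector \<rho> g"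
  define w where "w = Pi 1 y *v v + Pi (-1) y *v v"
  define f where "f = nnform (u g) \<nu>"
  note skew = perturbation_skew[OF g]
  \<comment> \<open>Skewness kills the diagonal entries on the neutral plane, so the derivative acts
    there through the single number \<open>f\<close>.\<close>
  have U: "nnform \<nu> (?U *v \<nu>) = 0" "nnform e2n (?U *v e2n) = 0" "nnform e2n (?U *v \<nu>) = - f" "nnform \<nu> (?U *v e2n) = f"
    using skew[of \<nu> \<nu>] skew[of e2n e2n] skew[of e2n \<nu>]
    unfolding f_def nnform_sym[of "?U *v _"] by auto
  have v: "w + nnform v \<nu> *\<^sub>R \<nu> - nnform v e2n *\<^sub>R e2n = v"
    unfolding w_def by (rule neutral_decomp[OF n])
  have "nnform v (?U *v ?n) = nnform w (?U *v ?n) + nnform v \<nu> * nnform \<nu> (?U *v ?n) - nnform v e2n * nnform e2n (?U *v ?n)"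
    using arg_cong[OF v, of "\<lambda>x. nnform x (?U *v ?n)"] by (simp add: nnform_simps)
  also have "\<dots> = nnform w (?U *v ?n) + nnform v \<nu> * (- (s * f)) - nnform v e2n * (- f)"
    by (simp add: nnform_simps matrix_vector_mult_diff_distrib matrix_vector_mult_scaleR U)
  also have "\<dots> = nnform w (?U *v ?n) - s * f * nnform v ?n"
    using s by (simp add: nnform_simps algebra_simps)
  finally have vU: "nnform v (?U *v ?n) = nnform w (?U *v ?n) - s * f * nnform v ?n" .
  have "\<rho> 0 (inv g) *v \<nu> - s *\<^sub>R e2n = \<rho> 0 (inv g) *v ?n"
    using g by (simp add: matrix_vector_mult_diff_distrib matrix_vector_mult_scaleR rho_e)
  \<comment> \<open>\<open>\<rho> t g\<close> undoes \<open>\<rho> t (inv g)\<close> in the left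
    entry; in the right entry it leaves the perturbation
    \<open>\<rho> t g ** \<rho> 0 (inv g)\<close>, which is then expanded to first order with
    remainder \<open>R\<close>.\<close>
  then have "nnform (\<rho> t (inv g) *v v) (\<rho> 0 (inv g) *v \<nu> - s *\<^sub>R e2n)
      = nnform (\<rho> t g *v (\<rho> t (inv g) *v v)) (\<rho> t g *v (\<rho> 0 (inv g) *v ?n))"
    by (simp only: rho_form[OF t g])
  also have "\<dots> = nnform v ((mat 1 + t *\<^sub>R ?U + R) *v ?n)"
    using rho_inv[OF t g] by (simp add: R matrix_vector_mul_assoc)
  also have "\<dots> = nnform v ?n + t * nnform v (?U *v ?n) + nnform v (R *v ?n)"
    by (simp add: matrix_vector_mult_add_rdistrib scaleR_matrix_vector_assoc[symmetric] nnform_simps)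
  finally show ?thesis unfolding vU by (simp add: w_def f_def algebra_simps)
qed

text \<open>Finitely many elements share one \<epsilon>. The first error is compared with
  \<open>t\<close>, since the gain on the neutral plane is itself of order \<open>t\<close>; for the
  other two summands, whose rate does not depend on \<open>t\<close>, a small error as in the second
  bound is enough.\<close>

lemma uniform_perturbation:
  assumes "finite F" "F \<subseteq> carrier \<Gamma>" "0 < \<delta>"
  obtains \<epsilon> where "0 < \<epsilon>" "\<epsilon> \<le> 1" "\<And>t g. \<lbrakk>0 < \<bar>t\<bar>; \<bar>t\<bar> < \<epsilon>; g \<in> F\<rbrakk> \<Longrightarrow>
    norm (\<rho> t g ** \<rho> 0 (inv g) - mat 1 - t *\<^sub>R tangent_vector \<rho> g) \<le> \<delta> * \<bar>t\<bar>"
    "\<And>t g. \<lbrakk>0 < \<bar>t\<bar>; \<bar>t\<bar> < \<epsilon>; g \<in> F\<rbrakk> \<Longrightarrow> norm (\<rho> 0 g ** \<rho> t (inv g) - mat 1) \<le> \<delta>"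
proof -
  have "\<forall>\<^sub>F t in at 0. norm (\<rho> t g ** \<rho> 0 (inv g) - mat 1 - t *\<^sub>R tangent_vector \<rho> g) \<le> \<delta> * \<bar>t\<bar> \<and>
      norm (\<rho> 0 g ** \<rho> t (inv g) - mat 1) \<le> \<delta>" if g: "g \<in> F" for g
  proof (rule eventually_conj)
    have gc: "g \<in> carrier \<Gamma>" using assms g by blast
    have 1: "\<rho> 0 g ** \<rho> 0 (inv g) = mat 1" using rho_inv(4)[of 0 g] gc by simp
    have "\<forall>\<^sub>F t in at 0. norm (\<rho> t g ** \<rho> 0 (inv g) - \<rho> 0 g ** \<rho> 0 (inv g) - (t - 0) *\<^sub>R tangent_vector \<rho> g) \<le> \<delta> * norm (t - 0)"
      using perturbation_derivative[OF gc] \<open>0 < \<delta>\<close>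
      unfolding has_vector_derivative_def has_derivative_within_alt2 by auto
    then show "\<forall>\<^sub>F t in at 0. norm (\<rho> t g ** \<rho> 0 (inv g) - mat 1 - t *\<^sub>R tangent_vector \<rho> g) \<le> \<delta> * \<bar>t\<bar>"
      by (simp add: 1)
    have "continuous (at 0) (\<lambda>t. \<rho> t (inv g))"
      using gc by (intro differentiable_imp_continuous_within rho_diff) auto
    then have "((\<lambda>t. \<rho> 0 g ** \<rho> t (inv g)) \<longlongrightarrow> \<rho> 0 g ** \<rho> 0 (inv g)) (at 0)"
      by (intro tendsto_matrix_mult tendsto_const) (simp add: continuous_at)
    then have "\<forall>\<^sub>F t in at 0. dist (\<rho> 0 g ** \<rho> t (inv g)) (mat 1) < \<delta>"
      using \<open>0 < \<delta>\<close> by (simp add: 1 tendstoD)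
    then show "\<forall>\<^sub>F t in at 0. norm (\<rho> 0 g ** \<rho> t (inv g) - mat 1) \<le> \<delta>"
      by eventually_elim (simp add: dist_norm)
  qed
  then have "\<forall>\<^sub>F t in at 0. \<forall>g\<in>F. norm (\<rho> t g ** \<rho> 0 (inv g) - mat 1 - t *\<^sub>R tangent_vector \<rho> g) \<le> \<delta> * \<bar>t\<bar> \<and>
      norm (\<rho> 0 g ** \<rho> t (inv g) - mat 1) \<le> \<delta>"
    using assms(1) by (simp add: eventually_ball_finite)
  then obtain d where "0 < d" "\<And>t. t \<noteq> 0 \<Longrightarrow> \<bar>t\<bar> < d \<Longrightarrow> \<forall>g\<in>F. norm (\<rho> t g ** \<rho> 0 (inv g) - mat 1 - t *\<^sub>R tangent_vector \<rho> g) \<le> \<delta> * \<bar>t\<bar> \<and>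
      norm (\<rho> 0 g ** \<rho> t (inv g) - mat 1) \<le> \<delta>"
    unfolding eventually_at by auto
  then show thesis by (intro that[of "min d 1"]) auto
qed

text \<open>The sizes are equivalent to the euclidean norm, uniformly over \<open>K\<close>. As
  \<open>s\<close> is a sign, half sum and half difference of the null coordinates recover the
  pairings with \<nu> and \<open>e2n\<close> up to sign, and the resolution of the identity bounds
  \<open>norm v\<close> by \<open>m + m + m * b + m\<close>. No \<open>k\<close> enters there
  because \<open>1 \<le> k\<close>.\<close>

lemma size_bounds:
  assumes y: "y \<in> K" and n: "neutral_at y \<nu>" and s: "\<bar>s\<bar> = 1" and k: "1 \<le> k"
  shows "norm v \<le> (b + 3) * max (contr_size k s y \<nu> v) (expan_size k s y \<nu> v)"
    and "max (contr_size k s y \<nu> v) (expan_size k s y \<nu> v) \<le> (k * b + b + 1) * norm v"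
proof -
  define m where "m = max (contr_size k s y \<nu> v) (expan_size k s y \<nu> v)"
  have \<nu>: "norm \<nu> \<le> b" using neutral_bound[OF y n] .
  have P1: "k * norm (Pi 1 y *v v) \<le> m" and P2: "k * norm (Pi (-1) y *v v) \<le> m"
    and a1: "\<bar>nnform v (\<nu> - s *\<^sub>R e2n)\<bar> \<le> m" and a2: "\<bar>nnform v (\<nu> + s *\<^sub>R e2n)\<bar> \<le> m"
    unfolding m_def contr_size_def expan_size_def by auto
  have m0: "0 \<le> m" using a1 by simp
  have Q: "norm (Pi 1 y *v v) \<le> m" "norm (Pi (-1) y *v v) \<le> m"
    using P1 P2 mult_right_mono[OF k norm_ge_zero[of "Pi 1 y *v v"]]
      mult_right_mono[OF k norm_ge_zero[of "Pi (-1) y *v v"]] by linarith+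
  have "s = 1 \<or> s = -1" using s by linarith
  then have ab: "\<bar>nnform v \<nu>\<bar> \<le> m" "\<bar>nnform v e2n\<bar> \<le> m"
    using a1 a2 by (auto simp: nnform_simps)
  have "norm v = norm (Pi 1 y *v v + Pi (-1) y *v v + nnform v \<nu> *\<^sub>R \<nu> - nnform v e2n *\<^sub>R e2n)"
    by (simp only: neutral_decomp[OF n])
  also have "\<dots> \<le> norm (Pi 1 y *v v) + norm (Pi (-1) y *v v) + norm (nnform v \<nu> *\<^sub>R \<nu>) + norm (nnform v e2n *\<^sub>R (e2n :: 'n dvec))"
    using norm_triangle_ineq4[of "Pi 1 y *v v + Pi (-1) y *v v + nnform v \<nu> *\<^sub>R \<nu>" "nnform v e2n *\<^sub>R (e2n :: 'n dvec)"]
      norm_triangle_ineq[of "Pi 1 y *v v + Pi (-1) y *v v" "nnform v \<nu> *\<^sub>R \<nu>"]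
      norm_triangle_ineq[of "Pi 1 y *v v" "Pi (-1) y *v v"] by linarith
  also have "\<dots> \<le> m + m + m * b + m"
    using Q ab \<nu> pos m0 by (intro add_mono) (auto intro!: mult_mono)
  finally show "norm v \<le> (b + 3) * max (contr_size k s y \<nu> v) (expan_size k s y \<nu> v)"
    by (simp add: m_def algebra_simps)
  have W: "k * norm (Pi \<sigma> y *v v) \<le> (k * b + b + 1) * norm v" if "\<sigma> \<in> {1, -1}" for \<sigma>
  proof -
    have "k * norm (Pi \<sigma> y *v v) \<le> k * (b * norm v)" using Pi_bound[OF that y] k by (intro mult_left_mono) auto
    also have "\<dots> \<le> (k * b + b + 1) * norm v" using pos by (simp add: algebra_simps)
    finally show ?thesis .
  qed
  have N: "\<bar>nnform v x\<bar> \<le> (k * b + b + 1) * norm v" if "norm x \<le> b + 1" for x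
  proof -
    have "\<bar>nnform v x\<bar> \<le> norm v * (b + 1)"
      using that by (intro abs_nnform_bound) auto
    also have "\<dots> \<le> (k * b + b + 1) * norm v" using pos k by (simp add: algebra_simps)
    finally show ?thesis .
  qed
  have "norm (\<nu> - s *\<^sub>R e2n) \<le> b + 1" "norm (\<nu> + s *\<^sub>R e2n) \<le> b + 1"
    using norm_triangle_ineq4[of \<nu> "s *\<^sub>R e2n"] norm_triangle_ineq[of \<nu> "s *\<^sub>R e2n"] \<nu> s by simp_all
  then show "max (contr_size k s y \<nu> v) (expan_size k s y \<nu> v) \<le> (k * b + b + 1) * norm v"
    unfolding contr_size_def expan_size_def using W N by auto
qed

text \<open>Over length \<open>L\<close> the hyperbolic summands gain the factor 4, while the null
  coordinates are multiplied by \<open>1 - \<bar>t * f\<bar>\<close> and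
  \<open>1 + \<bar>t * f\<bar>\<close> with \<open>1 < \<bar>f\<bar>\<close>. Relative errors of at
  most \<open>\<bar>t\<bar> / 4\<close> in the plane and \<open>1 / 4\<close> on the summands leave
  the rate \<open>\<bar>t\<bar> / 2\<close> for both sizes.\<close>

lemma one_step:
  assumes L: "C * exp (- c * real L) \<le> 1 / 4"
    and drift1: "\<And>y g y' \<nu>. \<lbrakk>E (real L) y g y'; neutral_at y \<nu>\<rbrakk> \<Longrightarrow> 1 < \<bar>nnform (u g) \<nu>\<bar>"
  obtains k \<epsilon> where "1 \<le> k" "0 < \<epsilon>" "\<epsilon> \<le> 1"
    "\<forall>t y g y' \<nu> v s. 0 < \<bar>t\<bar> \<longrightarrow> \<bar>t\<bar> < \<epsilon> \<longrightarrow> E (real L) y g y' \<longrightarrow> neutral_at y \<nu> \<longrightarrow>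
       s = sgn (t * nnform (u g) \<nu>) \<longrightarrow>
       contr_size k s y' (\<rho> 0 (inv g) *v \<nu>) (\<rho> t (inv g) *v v) \<le>
         (1 - \<bar>t\<bar> / 2) * max (contr_size k s y \<nu> v) (expan_size k s y \<nu> v) \<and>
       (contr_size k s y \<nu> v \<le> expan_size k s y \<nu> v \<longrightarrow>
         (1 + \<bar>t\<bar> / 2) * expan_size k s y \<nu> v \<le> expan_size k s y' (\<rho> 0 (inv g) *v \<nu>) (\<rho> t (inv g) *v v))"
proof -
  define F where "F = {g. \<exists>T\<in>{real L..real L}. \<exists>y y'. E T y g y'}"
  have fin: "finite F" unfolding F_def by (rule finite_E)
  have inF: "g \<in> F" if "E (real L) y g y'" for y g y'
    unfolding F_def using that by auto
  have Fc: "F \<subseteq> carrier \<Gamma>" unfolding F_def using E_carrier by blast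
  define Um where "Um = (\<Sum>g\<in>F. norm (tangent_vector \<rho> g))"
  define Rm where "Rm = 1 + (\<Sum>g\<in>F. norm (\<rho> 0 (inv g)))"
  have Um: "norm (tangent_vector \<rho> g) \<le> Um" if "g \<in> F" for g
    unfolding Um_def using fin that by (intro member_le_sum) auto
  have Rm: "norm (\<rho> 0 (inv g)) \<le> Rm" if "g \<in> F" for g
    unfolding Rm_def using fin that by (intro add_increasing member_le_sum) auto
  have Um0: "0 \<le> Um" and Rm0: "1 \<le> Rm" by (simp_all add: Um_def Rm_def sum_nonneg)
  \<comment> \<open>With two summands of weighted size at most \<open>m\<close>, the factor 32
    brings the first-order coupling into the plane down to
    \<open>\<bar>t\<bar> * m / 16\<close>.\<close>
  define k where "k = max 1 (32 * (Um * (b + 1)))"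
  have k: "1 \<le> k" "32 * (Um * (b + 1)) \<le> k" by (simp_all add: k_def)
  \<comment> \<open>The first entry makes the remainder in the plane at most
    \<open>\<bar>t\<bar> * m / 8\<close>; the second, which depends on \<open>k\<close>, makes the
    weighted error on the summands at most \<open>m / 4\<close>.\<close>
  define \<delta> where "\<delta> = min (1 / (8 * ((b + 3) * (b + 1)))) (1 / (4 * (k * (Rm * (b * (b + 3))))))"
  have \<delta>: "0 < \<delta>" using pos k Rm0 by (simp add: \<delta>_def)
  have \<delta>1: "(b + 3) * (b + 1) * \<delta> \<le> 1 / 8"
  proof -
    have "(b + 3) * (b + 1) * \<delta> \<le> (b + 3) * (b + 1) * (1 / (8 * ((b + 3) * (b + 1))))"
      using pos by (intro mult_left_mono) (auto simp: \<delta>_def)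
    then show ?thesis using pos by simp
  qed
  have \<delta>2: "k * (Rm * (b * (b + 3))) * \<delta> \<le> 1 / 4"
  proof -
    have "k * (Rm * (b * (b + 3))) * \<delta> \<le> k * (Rm * (b * (b + 3))) * (1 / (4 * (k * (Rm * (b * (b + 3))))))"
      using pos k Rm0 by (intro mult_left_mono) (auto simp: \<delta>_def)
    then show ?thesis using pos k Rm0 by simp
  qed
  obtain \<epsilon>' where \<epsilon>': "0 < \<epsilon>'" "\<epsilon>' \<le> 1"
    "\<And>t g. \<lbrakk>0 < \<bar>t\<bar>; \<bar>t\<bar> < \<epsilon>'; g \<in> F\<rbrakk> \<Longrightarrow>
      norm (\<rho> t g ** \<rho> 0 (inv g) - mat 1 - t *\<^sub>R tangent_vector \<rho> g) \<le> \<delta> * \<bar>t\<bar>"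
    "\<And>t g. \<lbrakk>0 < \<bar>t\<bar>; \<bar>t\<bar> < \<epsilon>'; g \<in> F\<rbrakk> \<Longrightarrow> norm (\<rho> 0 g ** \<rho> t (inv g) - mat 1) \<le> \<delta>"
    using uniform_perturbation[OF fin Fc \<delta>] by blast
  \<comment> \<open>Since \<open>\<bar>f\<bar> \<le> Um * b\<close>, the second entry keeps
    \<open>\<bar>t * f\<bar>\<close> at most 1, so that \<open>1 - \<bar>t * f\<bar>\<close> is not
    negative.\<close>
  define \<epsilon> where "\<epsilon> = min \<epsilon>' (1 / (Um * b + 1))"
  have Ub: "0 \<le> Um * b" using Um0 pos by simp
  have \<epsilon>: "0 < \<epsilon>" "\<epsilon> \<le> 1" using \<epsilon>' Ub by (simp_all add: \<epsilon>_def)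
  have main: "contr_size k s y' (\<rho> 0 (inv g) *v \<nu>) (\<rho> t (inv g) *v v) \<le> (1 - \<bar>t\<bar> / 2) * m \<and>
      (m = expan_size k s y \<nu> v \<longrightarrow>
        (1 + \<bar>t\<bar> / 2) * m \<le> expan_size k s y' (\<rho> 0 (inv g) *v \<nu>) (\<rho> t (inv g) *v v))"
    if t0: "0 < \<bar>t\<bar>" and t\<epsilon>: "\<bar>t\<bar> < \<epsilon>" and e: "E (real L) y g y'" and n: "neutral_at y \<nu>"
      and s: "s = sgn (t * nnform (u g) \<nu>)"
      and m: "m = max (contr_size k s y \<nu> v) (expan_size k s y \<nu> v)" for t y g y' \<nu> v s m
  proof -
    have g: "g \<in> carrier \<Gamma>" and y: "y \<in> K" and y': "y' \<in> K" using E_carrier[OF e] by auto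
    have gF: "g \<in> F" using inF[OF e] .
    have t1: "t \<in> {-1<..<1}" and t\<epsilon>': "\<bar>t\<bar> < \<epsilon>'" using t\<epsilon> \<epsilon> by (auto simp: \<epsilon>_def)
    define f where "f = nnform (u g) \<nu>"
    have \<nu>: "norm \<nu> \<le> b" using neutral_bound[OF y n] .
    have f1: "1 < \<bar>f\<bar>" using drift1[OF e n] by (simp add: f_def)
    have "\<bar>f\<bar> \<le> norm (u g) * norm \<nu>" unfolding f_def by (rule abs_nnform_le)
    also have "\<dots> \<le> Um * b"
      using norm_matrix_vector_le[of "tangent_vector \<rho> g" e2n] Um[OF gF] \<nu> Um0 by (intro mult_mono) auto
    finally have fU: "\<bar>f\<bar> \<le> Um * b" .
    have tf1: "\<bar>t * f\<bar> \<le> 1"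
    proof -
      have "\<bar>t\<bar> * \<bar>f\<bar> \<le> (1 / (Um * b + 1)) * (Um * b)"
        using t\<epsilon> fU Ub by (intro mult_mono) (auto simp: \<epsilon>_def)
      also have "\<dots> \<le> 1" using Ub by simp
      finally show ?thesis by (simp add: abs_mult)
    qed
    have tf2: "\<bar>t\<bar> \<le> \<bar>t * f\<bar>" using f1 mult_left_mono[of 1 "\<bar>f\<bar>" "\<bar>t\<bar>"] by (simp add: abs_mult)
    have stf: "s * (t * f) = \<bar>t * f\<bar>" "s * s = 1" "\<bar>s\<bar> = 1"
      using t0 f1 unfolding s f_def[symmetric] by (auto simp: sgn_if abs_if)
    have P1: "k * norm (Pi 1 y *v v) \<le> m" and P2: "k * norm (Pi (-1) y *v v) \<le> m"
      and a1: "\<bar>nnform v (\<nu> - s *\<^sub>R e2n)\<bar> \<le> m" and a2: "\<bar>nnform v (\<nu> + s *\<^sub>R e2n)\<bar> \<le> m"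
      unfolding m contr_size_def expan_size_def by auto
    have m0: "0 \<le> m" using a1 by simp
    have normv: "norm v \<le> (b + 3) * m"
      unfolding m by (rule size_bounds[OF y n stf(3) k(1)])
    define R where "R = \<rho> t g ** \<rho> 0 (inv g) - mat 1 - t *\<^sub>R tangent_vector \<rho> g"
    have R: "norm R \<le> \<delta> * \<bar>t\<bar>" unfolding R_def using \<epsilon>'(3)[OF t0 t\<epsilon>' gF] .
    have center: "\<bar>nnform (\<rho> t (inv g) *v v) (\<rho> 0 (inv g) *v \<nu> - r *\<^sub>R e2n)
        - (1 - r * (t * f)) * nnform v (\<nu> - r *\<^sub>R e2n)\<bar> \<le> \<bar>t\<bar> / 4 * m" if r: "r * r = 1" for r
    proof -
      let ?n = "\<nu> - r *\<^sub>R e2n"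
      let ?w = "Pi 1 y *v v + Pi (-1) y *v v"
      have r1: "\<bar>r\<bar> = 1" using r by (auto simp: square_eq_1_iff)
      have nn: "norm ?n \<le> b + 1"
        using norm_triangle_ineq4[of \<nu> "r *\<^sub>R e2n"] \<nu> r1 by simp
      have "\<bar>t * nnform ?w (tangent_vector \<rho> g *v ?n)\<bar> \<le> \<bar>t\<bar> * (norm ?w * (Um * (b + 1)))"
      proof -
        have "norm (tangent_vector \<rho> g *v ?n) \<le> Um * (b + 1)"
          using Um[OF gF] nn by (rule norm_matrix_vector_bound)
        then have "\<bar>nnform ?w (tangent_vector \<rho> g *v ?n)\<bar> \<le> norm ?w * (Um * (b + 1))"
          by (intro abs_nnform_bound) auto
        then show ?thesis by (simp add: abs_mult mult_left_mono)
      qed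
      also have "\<dots> \<le> \<bar>t\<bar> * (m / 16)"
      proof -
        have "k * norm ?w \<le> k * (norm (Pi 1 y *v v) + norm (Pi (-1) y *v v))"
          using k by (intro mult_left_mono norm_triangle_ineq) auto
        then have "norm ?w * k \<le> 2 * m" using P1 P2 by (simp add: algebra_simps)
        moreover have "norm ?w * (32 * (Um * (b + 1))) \<le> norm ?w * k"
          using k by (intro mult_left_mono) auto
        ultimately have "norm ?w * (Um * (b + 1)) \<le> m / 16" by simp
        then show ?thesis by (intro mult_left_mono) auto
      qed
      finally have e1: "\<bar>t * nnform ?w (tangent_vector \<rho> g *v ?n)\<bar> \<le> \<bar>t\<bar> * (m / 16)" .
      have "\<bar>nnform v (R *v ?n)\<bar> \<le> norm v * norm (R *v ?n)" by (rule abs_nnform_le)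
      also have "\<dots> \<le> ((b + 3) * m) * ((\<delta> * \<bar>t\<bar>) * (b + 1))"
      proof (rule mult_mono[OF normv])
        show "norm (R *v ?n) \<le> (\<delta> * \<bar>t\<bar>) * (b + 1)"
          using R nn by (rule norm_matrix_vector_bound)
      qed (use pos m0 in auto)
      also have "\<dots> = ((b + 3) * (b + 1) * \<delta>) * (\<bar>t\<bar> * m)" by (simp add: mult_ac)
      also have "\<dots> \<le> (1 / 8) * (\<bar>t\<bar> * m)" using \<delta>1 m0 by (intro mult_right_mono) auto
      finally have e2: "\<bar>nnform v (R *v ?n)\<bar> \<le> (1 / 8) * (\<bar>t\<bar> * m)" .
      have "nnform (\<rho> t (inv g) *v v) (\<rho> 0 (inv g) *v \<nu> - r *\<^sub>R e2n) - (1 - r * (t * f)) * nnform v ?n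
          = t * nnform ?w (tangent_vector \<rho> g *v ?n) + nnform v (R *v ?n)"
        using null_coordinate_step[OF g n r t1 R_def, of v] by (simp add: f_def)
      moreover have "0 \<le> \<bar>t\<bar> * m" using m0 by simp
      ultimately show ?thesis using e1 e2 abs_triangle_ineq[of "t * nnform ?w (tangent_vector \<rho> g *v ?n)" "nnform v (R *v ?n)"] by simp
    qed
    define D where "D = \<rho> 0 g ** \<rho> t (inv g) - mat 1"
    have D: "norm D \<le> \<delta>" unfolding D_def using \<epsilon>'(4)[OF t0 t\<epsilon>' gF] .
    have side: "Pi \<sigma> y' *v (\<rho> t (inv g) *v v) = \<rho> 0 (inv g) *v (Pi \<sigma> y *v v) + \<rho> 0 (inv g) *v (Pi \<sigma> y *v (D *v v))"
      "k * norm (\<rho> 0 (inv g) *v (Pi \<sigma> y *v (D *v v))) \<le> m / 4" if \<sigma>: "\<sigma> \<in> {1, -1}" for \<sigma>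
    proof -
      have "\<rho> 0 g *v (\<rho> t (inv g) *v v) = v + D *v v"
        by (simp add: D_def matrix_vector_mult_diff_rdistrib matrix_vector_mul_assoc)
      then have "Pi \<sigma> y *v v + Pi \<sigma> y *v (D *v v) = \<rho> 0 g *v (Pi \<sigma> y' *v (\<rho> t (inv g) *v v))"
        using Pi_equiv[OF \<sigma> e, of "\<rho> t (inv g) *v v"] by (simp add: matrix_vector_right_distrib)
      then have "\<rho> 0 (inv g) *v (Pi \<sigma> y *v v + Pi \<sigma> y *v (D *v v)) = Pi \<sigma> y' *v (\<rho> t (inv g) *v v)"
        using g by simp
      then show "Pi \<sigma> y' *v (\<rho> t (inv g) *v v) = \<rho> 0 (inv g) *v (Pi \<sigma> y *v v) + \<rho> 0 (inv g) *v (Pi \<sigma> y *v (D *v v))"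
        by (simp add: matrix_vector_right_distrib)
      have "norm (D *v v) \<le> \<delta> * ((b + 3) * m)"
        using D normv by (rule norm_matrix_vector_bound)
      then have "norm (Pi \<sigma> y *v (D *v v)) \<le> b * (\<delta> * ((b + 3) * m))"
        using pos by (intro order_trans[OF Pi_bound[OF \<sigma> y] mult_left_mono]) auto
      then have "norm (\<rho> 0 (inv g) *v (Pi \<sigma> y *v (D *v v))) \<le> Rm * (b * (\<delta> * ((b + 3) * m)))"
        by (rule norm_matrix_vector_bound[OF Rm[OF gF]])
      then have "k * norm (\<rho> 0 (inv g) *v (Pi \<sigma> y *v (D *v v))) \<le> k * (Rm * (b * (\<delta> * ((b + 3) * m))))"
        using k by (intro mult_left_mono) auto
      also have "\<dots> = (k * (Rm * (b * (b + 3))) * \<delta>) * m" by (simp add: mult_ac)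
      also have "\<dots> \<le> (1 / 4) * m" using \<delta>2 m0 by (intro mult_right_mono) auto
      finally show "k * norm (\<rho> 0 (inv g) *v (Pi \<sigma> y *v (D *v v))) \<le> m / 4" by simp
    qed
    have tm: "0 \<le> \<bar>t\<bar> * m" "\<bar>t\<bar> * m \<le> m" using m0 t1 mult_right_mono[of "\<bar>t\<bar>" 1 m] by auto
    have contr_W: "k * norm (Pi 1 y' *v (\<rho> t (inv g) *v v)) \<le> (1 - \<bar>t\<bar> / 2) * m"
    proof -
      have "norm (\<rho> 0 (inv g) *v (Pi 1 y *v v)) \<le> 1 / 4 * norm (Pi 1 y *v v)"
        using contraction[OF _ e, of 1 v] mult_right_mono[OF L norm_ge_zero[of "Pi 1 y *v v"]] by simp
      then have "k * norm (\<rho> 0 (inv g) *v (Pi 1 y *v v)) \<le> k * (1 / 4 * norm (Pi 1 y *v v))"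
        using k by (intro mult_left_mono) auto
      then have "k * norm (\<rho> 0 (inv g) *v (Pi 1 y *v v)) \<le> m / 4" using P1 by simp
      moreover have "k * norm (Pi 1 y' *v (\<rho> t (inv g) *v v)) \<le> k * norm (\<rho> 0 (inv g) *v (Pi 1 y *v v))
          + k * norm (\<rho> 0 (inv g) *v (Pi 1 y *v (D *v v)))"
        unfolding side(1)[OF insertI1] distrib_left[symmetric]
        using k by (intro mult_left_mono norm_triangle_ineq) auto
      ultimately show ?thesis using side(2)[of 1] tm by (simp add: algebra_simps)
    qed
    have contr_E: "\<bar>nnform (\<rho> t (inv g) *v v) (\<rho> 0 (inv g) *v \<nu> - s *\<^sub>R e2n)\<bar> \<le> (1 - \<bar>t\<bar> / 2) * m"
    proof -
      let ?X = "(1 - \<bar>t * f\<bar>) * nnform v (\<nu> - s *\<^sub>R e2n)"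
      have "\<bar>1 - \<bar>t * f\<bar>\<bar> \<le> 1 - \<bar>t\<bar>" using tf1 tf2 by linarith
      then have "\<bar>?X\<bar> \<le> (1 - \<bar>t\<bar>) * m"
        unfolding abs_mult[of "1 - \<bar>t * f\<bar>"] using a1 by (intro mult_mono) auto
      moreover have "(1 - \<bar>t\<bar>) * m + \<bar>t\<bar> / 4 * m \<le> (1 - \<bar>t\<bar> / 2) * m"
        using tm by (simp add: algebra_simps)
      ultimately show ?thesis using center[OF stf(2)] unfolding stf(1) by linarith
    qed
    have "expan_size k s y \<nu> v = m \<Longrightarrow> (1 + \<bar>t\<bar> / 2) * m \<le> expan_size k s y' (\<rho> 0 (inv g) *v \<nu>) (\<rho> t (inv g) *v v)"
    proof -
      assume "expan_size k s y \<nu> v = m"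
      then consider "m = k * norm (Pi (-1) y *v v)" | "m = \<bar>nnform v (\<nu> + s *\<^sub>R e2n)\<bar>"
        unfolding expan_size_def by linarith
      then show ?thesis
      proof cases
        case 1
        \<comment> \<open>Forward expansion is contraction along the reversed segment, applied to
          the vector at the far end.\<close>
        have "Pi (-1) y *v v = \<rho> 0 g *v (\<rho> 0 (inv g) *v (Pi (-1) y *v v))" using g by simp
        moreover have "\<rho> 0 (inv g) *v (Pi (-1) y *v v) = Pi (-1) y' *v (\<rho> 0 (inv g) *v v)"
          using Pi_equiv[OF _ e, of "-1" "\<rho> 0 (inv g) *v v"] g by simp
        moreover have "norm (\<rho> 0 (inv (inv g)) *v (Pi (-1) y' *v (\<rho> 0 (inv g) *v v)))
            \<le> 1 / 4 * norm (Pi (-1) y' *v (\<rho> 0 (inv g) *v v))"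
          using contraction[OF _ E_neg[OF e], of "-1" "\<rho> 0 (inv g) *v v"]
            mult_right_mono[OF L norm_ge_zero[of "Pi (-1) y' *v (\<rho> 0 (inv g) *v v)"]] by simp
        ultimately have "norm (Pi (-1) y *v v) \<le> 1 / 4 * norm (\<rho> 0 (inv g) *v (Pi (-1) y *v v))"
          using g by simp
        then have "k * norm (Pi (-1) y *v v) \<le> k * (1 / 4 * norm (\<rho> 0 (inv g) *v (Pi (-1) y *v v)))"
          using k by (intro mult_left_mono) auto
        then have "4 * m \<le> k * norm (\<rho> 0 (inv g) *v (Pi (-1) y *v v))" using 1 by simp
        moreover have "k * norm (\<rho> 0 (inv g) *v (Pi (-1) y *v v)) \<le> k * norm (Pi (-1) y' *v (\<rho> t (inv g) *v v))
            + k * norm (\<rho> 0 (inv g) *v (Pi (-1) y *v (D *v v)))"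
        proof -
          have "norm (\<rho> 0 (inv g) *v (Pi (-1) y *v v)) \<le> norm (Pi (-1) y' *v (\<rho> t (inv g) *v v))
            + norm (\<rho> 0 (inv g) *v (Pi (-1) y *v (D *v v)))"
            using side(1)[of "-1"] norm_triangle_ineq4[of "Pi (-1) y' *v (\<rho> t (inv g) *v v)" "\<rho> 0 (inv g) *v (Pi (-1) y *v (D *v v))"]
            by simp
          then show ?thesis unfolding distrib_left[symmetric] using k by (intro mult_left_mono) auto
        qed
        ultimately have "2 * m \<le> k * norm (Pi (-1) y' *v (\<rho> t (inv g) *v v))" using side(2)[of "-1"] m0 by simp
        moreover have "(1 + \<bar>t\<bar> / 2) * m \<le> 2 * m" using tm by (simp add: algebra_simps)
        ultimately show ?thesis unfolding expan_size_def by linarith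
      next
        case 2
        \<comment> \<open>The other null coordinate is \<open>center\<close> at
          \<open>r = - s\<close>, where the factor is \<open>1 + \<bar>t * f\<bar>\<close>.\<close>
        let ?X = "(1 - (-s) * (t * f)) * nnform v (\<nu> - (-s) *\<^sub>R e2n)"
        let ?A = "nnform (\<rho> t (inv g) *v v) (\<rho> 0 (inv g) *v \<nu> - (-s) *\<^sub>R e2n)"
        have X: "\<bar>?X\<bar> = (1 + \<bar>t * f\<bar>) * m"
          unfolding abs_mult using stf 2 by (simp add: abs_mult)
        have "(1 + \<bar>t\<bar>) * m \<le> (1 + \<bar>t * f\<bar>) * m" using tf2 m0 by (intro mult_right_mono) auto
        moreover have "\<bar>?A - ?X\<bar> \<le> \<bar>t\<bar> / 4 * m" using center[of "-s"] stf(2) by simp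
        ultimately have "(1 + \<bar>t\<bar>) * m - \<bar>t\<bar> / 4 * m \<le> \<bar>?X\<bar> - \<bar>?A - ?X\<bar>"
          unfolding X by (rule diff_mono)
        also have "\<dots> \<le> \<bar>?A\<bar>" by linarith
        finally have "(1 + \<bar>t\<bar>) * m - \<bar>t\<bar> / 4 * m \<le> \<bar>?A\<bar>" .
        then have "(1 + \<bar>t\<bar> / 2) * m \<le> \<bar>nnform (\<rho> t (inv g) *v v) (\<rho> 0 (inv g) *v \<nu> + s *\<^sub>R e2n)\<bar>"
          using tm by (simp add: algebra_simps)
        then show ?thesis unfolding expan_size_def by linarith
      qed
    qed
    with contr_W contr_E show ?thesis unfolding contr_size_def by auto
  qed
  show thesis
  proof (rule that[OF k(1) \<epsilon>], intro allI impI conjI)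
    fix t y g y' \<nu> v s
    assume A: "0 < \<bar>t\<bar>" "\<bar>t\<bar> < \<epsilon>" "E (real L) y g y'" "neutral_at y \<nu>" "s = sgn (t * nnform (u g) \<nu>)"
    show "contr_size k s y' (\<rho> 0 (inv g) *v \<nu>) (\<rho> t (inv g) *v v) \<le>
         (1 - \<bar>t\<bar> / 2) * max (contr_size k s y \<nu> v) (expan_size k s y \<nu> v)"
      using main[OF A refl] by blast
    assume "contr_size k s y \<nu> v \<le> expan_size k s y \<nu> v"
    then have "max (contr_size k s y \<nu> v) (expan_size k s y \<nu> v) = expan_size k s y \<nu> v" by simp
    then show "(1 + \<bar>t\<bar> / 2) * expan_size k s y \<nu> v \<le> expan_size k s y' (\<rho> 0 (inv g) *v \<nu>) (\<rho> t (inv g) *v v)"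
      using main[OF A refl, of v] by simp
  qed
qed


section \<open>Finiteness of bounded returns\<close>

text \<open>Sampling the orbit at the multiples of \<open>L\<close> produces the sequences of
  \<open>cone_sequence_length\<close>. The number of samples, hence the time, is bounded, and
  \<open>finite_E\<close> turns bounded time into finitely many elements.\<close>

lemma finite_bounded_returns:
  obtains \<epsilon> where "0 < \<epsilon>" "\<epsilon> \<le> 1"
    "\<And>t R. 0 < \<bar>t\<bar> \<Longrightarrow> \<bar>t\<bar> < \<epsilon> \<Longrightarrow>
      finite {g \<in> carrier \<Gamma>. \<exists>v. nnform v v = -1 \<and> norm v \<le> R \<and> norm (\<rho> t g *v v) \<le> R}"
proof -
  obtain L1 where L1: "\<forall>L y g y' \<nu>. L1 \<le> L \<longrightarrow> E (real L) y g y' \<longrightarrow> neutral_at y \<nu> \<longrightarrow> 1 < \<bar>nnform (u g) \<nu>\<bar>"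
    "\<forall>L y g y' g' y'' \<nu>. L1 \<le> L \<longrightarrow> E (real L) y g y' \<longrightarrow> E (real L) y' g' y'' \<longrightarrow> neutral_at y \<nu> \<longrightarrow>
       0 < nnform (u g) \<nu> * nnform (u g') (\<rho> 0 (inv g) *v \<nu>)"
    by (rule drift_sign) (rule that)
  have "(\<lambda>L. C * exp (- c) ^ L) \<longlonglongrightarrow> 0"
    using pos by (intro tendsto_mult_right_zero LIMSEQ_power_zero) auto
  then have "\<forall>\<^sub>F L in sequentially. C * exp (- c) ^ L < 1 / 4" by (intro order_tendstoD) auto
  then obtain L2 where L2: "\<And>L. L2 \<le> L \<Longrightarrow> C * exp (- c) ^ L < 1 / 4"
    unfolding eventually_sequentially by blast
  \<comment> \<open>\<open>L1\<close> gives the drift and its sign, \<open>L2\<close> the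
    contraction by \<open>1 / 4\<close>; \<open>L\<close> has to be positive since times are divided
    by it.\<close>
  define L where "L = max 1 (max L1 L2)"
  have L: "1 \<le> L" "L1 \<le> L" "L2 \<le> L" by (simp_all add: L_def)
  have ex: "exp (- c * real L) = exp (- c) ^ L" by (metis exp_of_nat_mult mult.commute)
  have L4: "C * exp (- c * real L) \<le> 1 / 4" unfolding ex using L2[OF L(3)] by simp
  note drift1 = L1(1)[rule_format, OF L(2)] and dsign = L1(2)[rule_format, OF L(2)]
  obtain k \<epsilon> where k: "1 \<le> k" and \<epsilon>: "0 < \<epsilon>" "\<epsilon> \<le> 1" and
    step:
    "\<forall>t y g y' \<nu> v s. 0 < \<bar>t\<bar> \<longrightarrow> \<bar>t\<bar> < \<epsilon> \<longrightarrow> E (real L) y g y' \<longrightarrow> neutral_at y \<nu> \<longrightarrow>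
       s = sgn (t * nnform (u g) \<nu>) \<longrightarrow>
       contr_size k s y' (\<rho> 0 (inv g) *v \<nu>) (\<rho> t (inv g) *v v) \<le>
         (1 - \<bar>t\<bar> / 2) * max (contr_size k s y \<nu> v) (expan_size k s y \<nu> v) \<and>
       (contr_size k s y \<nu> v \<le> expan_size k s y \<nu> v \<longrightarrow>
         (1 + \<bar>t\<bar> / 2) * expan_size k s y \<nu> v \<le> expan_size k s y' (\<rho> 0 (inv g) *v \<nu>) (\<rho> t (inv g) *v v))"
    by (rule one_step[OF L4]) (erule (1) drift1, rule that)
  show thesis
  proof (rule that[OF \<epsilon>])
    fix t R assume t0: "0 < \<bar>t\<bar>" and t\<epsilon>: "\<bar>t\<bar> < \<epsilon>"
    have t1: "t \<in> {-1<..<1}" using t\<epsilon> \<epsilon> by auto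
    define F where "F = {g. \<exists>T\<in>{0..real L}. \<exists>y y'. E T y g y'}"
    have "finite F" unfolding F_def by (rule finite_E)
    define B where "B = 1 + (\<Sum>g\<in>F. norm (\<rho> t g))"
    have B: "norm (\<rho> t g) \<le> B" if "g \<in> F" for g
      unfolding B_def using \<open>finite F\<close> that by (intro add_increasing member_le_sum) auto
    have B1: "1 \<le> B" by (simp add: B_def sum_nonneg)
    \<comment> \<open>\<open>B\<close> pays for the piece of length at most \<open>L\<close> between
      the last sample and the end of the orbit segment.\<close>
    define R' where "R' = (k * b + b + 1) * (B * R)"
    have l: "0 < \<bar>t\<bar> / 2" "\<bar>t\<bar> / 2 < 1" "0 < 1 / (b + 3)" using t0 t1 pos by auto
    obtain N :: nat where N: "\<forall>p q m. (\<forall>j\<le>m. 1 / (b + 3) \<le> max (p j) (q j)) \<longrightarrow>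
      (\<forall>j<m. p (Suc j) \<le> (1 - \<bar>t\<bar> / 2) * max (p j) (q j)) \<longrightarrow>
      (\<forall>j<m. p j \<le> q j \<longrightarrow> (1 + \<bar>t\<bar> / 2) * q j \<le> q (Suc j)) \<longrightarrow>
      max (p 0) (q 0) \<le> R' \<longrightarrow> max (p m) (q m) \<le> R' \<longrightarrow> m \<le> N"
      by (rule cone_sequence_length[OF l, of R']) (rule that)
    have time: "T \<le> real ((N + 1) * L)"
      if e: "E T y g y'" and T0: "0 \<le> T" and v1: "nnform v v = -1" and vR: "norm v \<le> R" and wR: "norm (\<rho> t g *v v) \<le> R" for T y g y' v
    proof -
      have g: "g \<in> carrier \<Gamma>" and y: "y \<in> K" using E_carrier[OF e] by auto
      have R0: "0 \<le> R" using vR norm_ge_zero order_trans by blast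
      obtain \<nu> where n: "neutral_at y \<nu>" using neutral_ex[OF y] by blast
      define m where "m = nat \<lfloor>T / real L\<rfloor>"
      have m: "real (m * L) \<le> T" "T \<le> real ((m + 1) * L)"
      proof -
        have "real m = of_int \<lfloor>T / real L\<rfloor>" unfolding m_def using T0 by simp
        then have "real m \<le> T / real L" "T / real L \<le> real m + 1" by linarith+
        then show "real (m * L) \<le> T" "T \<le> real ((m + 1) * L)" using L(1) by (simp_all add: field_simps)
      qed
      have "\<exists>p. E (real (j * L)) y (fst p) (snd p) \<and> (j = 0 \<longrightarrow> p = (\<one>, y))" for j
        using E_ex[OF y, of "real (j * L)"] E_refl[OF y] by (cases "j = 0") auto
      then obtain p where p: "\<And>j. E (real (j * L)) y (fst (p j)) (snd (p j))" and p0: "p 0 = (\<one>, y)"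
        by metis
      define G Y where "G j = fst (p j)" and "Y j = snd (p j)" for j
      have GY: "E (real (j * L)) y (G j) (Y j)" for j using p by (simp add: G_def Y_def)
      have G0: "G 0 = \<one>" "Y 0 = y" using p0 by (simp_all add: G_def Y_def)
      have Gc: "G j \<in> carrier \<Gamma>" and Yc: "Y j \<in> K" for j using E_carrier[OF GY] by auto
      define h where "h j = inv (G j) \<otimes> G (Suc j)" for j
      have hc: "h j \<in> carrier \<Gamma>" for j using Gc by (simp add: h_def)
      have Eh: "E (real L) (Y j) (h j) (Y (Suc j))" for j
      proof -
        have "real (Suc j * L) - real (j * L) = real L" by (simp add: algebra_simps)
        then show ?thesis using E_div[OF GY[of j] GY[of "Suc j"]] unfolding h_def by (simp only:)
      qed
      define n' where "n' j = \<rho> 0 (inv (G j)) *v \<nu>" for j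
      have N': "neutral_at (Y j) (n' j)" for j unfolding n'_def using neutral_equiv[OF GY n] .
      have chain: "\<rho> r (inv (h j)) *v (\<rho> r (inv (G j)) *v x) = \<rho> r (inv (G (Suc j))) *v x" if "r \<in> {-1<..<1}" for r j x
      proof -
        have "inv (h j) \<otimes> inv (G j) = inv (G (Suc j))"
          using Gc by (simp add: h_def inv_mult_group m_assoc)
        then show ?thesis
          using rho_mult[OF that, of "inv (h j)" "inv (G j)"] Gc hc by (simp add: matrix_vector_mul_assoc)
      qed
      have n'Suc: "\<rho> 0 (inv (h j)) *v n' j = n' (Suc j)" for j
        using chain[of 0] by (simp add: n'_def)
      \<comment> \<open>Fixed by the first piece; \<open>drift_sign\<close> passes the value on to
        all later pieces, so one pair of sizes serves the whole segment.\<close>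
      define s where "s = sgn (t * nnform (u (h 0)) (n' 0))"
      have sj: "s = sgn (t * nnform (u (h j)) (n' j))" for j
      proof (induction j)
        case (Suc j)
        have "0 < nnform (u (h j)) (n' j) * nnform (u (h (Suc j))) (n' (Suc j))"
          using dsign[OF Eh[of j] Eh[of "Suc j"] N'[of j]] by (simp add: n'Suc)
        then have "sgn (nnform (u (h j)) (n' j)) = sgn (nnform (u (h (Suc j))) (n' (Suc j)))"
          by (auto simp: zero_less_mult_iff)
        then show ?case using Suc.IH by (simp add: sgn_mult)
      qed (simp add: s_def)
      have s1: "\<bar>s\<bar> = 1"
        using drift1[OF Eh[of 0] N'[of 0]] t0 unfolding s_def by (auto simp: sgn_if)
      define w where "w = \<rho> t g *v v"
      \<comment> \<open>The vector \<open>\<rho> t g *v v\<close> seen from the sample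
        \<open>Y j\<close>: the trajectory starts at this vector and would reach \<open>v\<close> at
        the end of the segment.\<close>
      define x where "x j = \<rho> t (inv (G j)) *v w" for j
      have xSuc: "x (Suc j) = \<rho> t (inv (h j)) *v x j" for j using chain[OF t1] by (simp add: x_def)
      \<comment> \<open>The form keeps the value -1, and its absolute value is at most the square of
        the norm.\<close>
      have x1: "1 \<le> norm (x j)" for j
      proof -
        have "nnform (x j) (x j) = -1"
          using Gc g v1 rho_form[OF t1] by (simp add: x_def w_def)
        then have "1 \<le> norm (x j) * norm (x j)" using abs_nnform_le[of "x j" "x j"] by simp
        then show ?thesis using mult_strict_mono'[of "norm (x j)" 1 "norm (x j)" 1] by fastforce
      qed
      define P Q where "P j = contr_size k s (Y j) (n' j) (x j)" and "Q j = expan_size k s (Y j) (n' j) (x j)" for j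
      have "m \<le> N"
      proof (rule N[rule_format, of m P Q])
        fix j
        have "1 \<le> (b + 3) * max (P j) (Q j)"
          using size_bounds(1)[OF Yc[of j] N'[of j] s1 k, of "x j"] x1[of j] by (simp add: P_def Q_def)
        then show "1 / (b + 3) \<le> max (P j) (Q j)" using pos by (simp add: divide_le_eq mult.commute)
        show "P (Suc j) \<le> (1 - \<bar>t\<bar> / 2) * max (P j) (Q j)"
          using step[rule_format, THEN conjunct1, OF t0 t\<epsilon> Eh[of j] N'[of j] sj[of j], of "x j"] by (simp add: P_def Q_def xSuc n'Suc)
        show "(1 + \<bar>t\<bar> / 2) * Q j \<le> Q (Suc j)" if "P j \<le> Q j"
          using step[rule_format, THEN conjunct2, rule_format, OF t0 t\<epsilon> Eh[of j] N'[of j] sj[of j], of "x j"] that by (simp add: P_def Q_def xSuc n'Suc)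
      next
        have kb: "0 \<le> k * b + b + 1" using k pos by simp
        have up: "max (P j) (Q j) \<le> R'" if "norm (x j) \<le> B * R" for j
        proof -
          have "max (P j) (Q j) \<le> (k * b + b + 1) * norm (x j)"
            unfolding P_def Q_def by (rule size_bounds[OF Yc N' s1 k])
          also have "\<dots> \<le> R'" unfolding R'_def using that kb by (intro mult_left_mono)
          finally show ?thesis .
        qed
        show "max (P 0) (Q 0) \<le> R'"
        proof (rule up)
          have "x 0 = w" using rho_one[OF t1] by (simp add: x_def G0)
          then show "norm (x 0) \<le> B * R" using wR mult_right_mono[OF B1 R0] by (simp add: w_def)
        qed
        show "max (P m) (Q m) \<le> R'"
        proof (rule up)
          define \<beta> where "\<beta> = inv (G m) \<otimes> g"
          have "E (T - real (m * L)) (Y m) \<beta> y'" using E_div[OF GY e] by (simp add: \<beta>_def)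
          moreover have "T - real (m * L) \<in> {0..real L}" using m by (simp add: algebra_simps)
          ultimately have "\<beta> \<in> F" unfolding F_def by (intro CollectI bexI exI)
          have "x m = \<rho> t \<beta> *v v"
            using rho_mult[OF t1, of "inv (G m)" g] Gc g by (simp add: x_def w_def \<beta>_def matrix_vector_mul_assoc)
          then have "norm (x m) \<le> norm (\<rho> t \<beta>) * norm v" using norm_matrix_vector_le by simp
          also have "\<dots> \<le> B * R" using B[OF \<open>\<beta> \<in> F\<close>] vR B1 by (intro mult_mono) auto
          finally show "norm (x m) \<le> B * R" .
        qed
      qed
      then have "real ((m + 1) * L) \<le> real ((N + 1) * L)" by (intro of_nat_mono mult_right_mono) auto
      then show ?thesis using m by linarith
    qed
    define H where "H = {g. \<exists>T\<in>{0..real ((N + 1) * L)}. \<exists>y y'. E T y g y'}"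
    have finH: "finite H" unfolding H_def by (rule finite_E)
    have HH: "g \<in> H \<union> m_inv \<Gamma> ` H" if g: "g \<in> carrier \<Gamma>" and v: "nnform v v = -1" "norm v \<le> R" "norm (\<rho> t g *v v) \<le> R"
      and e: "E T y g y'" for g v T y y'
    proof (cases "0 \<le> T")
      case True
      then have "T \<in> {0..real ((N + 1) * L)}" using time[OF e True v] by simp
      then have "g \<in> H" unfolding H_def using e by (intro CollectI bexI exI)
      then show ?thesis by simp
    next
      case False
      \<comment> \<open>A negative time for \<open>g\<close> is a positive time for
        \<open>inv g\<close>, with \<open>v\<close> and \<open>\<rho> t g *v v\<close> exchanging
        roles.\<close>
      have "- T \<le> real ((N + 1) * L)"
      proof (rule time[OF E_neg[OF e]])
        show "nnform (\<rho> t g *v v) (\<rho> t g *v v) = -1" using v g rho_form[OF t1] by simp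
        show "norm (\<rho> t (inv g) *v (\<rho> t g *v v)) \<le> R" using rho_inv(1)[OF t1 g] v by simp
      qed (use False v in auto)
      then have "- T \<in> {0..real ((N + 1) * L)}" using False by simp
      then have "inv g \<in> H" unfolding H_def using E_neg[OF e] by (intro CollectI bexI exI)
      then have "inv (inv g) \<in> m_inv \<Gamma> ` H" by (rule imageI)
      then show ?thesis using g by simp
    qed
    have "{g \<in> carrier \<Gamma>. \<exists>v. nnform v v = -1 \<and> norm v \<le> R \<and> norm (\<rho> t g *v v) \<le> R}
        \<subseteq> (H \<union> m_inv \<Gamma> ` H) \<union> {g \<in> carrier \<Gamma>. \<not> (\<exists>T y y'. E T y g y')}" (is "?A \<subseteq> _ \<union> ?B")
    proof
      fix g assume "g \<in> ?A"
      then obtain v where g: "g \<in> carrier \<Gamma>" and v: "nnform v v = -1" "norm v \<le> R" "norm (\<rho> t g *v v) \<le> R"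
        by blast
      show "g \<in> (H \<union> m_inv \<Gamma> ` H) \<union> ?B"
      proof (cases "\<exists>T y y'. E T y g y'")
        case True
        then obtain T y y' where "E T y g y'" by blast
        from HH[OF g v this] show ?thesis by (rule UnI1)
      next
        case False
        with g show ?thesis by simp
      qed
    qed
    then show "finite ?A"
      by (rule finite_subset) (intro finite_UnI finite_imageI finH E_all)
  qed
qed

end

section \<open>The groups and their Lie algebras\<close>

lemma Inn_Inn: "Inn ** Inn = (mat 1 :: ('n::finite) dmat)"
proof -
  have "(Inn ** Inn) *v v = (mat 1 :: 'n dmat) *v v" for v
    unfolding matrix_vector_mul_assoc[symmetric] matrix_vector_mul_lid
    by (simp add: vec_eq_iff Inn_def matrix_vector_mult_def if_distrib[of "\<lambda>x. x * _"]
        split: sum.split cong: if_cong)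
  then show ?thesis by (simp add: matrix_eq)
qed

text \<open>Invariance says that the transpose of \<open>g\<close> times \<open>Inn\<close> times
  \<open>g\<close> is \<open>Inn\<close>, and \<open>Inn\<close> is its own inverse. The inverse is
  thus a linear expression in \<open>g\<close>, from which continuity of inversion on the group will
  follow.\<close>

lemma form_preserving_left_inverse:
  fixes g :: "('n::finite) dmat"
  assumes "\<And>v w. nnform (g *v v) (g *v w) = nnform v w"
  shows "(Inn ** transpose g ** Inn) ** g = mat 1"
proof -
  have eq: "((Inn ** transpose g ** Inn) ** g) *v w = w" for w
  proof -
    have "v \<bullet> (transpose g *v (Inn *v (g *v w))) = v \<bullet> (Inn *v w)" for v
    proof -
      have "v \<bullet> (transpose g *v (Inn *v (g *v w))) = (g *v v) \<bullet> (Inn *v (g *v w))"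
        unfolding transpose_matrix_vector
        by (rule trans[OF inner_commute trans[OF dot_lmul_matrix inner_commute]])
      then show ?thesis using assms[of v w] by (simp add: nnform_def)
    qed
    then have "transpose g *v (Inn *v (g *v w)) = Inn *v w"
      by (metis vector_eq_ldot)
    then have "Inn *v (transpose g *v (Inn *v (g *v w))) = Inn *v (Inn *v w)" by simp
    then show ?thesis
      by (simp only: matrix_vector_mul_assoc matrix_mul_assoc Inn_Inn matrix_vector_mul_lid)
  qed
  show ?thesis using eq by (simp add: matrix_eq)
qed

lemma det_form_preserving:
  fixes g :: "('n::finite) dmat"
  assumes "\<And>v w. nnform (g *v v) (g *v w) = nnform v w"
  shows "det g * det g = 1"
proof -
  have "det ((Inn ** transpose g ** Inn) ** g) = det (Inn ** (Inn :: 'n dmat)) * (det g * det g)"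
    unfolding det_mul det_transpose by (simp only: mult_ac)
  then show ?thesis
    unfolding form_preserving_left_inverse[OF assms] Inn_Inn det_I mult_1 by (rule sym)
qed

lemma SOnn_form: "g \<in> SOnn \<Longrightarrow> nnform (g *v v) (g *v w) = nnform v w"
  by (simp add: SOnn_def)

lemma SOnn_inverse:
  assumes "g \<in> SOnn"
  shows "matrix_inv g = Inn ** transpose g ** Inn" "matrix_inv g ** g = mat 1" "g ** matrix_inv g = mat 1"
    "matrix_inv g \<in> SOnn"
proof -
  have 1: "(Inn ** transpose g ** Inn) ** g = mat 1"
    by (rule form_preserving_left_inverse) (simp add: SOnn_form assms)
  then show 2: "matrix_inv g = Inn ** transpose g ** Inn" by (rule matrix_inv_unique)
  show 3: "matrix_inv g ** g = mat 1" using 1 2 by simp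
  then show 4: "g ** matrix_inv g = mat 1" by (simp add: matrix_left_right_inverse)
  have "nnform (matrix_inv g *v v) (matrix_inv g *v w) = nnform v w" for v w
    using SOnn_form[OF assms, of "matrix_inv g *v v" "matrix_inv g *v w"] 4
    by (simp add: matrix_vector_mul_assoc)
  moreover have "det (matrix_inv g) = 1"
  proof -
    have "det (matrix_inv g ** g) = 1" unfolding 3 by simp
    then show ?thesis using assms by (simp add: det_mul SOnn_def)
  qed
  ultimately show "matrix_inv g \<in> SOnn" by (simp add: SOnn_def)
qed

lemma SOnn_mult: "g \<in> SOnn \<Longrightarrow> h \<in> SOnn \<Longrightarrow> g ** h \<in> SOnn"
  by (simp add: SOnn_def det_mul matrix_vector_mul_assoc[symmetric])

lemma mat1_SOnn: "mat 1 \<in> SOnn"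
  by (simp add: SOnn_def)

lemma carrier_GG: "carrier GG = connected_component_set SOnn (mat 1)"
  by (simp add: GG_def)

lemma GG_SOnn: "g \<in> carrier GG \<Longrightarrow> g \<in> SOnn"
  using connected_component_subset by (auto simp: carrier_GG)

lemma mat1_GG: "mat 1 \<in> carrier GG"
  by (simp add: carrier_GG mat1_SOnn)

text \<open>The components of \<open>x\<close> and of the identity coincide once \<open>x\<close>
  lies in \<open>GG\<close>. Products, inverses and unipotent elements are all placed in
  \<open>GG\<close> by this test.\<close>

lemma connected_GG_I:
  assumes "connected T" "T \<subseteq> SOnn" "x \<in> T" "x \<in> carrier GG" "y \<in> T"
  shows "y \<in> carrier GG"
proof -
  have "T \<subseteq> connected_component_set SOnn x"
    using assms by (intro connected_component_maximal) auto
  moreover have "connected_component_set SOnn x = connected_component_set SOnn (mat 1)"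
    using assms(4) by (intro connected_component_eq) (simp add: carrier_GG)
  ultimately show ?thesis using assms(5) by (auto simp: carrier_GG)
qed

lemma GG_mult: 
  assumes "g \<in> carrier GG" "h \<in> carrier GG" shows "g ** h \<in> carrier GG"
proof (rule connected_GG_I)
  show "connected ((\<lambda>x. g ** x) ` carrier GG)"
    unfolding carrier_GG by (intro connected_continuous_image continuous_intros) auto
  show "(\<lambda>x. g ** x) ` carrier GG \<subseteq> SOnn" using assms GG_SOnn SOnn_mult by blast
  show "g \<in> (\<lambda>x. g ** x) ` carrier GG" using mat1_GG by (intro image_eqI[of _ _ "mat 1"]) auto
qed (use assms in auto)

lemma continuous_on_transpose [continuous_intros]:
  fixes f :: "'a::topological_space \<Rightarrow> real ^ 'n::finite ^ 'm::finite"
  shows "continuous_on S f \<Longrightarrow> continuous_on S (\<lambda>x. transpose (f x))"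
  unfolding transpose_def by (intro continuous_intros)

text \<open>On the group, inversion agrees with the globally defined linear map \<open>I\<close>, so
  the image of \<open>GG\<close> is connected, and it contains the identity.\<close>

lemma GG_inverse:
  fixes g :: "('n::finite) dmat"
  assumes "g \<in> carrier GG" shows "matrix_inv g \<in> carrier GG"
proof -
  define I :: "'n dmat \<Rightarrow> 'n dmat" where "I x = Inn ** transpose x ** Inn" for x
  have I: "I x = matrix_inv x" if "x \<in> carrier GG" for x
    using SOnn_inverse(1)[OF GG_SOnn[OF that]] by (simp add: I_def)
  show ?thesis
  proof (rule connected_GG_I)
    show "connected (I ` carrier GG)"
      unfolding carrier_GG I_def[abs_def] by (intro connected_continuous_image continuous_intros) auto
    show "I ` carrier GG \<subseteq> SOnn"
      using SOnn_inverse(4)[OF GG_SOnn] I by (intro image_subsetI) simp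
    show "mat 1 \<in> I ` carrier GG"
      by (rule image_eqI[OF _ mat1_GG]) (simp add: I_def Inn_Inn)
    show "matrix_inv g \<in> I ` carrier GG"
      by (rule image_eqI[OF _ assms]) (simp add: I[OF assms])
  qed (rule mat1_GG)
qed

lemma G0_simps [simp]: "mult G0 = (**)" "one G0 = mat 1"
  by (simp_all add: G0_def)

lemma GG_simps [simp]: "mult GG = (**)" "one GG = mat 1"
  by (simp_all add: GG_def)

lemma G0_iff: "g \<in> carrier G0 \<longleftrightarrow> g \<in> carrier GG \<and> g *v e2n = e2n"
  by (simp add: G0_def)

lemma G0_SOnn: "g \<in> carrier G0 \<Longrightarrow> g \<in> SOnn"
  by (simp add: G0_iff GG_SOnn)

lemma G0_inv [simp]:
  assumes "g \<in> carrier G0"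
  shows "matrix_inv g ** g = mat 1" "g ** matrix_inv g = mat 1"
    "matrix_inv g *v (g *v v) = v" "g *v (matrix_inv g *v v) = v"
  using SOnn_inverse[OF G0_SOnn[OF assms]] by (simp_all add: matrix_vector_mul_assoc)

lemma G0_inverse: "g \<in> carrier G0 \<Longrightarrow> matrix_inv g \<in> carrier G0"
  using G0_inv(3)[of g e2n] by (simp add: G0_iff GG_inverse)

lemma G0_mult: "g \<in> carrier G0 \<Longrightarrow> h \<in> carrier G0 \<Longrightarrow> g ** h \<in> carrier G0"
  by (simp add: G0_iff GG_mult matrix_vector_mul_assoc[symmetric])

lemma mat1_G0: "mat 1 \<in> carrier G0"
  by (simp add: G0_iff mat1_GG)

lemma G0_e2n: "g \<in> carrier G0 \<Longrightarrow> g *v e2n = e2n"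
  by (simp add: G0_iff)

lemma group_G0: "group (G0 :: ('n::{finite,linorder}) dmat monoid)"
proof (rule groupI)
  show "\<exists>y\<in>carrier G0. y \<otimes>\<^bsub>G0\<^esub> x = \<one>\<^bsub>G0\<^esub>" if "x \<in> carrier G0" for x :: "'n dmat"
    using that G0_inverse[OF that] by (intro bexI[of _ "matrix_inv x"]) simp_all
qed (simp_all add: G0_mult mat1_G0 matrix_mul_assoc)

lemma inv_G0: "g \<in> carrier G0 \<Longrightarrow> inv\<^bsub>G0\<^esub> g = matrix_inv g"
  using group.inv_equality[OF group_G0, of "matrix_inv g" g] by (simp add: G0_inverse)

lemma subgroup_stab0: "subgroup (stab0 V) (G0 :: ('n::{finite,linorder}) dmat monoid)"
proof (rule group.subgroupI[OF group_G0])
  show "stab0 V \<subseteq> carrier G0" by (auto simp: stab0_def)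
  show "stab0 V \<noteq> {}" using mat1_G0 by (auto simp: stab0_def intro!: exI[of _ "mat 1"])
  show "inv\<^bsub>G0\<^esub> a \<in> stab0 V" if "a \<in> stab0 V" for a
  proof -
    have a: "a \<in> carrier G0" "(*v) a ` V = V" using that by (auto simp: stab0_def)
    have "(*v) (matrix_inv a) ` ((*v) a ` V) = V" using a(1) by (simp add: image_image)
    then show ?thesis using a by (simp add: stab0_def inv_G0 G0_inverse)
  qed
  show "a \<otimes>\<^bsub>G0\<^esub> b \<in> stab0 V" if "a \<in> stab0 V" "b \<in> stab0 V" for a b
  proof -
    have "(*v) (a ** b) ` V = (*v) a ` ((*v) b ` V)" by (simp add: image_image matrix_vector_mul_assoc)
    then show ?thesis using that by (simp add: stab0_def G0_mult)
  qed
qed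

lemma lcoset_G0_eq_iff:
  assumes "g \<in> carrier G0" "h \<in> carrier G0"
  shows "g <#\<^bsub>G0\<^esub> stab0 V = h <#\<^bsub>G0\<^esub> stab0 V \<longleftrightarrow> matrix_inv h ** g \<in> stab0 V"
proof
  assume "g <#\<^bsub>G0\<^esub> stab0 V = h <#\<^bsub>G0\<^esub> stab0 V"
  moreover have "g \<in> g <#\<^bsub>G0\<^esub> stab0 V"
    using group.lcos_self[OF group_G0 assms(1) subgroup_stab0] .
  ultimately obtain k where "k \<in> stab0 V" "g = h ** k" unfolding l_coset_def by auto
  then show "matrix_inv h ** g \<in> stab0 V" using assms by (simp add: matrix_mul_assoc)
next
  assume k: "matrix_inv h ** g \<in> stab0 V"
  have "g = h ** (matrix_inv h ** g)" using assms by (simp add: matrix_mul_assoc)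
  then have "g \<in> h <#\<^bsub>G0\<^esub> stab0 V" using k unfolding l_coset_def by auto
  then show "g <#\<^bsub>G0\<^esub> stab0 V = h <#\<^bsub>G0\<^esub> stab0 V"
    using group.l_repr_independence[OF group_G0 _ assms(2) subgroup_stab0] by metis
qed

lemma lcoset_G0_assoc:
  assumes "g \<in> carrier G0" "h \<in> carrier G0"
  shows "g <#\<^bsub>G0\<^esub> (h <#\<^bsub>G0\<^esub> stab0 V) = (g ** h) <#\<^bsub>G0\<^esub> stab0 V"
  using group.lcos_m_assoc[OF group_G0 subgroup.subset[OF subgroup_stab0] assms] by simp

section \<open>Bivectors and unipotent elements\<close>

text \<open>The element of the Lie algebra of the form given by the bivector of \<open>a\<close> and
  \<open>b\<close>; \<open>skew_apply\<close> shows its action.\<close>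

definition skew :: "('n::finite) dvec \<Rightarrow> 'n dvec \<Rightarrow> 'n dmat" where
  "skew a b = (\<chi> i j. b $ i * (Inn *v a) $ j - a $ i * (Inn *v b) $ j)"

lemma skew_apply: "skew a b *v v = nnform v a *\<^sub>R b - nnform v b *\<^sub>R a"
proof -
  have "(skew a b *v v) $ i = (nnform v a *\<^sub>R b - nnform v b *\<^sub>R a) $ i" for i
    unfolding nnform_def inner_vec_def skew_def matrix_vector_mult_def[of "\<chi> i j. _ i j"]
    by (simp add: algebra_simps sum_subtractf sum_distrib_left)
  then show ?thesis by (simp add: vec_eq_iff)
qed

text \<open>Turns the equivariance of the Anosov norms under conjugation into a statement about
  vectors.\<close>

lemma skew_conj:
  assumes "h \<in> carrier G0"
  shows "h ** skew a b ** matrix_inv h = skew (h *v a) (h *v b)"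
proof -
  have "(h ** skew a b ** matrix_inv h) *v v = skew (h *v a) (h *v b) *v v" for v
  proof -
    have "nnform (matrix_inv h *v v) x = nnform v (h *v x)" for x
      using nnform_G0[OF assms, of "matrix_inv h *v v" x] assms by simp
    then show ?thesis
      by (simp add: matrix_vector_mul_assoc[symmetric] skew_apply matrix_vector_mult_diff_distrib
          matrix_vector_mult_scaleR)
  qed
  then show ?thesis by (simp add: matrix_eq)
qed

lemma tendsto_skew [tendsto_intros]:
  assumes "(f \<longlongrightarrow> a) F" "(g \<longlongrightarrow> b) F"
  shows "((\<lambda>x. skew (f x) (g x)) \<longlongrightarrow> skew a b) F"
  unfolding skew_def
  by (intro tendsto_vec_lambda tendsto_intros tendsto_vec_nth assms)

lemma norm_skew_le: "\<exists>K>0. \<forall>a b :: ('n::finite) dvec. norm (skew a b) \<le> norm a * norm b * K"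
proof -
  have "bilinear (skew :: 'n dvec \<Rightarrow> _)"
    unfolding bilinear_def
    by (intro conjI allI linearI)
      (simp_all add: skew_def vec_eq_iff matrix_vector_right_distrib matrix_vector_mult_scaleR algebra_simps)
  then have "bounded_bilinear (skew :: 'n dvec \<Rightarrow> _)" by (simp add: bilinear_conv_bounded_bilinear)
  then show ?thesis by (rule bounded_bilinear.pos_bounded)
qed

text \<open>This is \<open>exp (t * skew a b)\<close> if \<open>a\<close> is null and orthogonal to \<open>b\<close>, as the cube of \<open>skew a b\<close> is
  then zero.\<close>

definition unip :: "('n::finite) dvec \<Rightarrow> 'n dvec \<Rightarrow> real \<Rightarrow> 'n dmat" where
  "unip a b t = mat 1 + t *\<^sub>R skew a b + (t\<^sup>2 / 2) *\<^sub>R (skew a b ** skew a b)"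

lemma unip_0 [simp]: "unip a b 0 = mat 1"
  by (simp add: unip_def)

lemma unip_deriv: "(unip a b has_vector_derivative skew a b) (at 0)"
proof -
  have "((\<lambda>t. mat 1 + t *\<^sub>R skew a b + (t\<^sup>2 / 2) *\<^sub>R (skew a b ** skew a b)) has_vector_derivative
      0 + 1 *\<^sub>R skew a b + 0 *\<^sub>R (skew a b ** skew a b)) (at 0)"
    by (auto intro!: derivative_eq_intros has_vector_derivative_scaleR
        simp: has_real_derivative_iff_has_vector_derivative[symmetric])
  then show ?thesis by (simp add: unip_def[abs_def])
qed

context
  fixes a b :: "('n::{finite,linorder}) dvec"
  assumes ab: "nnform a a = 0" "nnform a b = 0" "nnform b b = 1" "nnform a e2n = 0" "nnform b e2n = 0"
begin

lemma unip_apply: "unip a b t *v v = v + t *\<^sub>R (nnform v a *\<^sub>R b - nnform v b *\<^sub>R a) - (t\<^sup>2 / 2 * nnform v a) *\<^sub>R a"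
proof -
  have ba: "nnform b a = 0" using ab nnform_sym by metis
  have "skew a b *v (skew a b *v v) = - (nnform v a *\<^sub>R a)"
    by (simp add: skew_apply nnform_simps ab ba)
  then show ?thesis
    by (simp add: unip_def matrix_vector_mult_add_rdistrib scaleR_matrix_vector_assoc[symmetric]
        matrix_vector_mul_assoc[symmetric] skew_apply)
qed

lemma unip_add: "unip a b s ** unip a b t = unip a b (s + t)"
proof -
  have ba: "nnform b a = 0" using ab nnform_sym by metis
  have "(unip a b s ** unip a b t) *v v = unip a b (s + t) *v v" for v
    by (simp add: matrix_vector_mul_assoc[symmetric] unip_apply nnform_simps ab ba)
      (simp add: algebra_simps power2_eq_square add_divide_distrib)
  then show ?thesis by (simp add: matrix_eq)
qed

lemma unip_form: "nnform (unip a b t *v v) (unip a b t *v w) = nnform v w"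
proof -
  have "nnform b a = 0" "nnform a w = nnform w a" "nnform b w = nnform w b"
    using ab nnform_sym by metis+
  then show ?thesis
    by (simp add: unip_apply nnform_simps ab) (simp add: algebra_simps power2_eq_square)
qed

text \<open>A form preserving matrix has determinant 1 or -1; this one is the square of the matrix
  at \<open>t / 2\<close>, so its determinant is 1.\<close>

lemma unip_SOnn: "unip a b t \<in> SOnn"
proof -
  have "det (unip a b t) = det (unip a b (t / 2) ** unip a b (t / 2))" by (simp add: unip_add)
  also have "\<dots> = 1" using det_form_preserving[of "unip a b (t / 2)"] by (simp add: det_mul unip_form)
  finally show ?thesis by (simp add: SOnn_def unip_form)
qed

lemma unip_G0: "unip a b t \<in> carrier G0"
proof -
  have "unip a b t \<in> carrier GG"
  proof (rule connected_GG_I)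
    show "connected (range (unip a b))"
      unfolding unip_def[abs_def] by (intro connected_continuous_image continuous_intros connected_UNIV) auto
    show "range (unip a b) \<subseteq> SOnn" using unip_SOnn by blast
    show "mat 1 \<in> range (unip a b)" by (rule range_eqI[of _ _ 0]) simp
  qed (auto simp: mat1_GG)
  moreover have "unip a b t *v e2n = e2n"
    using ab by (simp add: unip_apply nnform_sym[of e2n])
  ultimately show ?thesis by (simp add: G0_iff)
qed

end

text \<open>Scaling reparametrizes the curve; a sum is the velocity of the product of two curves
  through the identity.\<close>

lemma subspace_lie_algebra:
  fixes H :: "(real ^ 'k::finite ^ 'k) set"
  assumes one: "mat 1 \<in> H" and mult: "\<And>g h. g \<in> H \<Longrightarrow> h \<in> H \<Longrightarrow> g ** h \<in> H"
  shows "subspace (lie_algebra H)"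
proof (rule subspaceI)
  show "0 \<in> lie_algebra H" unfolding lie_algebra_def
    using one by (auto intro!: exI[of _ "\<lambda>_. mat 1"])
  fix X Y r assume "X \<in> lie_algebra H"
  then obtain c where c: "\<And>t. c t \<in> H" "c 0 = mat 1" "(c has_vector_derivative X) (at 0)"
    unfolding lie_algebra_def by blast
  show "r *\<^sub>R X \<in> lie_algebra H"
  proof -
    have "((\<lambda>t. c (r * t)) has_vector_derivative r *\<^sub>R X) (at 0)"
      using vector_diff_chain_at[of "\<lambda>t. r * t" r 0 c X] c(3)
      by (auto simp: o_def intro!: derivative_eq_intros
          simp: has_real_derivative_iff_has_vector_derivative[symmetric])
    then show ?thesis unfolding lie_algebra_def using c by (auto intro!: exI[of _ "\<lambda>t. c (r * t)"])
  qed
  assume "Y \<in> lie_algebra H"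
  then obtain d where d: "\<And>t. d t \<in> H" "d 0 = mat 1" "(d has_vector_derivative Y) (at 0)"
    unfolding lie_algebra_def by blast
  have "((\<lambda>t. c t ** d t) has_vector_derivative X + Y) (at 0)"
    using has_vector_derivative_matrix_mult[OF c(3) d(3)] c(2) d(2) by (simp add: add.commute)
  then show "X + Y \<in> lie_algebra H"
    unfolding lie_algebra_def using c d mult by (auto intro!: exI[of _ "\<lambda>t. c t ** d t"])
qed

section \<open>Projections of the standard splitting\<close>

definition en :: "('n::{finite,linorder}) dvec" where
  "en = axis (Inl (Max UNIV)) 1"

text \<open>The projection onto \<open>Wsub \<sigma>\<close> along the orthogonal complement of \<open>Wsub (- \<sigma>)\<close>.\<close>

definition pr :: "real \<Rightarrow> ('n::{finite,linorder}) dmat" where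
  "pr \<sigma> = matrix (\<lambda>v. \<chi> i. case i of
     Inl j \<Rightarrow> if j = Max UNIV then 0 else (v $ Inl j + \<sigma> * v $ Inr j) / 2
   | Inr j \<Rightarrow> if j = Max UNIV then 0 else \<sigma> * (v $ Inl j + \<sigma> * v $ Inr j) / 2)"

lemma pr_apply:
  "(pr \<sigma> *v v) $ Inl j = (if j = Max UNIV then 0 else (v $ Inl j + \<sigma> * v $ Inr j) / 2)"
  "(pr \<sigma> *v v) $ Inr j = (if j = Max UNIV then 0 else \<sigma> * (v $ Inl j + \<sigma> * v $ Inr j) / 2)"
proof -
  have "linear (\<lambda>v :: 'a dvec. \<chi> i. case i of
     Inl j \<Rightarrow> if j = Max UNIV then 0 else (v $ Inl j + \<sigma> * v $ Inr j) / 2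
   | Inr j \<Rightarrow> if j = Max UNIV then 0 else \<sigma> * (v $ Inl j + \<sigma> * v $ Inr j) / 2)"
    by (rule linearI) (simp_all add: vec_eq_iff field_simps split: sum.split)
  then show "(pr \<sigma> *v v) $ Inl j = (if j = Max UNIV then 0 else (v $ Inl j + \<sigma> * v $ Inr j) / 2)"
    "(pr \<sigma> *v v) $ Inr j = (if j = Max UNIV then 0 else \<sigma> * (v $ Inl j + \<sigma> * v $ Inr j) / 2)"
    unfolding pr_def by (simp_all add: matrix_works linear_linear)
qed

context
  fixes \<sigma> :: real assumes \<sigma>: "\<sigma> * \<sigma> = 1"
begin

lemma sigma_cancel: "\<sigma> * (\<sigma> * a) = a"
  using \<sigma> by (simp add: mult.assoc[symmetric])

lemma pr_in_Wsub: "pr \<sigma> *v v \<in> Wsub \<sigma>"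
  by (simp add: Wsub_eq pr_apply)

lemma pr_Wsub: "w \<in> Wsub \<sigma> \<Longrightarrow> pr \<sigma> *v w = w"
proof -
  assume "w \<in> Wsub \<sigma>"
  then have w: "w $ Inl (Max UNIV) = 0" "\<And>j. w $ Inr j = \<sigma> * w $ Inl j" by (simp_all add: Wsub_eq)
  have "(pr \<sigma> *v w) $ i = w $ i" for i
    using w by (cases i) (auto simp: pr_apply sigma_cancel)
  then show ?thesis by (simp add: vec_eq_iff)
qed

lemma pr_pr: "pr \<sigma> *v (pr \<sigma> *v v) = pr \<sigma> *v v"
  by (rule pr_Wsub[OF pr_in_Wsub])

lemma pr_pr_opp: "pr \<sigma> *v (pr (- \<sigma>) *v v) = 0"
proof -
  have "(pr \<sigma> *v (pr (- \<sigma>) *v v)) $ i = 0" for i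
    by (cases i) (simp_all add: pr_apply sigma_cancel algebra_simps add_divide_distrib diff_divide_distrib)
  then show ?thesis by (simp add: vec_eq_iff)
qed

text \<open>\<open>Wsub \<sigma>\<close> and \<open>Wsub (- \<sigma>)\<close> are isotropic and dual
  to each other under the form, so taking adjoints exchanges the two projections.\<close>

lemma pr_adjoint: "nnform (pr \<sigma> *v v) w = nnform v (pr (- \<sigma>) *v w)"
proof -
  have "(pr \<sigma> *v v) $ Inl j * w $ Inl j - (pr \<sigma> *v v) $ Inr j * w $ Inr j
      = v $ Inl j * (pr (- \<sigma>) *v w) $ Inl j - v $ Inr j * (pr (- \<sigma>) *v w) $ Inr j" for j
    by (simp add: pr_apply algebra_simps add_divide_distrib diff_divide_distrib sigma_cancel)
  then show ?thesis by (simp add: nnform_eq sum_subtractf[symmetric])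
qed

lemma pr_e2n: "pr \<sigma> *v (e2n :: ('n::{finite,linorder}) dvec) = 0"
proof -
  have "(pr \<sigma> *v (e2n :: 'n dvec)) $ i = 0" for i
    by (cases i) (simp_all add: pr_apply e2n_def axis_def)
  then show ?thesis by (simp add: vec_eq_iff)
qed

end

text \<open>Describes the kernel through the form, which shows that an isometry preserving
  \<open>Wsub (- \<sigma>)\<close> preserves it.\<close>

lemma pr_zero_iff:
  assumes "\<sigma> * \<sigma> = 1"
  shows "pr \<sigma> *v v = 0 \<longleftrightarrow> (\<forall>w\<in>Wsub (- \<sigma>). nnform v w = 0)"
proof
  assume 0: "pr \<sigma> *v v = 0"
  show "\<forall>w\<in>Wsub (- \<sigma>). nnform v w = 0"
  proof
    fix w :: "'a dvec" assume "w \<in> Wsub (- \<sigma>)"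
    then have "nnform v w = nnform v (pr (- \<sigma>) *v w)" using assms by (subst pr_Wsub) auto
    also have "\<dots> = nnform (pr \<sigma> *v v) w" using pr_adjoint[OF assms, of v w] by simp
    finally show "nnform v w = 0" using 0 by simp
  qed
next
  assume 0: "\<forall>w\<in>Wsub (- \<sigma>). nnform v w = 0"
  show "pr \<sigma> *v v = 0"
  proof (rule nnform_nondeg)
    show "nnform (pr \<sigma> *v v) w = 0" for w
      using 0 pr_in_Wsub[of "- \<sigma>" w] assms by (simp add: pr_adjoint[OF assms])
  qed
qed

lemma neutral_pr: "neutral (pr 1) (pr (-1)) (en :: ('n::{finite,linorder}) dvec)"
proof -
  have en: "nnform v en = v $ Inl (Max UNIV)" for v :: "'n dvec"
    unfolding nnform_eq en_def by (simp add: axis_def if_distrib[of "\<lambda>z. _ * z"] cong: if_cong)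
  have c: "(en :: 'n dvec) $ Inl j = (if j = Max UNIV then 1 else 0)" "(en :: 'n dvec) $ Inr j = 0"
    "(e2n :: 'n dvec) $ Inr j = (if j = Max UNIV then 1 else 0)" "(e2n :: 'n dvec) $ Inl j = 0" for j
    by (simp_all add: en_def e2n_def axis_def)
  have "(pr 1 *v v + pr (-1) *v v + nnform v en *\<^sub>R en - nnform v e2n *\<^sub>R e2n) $ i = v $ i" for v :: "'n dvec" and i
    by (cases i) (simp_all add: pr_apply en nnform_e2n_right c field_simps)
  then have "pr 1 *v v + pr (-1) *v v + nnform v en *\<^sub>R en - nnform v e2n *\<^sub>R e2n = v" for v :: "'n dvec"
    unfolding vec_eq_iff by blast
  then show ?thesis
    unfolding neutral_def by (intro conjI allI) (simp_all only: en nnform_e2n_right c refl minus_zero if_True)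
qed

text \<open>\<open>Y\<close> acts as \<open>a\<close> on the image of \<open>pr \<sigma>\<close> and
  as \<open>b\<close> on its kernel. The image is \<open>Wsub \<sigma>\<close>, preserved by
  \<open>a\<close>; the kernel is the orthogonal of \<open>Wsub (- \<sigma>)\<close>, preserved by
  the isometry \<open>b\<close>.\<close>

lemma pr_commute:
  fixes a b :: "('n::{finite,linorder}) dmat"
  assumes \<sigma>: "\<sigma> * \<sigma> = 1" and a: "a \<in> stab0 (Wsub \<sigma>)" and b: "b \<in> stab0 (Wsub (- \<sigma>))"
  defines "Y \<equiv> a ** pr \<sigma> + b ** (mat 1 - pr \<sigma>)"
  shows "pr \<sigma> ** Y = Y ** pr \<sigma>"
proof -
  have Y: "Y *v v = a *v (pr \<sigma> *v v) + b *v (v - pr \<sigma> *v v)" for v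
    unfolding Y_def by (simp add: matrix_vector_mult_add_rdistrib matrix_vector_mul_assoc[symmetric]
      matrix_vector_mult_diff_rdistrib)
  have "pr \<sigma> *v (a *v (pr \<sigma> *v v)) = a *v (pr \<sigma> *v v)" for v
  proof (rule pr_Wsub[OF \<sigma>])
    have "a *v (pr \<sigma> *v v) \<in> (*v) a ` Wsub \<sigma>" by (rule imageI[OF pr_in_Wsub[OF \<sigma>]])
    then show "a *v (pr \<sigma> *v v) \<in> Wsub \<sigma>" using a by (simp add: stab0_def)
  qed
  moreover have "pr \<sigma> *v (b *v (v - pr \<sigma> *v v)) = 0" for v
  proof -
    have "pr \<sigma> *v (v - pr \<sigma> *v v) = 0" by (simp add: matrix_vector_mult_diff_distrib pr_pr[OF \<sigma>])
    then have 0: "nnform (v - pr \<sigma> *v v) w = 0" if "w \<in> Wsub (- \<sigma>)" for w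
      using that unfolding pr_zero_iff[OF \<sigma>] by blast
    have "nnform (b *v (v - pr \<sigma> *v v)) w = 0" if wW: "w \<in> Wsub (- \<sigma>)" for w
    proof -
      obtain w' where w': "w' \<in> Wsub (- \<sigma>)" "w = b *v w'"
      proof -
        have "w \<in> (*v) b ` Wsub (- \<sigma>)" using b wW by (simp add: stab0_def)
        then show ?thesis by (elim imageE) (rule that)
      qed
      have "b \<in> carrier G0" using b by (simp add: stab0_def)
      then show ?thesis using 0[OF w'(1)] by (simp add: w'(2) nnform_G0)
    qed
    then show ?thesis unfolding pr_zero_iff[OF \<sigma>] by blast
  qed
  ultimately have "pr \<sigma> *v (Y *v v) = a *v (pr \<sigma> *v v)" for v
    unfolding Y by (simp add: matrix_vector_right_distrib)
  moreover have "Y *v (pr \<sigma> *v v) = a *v (pr \<sigma> *v v)" for v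
    unfolding Y by (simp add: pr_pr[OF \<sigma>])
  ultimately have "(pr \<sigma> ** Y) *v v = (Y ** pr \<sigma>) *v v" for v
    unfolding matrix_vector_mul_assoc[symmetric] by simp
  then show ?thesis by (simp add: matrix_eq)
qed

text \<open>\<open>Q\<close> is known only through \<open>Q ** Z = Z ** pr \<sigma>\<close> with
  \<open>Z\<close> close to \<open>h\<close>. Rather than inverting \<open>Z\<close>, the proof
  writes \<open>Z = h + E\<close> and solves for \<open>D = Q - Q0\<close>: the unknown
  \<open>D\<close> reappears multiplied by the small \<open>E\<close>, and this term is absorbed on
  the left.\<close>

lemma projection_continuity:
  fixes h :: "('n::{finite,linorder}) dmat"
  assumes h: "h \<in> carrier G0" and e: "0 < \<epsilon>"
  obtains \<delta> where "0 < \<delta>" "\<forall>g g' Q. norm (g - h) < \<delta> \<longrightarrow> norm (g' - h) < \<delta> \<longrightarrow>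
     Q ** (g ** pr \<sigma> + g' ** (mat 1 - pr \<sigma>)) = (g ** pr \<sigma> + g' ** (mat 1 - pr \<sigma>)) ** pr \<sigma> \<longrightarrow>
     norm (Q - h ** pr \<sigma> ** matrix_inv h) < \<epsilon>"
proof -
  obtain K where K: "0 < K" "\<And>(A :: 'n dmat) (B :: 'n dmat). norm (A ** B) \<le> norm A * norm B * K"
    using bounded_bilinear.pos_bounded[OF bounded_bilinear_matrix_mult] by blast
  define P :: "'n dmat" where "P = pr \<sigma>"
  define Q0 where "Q0 = h ** P ** matrix_inv h"
  define H where "H = norm (matrix_inv h)"
  define c1 where "c1 = (norm P * K + norm (mat 1 - P) * K)"
  define c2 where "c2 = (norm P * K + norm Q0 * K) * H * K"
  define c3 where "c3 = K * H * K"
  have nn: "0 \<le> c1" "0 \<le> c2" "0 \<le> c3" using K by (simp_all add: c1_def c2_def c3_def H_def)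
  \<comment> \<open>The first entry makes the coefficient of \<open>norm D\<close> on the right at
    most \<open>1 / 2\<close>, the second makes the other terms smaller than
    \<open>\<epsilon> / 2\<close>.\<close>
  define \<delta> where "\<delta> = min (1 / (2 * (c3 * c1 + 1))) (\<epsilon> / (2 * (c2 * c1 + 1)))"
  have d: "0 < \<delta>" using nn e by (simp add: \<delta>_def add_nonneg_pos)
  have d1: "c3 * (c1 * \<delta>) \<le> 1 / 2"
  proof -
    have "x * (1 / (2 * (x + 1))) \<le> 1 / 2" if "0 \<le> x" for x :: real
      using that by (simp add: divide_le_eq)
    moreover have "c3 * c1 * \<delta> \<le> c3 * c1 * (1 / (2 * (c3 * c1 + 1)))"
      using nn by (intro mult_left_mono) (auto simp: \<delta>_def)
    ultimately show ?thesis using nn by (smt (verit) mult.assoc mult_nonneg_nonneg)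
  qed
  have d2: "c2 * (c1 * \<delta>) < \<epsilon> / 2"
  proof -
    have "x * (\<epsilon> / (2 * (x + 1))) < \<epsilon> / 2" if "0 \<le> x" for x :: real
      using that e by (simp add: divide_less_eq algebra_simps)
    moreover have "c2 * c1 * \<delta> \<le> c2 * c1 * (\<epsilon> / (2 * (c2 * c1 + 1)))"
      using nn by (intro mult_left_mono) (auto simp: \<delta>_def)
    ultimately show ?thesis using nn by (smt (verit) mult.assoc mult_nonneg_nonneg)
  qed
  show thesis
  proof (rule that[OF d], intro allI impI)
    fix g g' Q :: "'n dmat"
    assume g: "norm (g - h) < \<delta>" and g': "norm (g' - h) < \<delta>"
      and Q: "Q ** (g ** pr \<sigma> + g' ** (mat 1 - pr \<sigma>)) = (g ** pr \<sigma> + g' ** (mat 1 - pr \<sigma>)) ** pr \<sigma>"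
    define E where "E = (g - h) ** P + (g' - h) ** (mat 1 - P)"
    define D where "D = Q - Q0"
    note mm = bounded_bilinear.add_left[OF bounded_bilinear_matrix_mult] bounded_bilinear.add_right[OF bounded_bilinear_matrix_mult]
      bounded_bilinear.diff_left[OF bounded_bilinear_matrix_mult] bounded_bilinear.diff_right[OF bounded_bilinear_matrix_mult]
    have Z: "g ** P + g' ** (mat 1 - P) = h + E" by (simp add: E_def mm)
    have "norm E \<le> norm (g - h) * norm P * K + norm (g' - h) * norm (mat 1 - P) * K"
      unfolding E_def by (rule order_trans[OF norm_triangle_ineq add_mono[OF K(2) K(2)]])
    also have "\<dots> \<le> \<delta> * norm P * K + \<delta> * norm (mat 1 - P) * K"
      using g g' K by (intro add_mono mult_right_mono) auto
    finally have E: "norm E \<le> c1 * \<delta>" by (simp add: c1_def algebra_simps)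
    have Q0h: "Q0 ** h = h ** P" using h by (simp add: Q0_def matrix_mul_assoc[symmetric])
    have "D ** h = (E ** P - Q0 ** E) - D ** E"
      using Q unfolding P_def[symmetric] Z by (simp add: D_def mm Q0h algebra_simps)
    then have "D ** h ** matrix_inv h = ((E ** P - Q0 ** E) - D ** E) ** matrix_inv h" by simp
    then have Deq: "D = (E ** P - Q0 ** E) ** matrix_inv h - (D ** E) ** matrix_inv h"
      using h by (simp add: matrix_mul_assoc[symmetric] mm)
    have "norm (E ** P - Q0 ** E) \<le> norm E * norm P * K + norm Q0 * norm E * K"
      by (rule order_trans[OF norm_triangle_ineq4 add_mono[OF K(2) K(2)]])
    then have "norm ((E ** P - Q0 ** E) ** matrix_inv h) \<le> (norm E * norm P * K + norm Q0 * norm E * K) * H * K"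
      unfolding H_def using K(1)
      by (intro order_trans[OF K(2)[of "E ** P - Q0 ** E"] mult_right_mono[OF mult_right_mono]]) simp_all
    also have "\<dots> = c2 * norm E" by (simp add: c2_def algebra_simps)
    also have "\<dots> \<le> c2 * (c1 * \<delta>)" using E nn by (intro mult_left_mono)
    finally have t1: "norm ((E ** P - Q0 ** E) ** matrix_inv h) < \<epsilon> / 2" using d2 by simp
    have "norm ((D ** E) ** matrix_inv h) \<le> (norm D * norm E * K) * H * K"
      unfolding H_def using K(1)
      by (intro order_trans[OF K(2)[of "D ** E"] mult_right_mono[OF mult_right_mono[OF K(2)]]]) simp_all
    also have "\<dots> = norm D * (c3 * norm E)" by (simp add: c3_def algebra_simps)
    also have "\<dots> \<le> norm D * (1 / 2)"
    proof (rule mult_left_mono)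
      have "c3 * norm E \<le> c3 * (c1 * \<delta>)" using E nn by (intro mult_left_mono)
      then show "c3 * norm E \<le> 1 / 2" using d1 by simp
    qed simp
    finally have t2: "norm ((D ** E) ** matrix_inv h) \<le> norm D / 2" by simp
    have "norm D \<le> norm ((E ** P - Q0 ** E) ** matrix_inv h) + norm ((D ** E) ** matrix_inv h)"
      by (subst Deq) (rule norm_triangle_ineq4)
    then have "norm D < \<epsilon>" using t1 t2 by linarith
    then show "norm (Q - h ** pr \<sigma> ** matrix_inv h) < \<epsilon>" by (simp add: D_def Q0_def P_def)
  qed
qed

text \<open>The preimage in \<open>G0\<close> is the union of the right translates, by elements of
  \<open>stab0 V\<close>, of a ball in \<open>G0\<close>; this is why the quotient map is
  open.\<close>

lemma openin_lcosets_near: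
  assumes h: "h \<in> carrier G0"
  shows "openin (coset_topology G0 (stab0 V)) {g <#\<^bsub>G0\<^esub> stab0 V | g. g \<in> carrier G0 \<and> norm (g - h) < \<delta>}" (is "openin _ ?U")
  unfolding openin_coset_topology
proof (intro conjI)
  show "?U \<subseteq> lcosets\<^bsub>G0\<^esub> (stab0 V)" by (auto simp: LCOSETS_def)
  have "{g \<in> carrier G0. g <#\<^bsub>G0\<^esub> stab0 V \<in> ?U}
      = (\<Union>k\<in>stab0 V. {g \<in> carrier G0. norm (g ** matrix_inv k - h) < \<delta>})" (is "?A = ?B")
  proof
    show "?A \<subseteq> ?B"
    proof
      fix x assume "x \<in> ?A"
      then obtain g where x: "x \<in> carrier G0" and g: "g \<in> carrier G0" "norm (g - h) < \<delta>"
        and eq: "x <#\<^bsub>G0\<^esub> stab0 V = g <#\<^bsub>G0\<^esub> stab0 V" by auto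
      define k where "k = matrix_inv g ** x"
      have k: "k \<in> stab0 V" using eq lcoset_G0_eq_iff[OF x g(1)] by (simp add: k_def)
      then have kc: "k \<in> carrier G0" by (simp add: stab0_def)
      have "x = g ** k" using g by (simp add: k_def matrix_mul_assoc)
      then have "x ** matrix_inv k = g" using kc by (simp add: matrix_mul_assoc[symmetric])
      then show "x \<in> ?B" using k x g by auto
    qed
    show "?B \<subseteq> ?A"
    proof
      fix x assume "x \<in> ?B"
      then obtain k where k: "k \<in> stab0 V" and x: "x \<in> carrier G0" "norm (x ** matrix_inv k - h) < \<delta>" by auto
      have kc: "k \<in> carrier G0" using k by (simp add: stab0_def)
      define g where "g = x ** matrix_inv k"
      have g: "g \<in> carrier G0" using x kc by (simp add: g_def G0_mult G0_inverse)
      have "x = g ** k" using kc by (simp add: g_def matrix_mul_assoc[symmetric])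
      then have "matrix_inv g ** x = k" using g by (simp add: matrix_mul_assoc)
      then have "x <#\<^bsub>G0\<^esub> stab0 V = g <#\<^bsub>G0\<^esub> stab0 V" using lcoset_G0_eq_iff[OF x(1) g] k by simp
      then show "x \<in> ?A" using x g by (auto simp: g_def)
    qed
  qed
  moreover have "openin (top_of_set (carrier G0)) ?B"
  proof (intro openin_Union, clarify)
    fix k
    have "open {g :: 'a dmat. norm (g ** matrix_inv k - h) < \<delta>}"
      by (intro open_Collect_less continuous_intros)
    moreover have "{g \<in> carrier G0. norm (g ** matrix_inv k - h) < \<delta>} = carrier G0 \<inter> {g. norm (g ** matrix_inv k - h) < \<delta>}"
      by blast
    ultimately show "openin (top_of_set (carrier G0)) {g \<in> carrier G0. norm (g ** matrix_inv k - h) < \<delta>}"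
      by (simp add: openin_open_Int)
  qed
  ultimately show "openin (top_of_set (carrier G0)) ?A" by (simp only:)
qed

section \<open>The splitting defined by an Anosov representation\<close>

text \<open>Prepares Cauchy-Schwarz for a semidefinite form, so \<open>c\<close> may vanish; then
  the polynomial is affine in \<open>r\<close>, and its lower bound forces
  \<open>b = 0\<close>.\<close>

lemma nonneg_quadratic_discriminant:
  fixes a b c :: real
  assumes nonneg: "\<And>r. 0 \<le> a + 2 * r * b + r * r * c" and c: "0 \<le> c"
  shows "b * b \<le> a * c"
proof (cases "c = 0")
  case True
  have "b = 0"
  proof (rule ccontr)
    assume "b \<noteq> 0"
    \<comment> \<open>At this \<open>r\<close> the expression \<open>a + 2 * r * b\<close> is
      -1.\<close>
    then show False using nonneg[of "- (a + 1) / (2 * b)"] True by (simp add: field_simps)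
  qed
  then show ?thesis using True by simp
next
  case False
  then have "0 < c" using c by simp
  then have "0 \<le> (a + 2 * (- b / c) * b + (- b / c) * (- b / c) * c) * c"
    using nonneg[of "- b / c"] by (intro mult_nonneg_nonneg) auto
  also have "\<dots> = a * c - b * b" using \<open>0 < c\<close> by (simp add: field_simps)
  finally show ?thesis by simp
qed

text \<open>The seminorm laws on \<open>V\<close>; the triangle inequality is Cauchy-Schwarz for the
  form \<open>B\<close>, which is semidefinite there.\<close>

lemma euclidean_norm_mod:
  assumes N: "euclidean_norm_mod V W N" and V: "subspace V"
  shows euclidean_norm_mod_zero: "x \<in> V \<Longrightarrow> N x = 0 \<longleftrightarrow> x \<in> W"
    and euclidean_norm_mod_nonneg: "x \<in> V \<Longrightarrow> 0 \<le> N x"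
    and euclidean_norm_mod_scale: "x \<in> V \<Longrightarrow> N (r *\<^sub>R x) = \<bar>r\<bar> * N x"
    and euclidean_norm_mod_triangle: "x \<in> V \<Longrightarrow> y \<in> V \<Longrightarrow> N (x + y) \<le> N x + N y"
proof -
  obtain B where B: "bilinear B" "\<And>x y. B x y = B y x"
    "\<And>x. x \<in> V \<Longrightarrow> B x x \<ge> 0" "\<And>x. x \<in> V \<Longrightarrow> N x = sqrt (B x x)" "\<And>x. x \<in> V \<Longrightarrow> B x x = 0 \<longleftrightarrow> x \<in> W"
    using N unfolding euclidean_norm_mod_def by blast
  show "N x = 0 \<longleftrightarrow> x \<in> W" if "x \<in> V" using B(3-5)[OF that] by simp
  show "0 \<le> N x" if "x \<in> V" using B(3,4)[OF that] by simp
  show "N (r *\<^sub>R x) = \<bar>r\<bar> * N x" if x: "x \<in> V"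
  proof -
    have "B (r *\<^sub>R x) (r *\<^sub>R x) = r * r * B x x"
      using B(1) by (simp add: bilinear_lmul bilinear_rmul)
    then show ?thesis using B(4)[OF x] B(4)[OF subspace_scale[OF V x, of r]] by (simp add: real_sqrt_mult)
  qed
  show "N (x + y) \<le> N x + N y" if x: "x \<in> V" and y: "y \<in> V"
  proof -
    have exp: "B (x + r *\<^sub>R y) (x + r *\<^sub>R y) = B x x + 2 * r * B x y + r * r * B y y" for r
      using B(1) B(2)[of y x] by (simp add: bilinear_lmul bilinear_rmul bilinear_ladd bilinear_radd algebra_simps)
    have "B x y * B x y \<le> B x x * B y y"
    proof (rule nonneg_quadratic_discriminant)
      show "0 \<le> B x x + 2 * r * B x y + r * r * B y y" for r
        using B(3)[OF subspace_add[OF V x subspace_scale[OF V y]], of r] by (simp only: exp)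
    qed (rule B(3)[OF y])
    then have "sqrt (B x y * B x y) \<le> sqrt (B x x * B y y)" by (rule real_sqrt_le_mono)
    then have "B x y \<le> N x * N y" using B(4) x y by (simp add: real_sqrt_mult)
    moreover have "N x * N x = B x x" "N y * N y = B y y" using B(3,4) x y by simp_all
    ultimately have "B (x + y) (x + y) \<le> (N x + N y) * (N x + N y)"
      using exp[of 1] by (simp add: algebra_simps)
    then have "sqrt (B (x + y) (x + y)) \<le> sqrt ((N x + N y) * (N x + N y))" by (rule real_sqrt_le_mono)
    also have "\<dots> = N x + N y" using B(3,4) x y by simp
    finally show ?thesis using B(4)[OF subspace_add[OF V x y]] by simp
  qed
qed

section \<open>The flow space and its two end points\<close>

text \<open>The ends are indexed by a sign, 1 for \<open>p_+\<close> and -1 for \<open>p_-\<close>,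
  so that both boundary maps are handled by one argument.\<close>

definition end_pt :: "real \<Rightarrow> 'g flow_pt \<Rightarrow> (nat \<Rightarrow> 'g) set" where
  "end_pt \<sigma> x = (if \<sigma> = 1 then fst (fst x) else snd (fst x))"

lemma topspace_flow_topology:
  "x \<in> topspace (flow_topology \<Gamma> S) \<longleftrightarrow> fst x \<in> boundary_pairs \<Gamma> S"
  by (cases x, cases "fst x") (auto simp: flow_topology_def topspace_boundary_topology boundary_pairs_def)

lemma end_pt_flow [simp]: "end_pt \<sigma> (flow T x) = end_pt \<sigma> x"
  by (simp add: end_pt_def flow_def split: prod.split)

lemma fst_flow [simp]: "fst (flow T x) = fst x"
  by (simp add: flow_def split: prod.split)

lemma flow_topspace: "x \<in> topspace (flow_topology \<Gamma> S) \<Longrightarrow> flow T x \<in> topspace (flow_topology \<Gamma> S)"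
  by (simp add: topspace_flow_topology)

lemma end_pt_boundary: "x \<in> topspace (flow_topology \<Gamma> S) \<Longrightarrow> end_pt \<sigma> x \<in> boundary \<Gamma> S"
  by (auto simp: topspace_flow_topology boundary_pairs_def end_pt_def)

lemma continuous_map_end_pt:
  "continuous_map (flow_topology \<Gamma> S) (boundary_topology \<Gamma> S) (end_pt \<sigma>)"
proof -
  have "continuous_map (flow_topology \<Gamma> S)
      (subtopology (prod_topology (boundary_topology \<Gamma> S) (boundary_topology \<Gamma> S)) (boundary_pairs \<Gamma> S)) fst"
    unfolding flow_topology_def by (rule continuous_map_fst)
  then have 1: "continuous_map (flow_topology \<Gamma> S) (prod_topology (boundary_topology \<Gamma> S) (boundary_topology \<Gamma> S)) fst"
    by (rule continuous_map_into_fulltopology)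
  have "continuous_map (flow_topology \<Gamma> S) (boundary_topology \<Gamma> S) (fst \<circ> fst)"
    "continuous_map (flow_topology \<Gamma> S) (boundary_topology \<Gamma> S) (snd \<circ> fst)"
    by (rule continuous_map_compose[OF 1 continuous_map_fst], rule continuous_map_compose[OF 1 continuous_map_snd])
  then show ?thesis
    by (cases "\<sigma> = 1") (simp_all add: end_pt_def[abs_def] o_def)
qed

text \<open>The data of \<open>anosov\<close> with the signs unified. In \<open>N_contr\<close>, an
  element of the Lie algebra of the stabilizer of the \<sigma>-th coset has no component in the
  factor of sign \<sigma>, so it is tangent to the opposite factor; it decays forward for \<sigma> =
  1 and backward for \<sigma> = -1.\<close>

locale anosov_flow = group \<Gamma> for \<Gamma> :: "('g, 'm) monoid_scheme" (structure) +
  fixes S :: "'g set" and act :: "'g \<Rightarrow> 'g flow_pt \<Rightarrow> 'g flow_pt"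
    and \<rho> :: "'g \<Rightarrow> ('n::{finite,linorder}) dmat"
    and xi :: "real \<Rightarrow> (nat \<Rightarrow> 'g) set \<Rightarrow> 'n dmat set"
    and N :: "'g flow_pt \<Rightarrow> 'n dmat \<Rightarrow> real" and C c :: real
  assumes gflow: "gromov_flow \<Gamma> S act"
    and rho_hom: "\<rho> \<in> hom \<Gamma> G0"
    and xi_cont: "\<sigma> \<in> {1, -1} \<Longrightarrow>
      continuous_map (boundary_topology \<Gamma> S) (coset_topology G0 (stab0 (Wsub \<sigma>))) (xi \<sigma>)"
    and xi_equiv: "\<lbrakk>\<sigma> \<in> {1, -1}; g \<in> carrier \<Gamma>; p \<in> boundary \<Gamma> S\<rbrakk> \<Longrightarrow>
      xi \<sigma> (boundary_act \<Gamma> g p) = \<rho> g <#\<^bsub>G0\<^esub> xi \<sigma> p"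
    and xi_frame: "x \<in> topspace (flow_topology \<Gamma> S) \<Longrightarrow>
      \<exists>h\<in>carrier G0. \<forall>\<sigma>\<in>{1, -1}. xi \<sigma> (end_pt \<sigma> x) = h <#\<^bsub>G0\<^esub> stab0 (Wsub \<sigma>)"
    and N_norm: "x \<in> topspace (flow_topology \<Gamma> S) \<Longrightarrow>
      euclidean_norm_mod (lie_algebra (carrier G0))
        (lie_algebra (coset_stab G0 (xi 1 (end_pt 1 x)) \<inter> coset_stab G0 (xi (-1) (end_pt (-1) x)))) (N x)"
    and N_cont: "Y \<in> lie_algebra (carrier G0) \<Longrightarrow>
      continuous_map (flow_topology \<Gamma> S) euclideanreal (\<lambda>x. N x Y)"
    and N_equiv: "\<lbrakk>g \<in> carrier \<Gamma>; x \<in> topspace (flow_topology \<Gamma> S); Y \<in> lie_algebra (carrier G0)\<rbrakk> \<Longrightarrow>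
      N (act g x) (\<rho> g ** Y ** matrix_inv (\<rho> g)) = N x Y"
    and N_contr: "\<lbrakk>\<sigma> \<in> {1, -1}; x \<in> topspace (flow_topology \<Gamma> S);
      Y \<in> lie_algebra (coset_stab G0 (xi \<sigma> (end_pt \<sigma> x))); 0 \<le> t\<rbrakk> \<Longrightarrow>
      N (flow (\<sigma> * t) x) Y \<le> C * exp (- c * t) * N x Y"
    and pos: "0 < C" "0 < c"
begin

abbreviation X :: "'g flow_pt topology" where "X \<equiv> flow_topology \<Gamma> S"

section \<open>Frames and the continuity of the splitting\<close>

definition frame :: "'n dmat \<Rightarrow> 'g flow_pt \<Rightarrow> bool" where
  "frame h x \<longleftrightarrow> h \<in> carrier G0 \<and> (\<forall>\<sigma>\<in>{1, -1}. xi \<sigma> (end_pt \<sigma> x) = h <#\<^bsub>G0\<^esub> stab0 (Wsub \<sigma>))"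

lemma frame_xi: "frame h x \<Longrightarrow> \<sigma> \<in> {1, -1} \<Longrightarrow> xi \<sigma> (end_pt \<sigma> x) = h <#\<^bsub>G0\<^esub> stab0 (Wsub \<sigma>)"
  unfolding frame_def by blast

lemma frame_ex: "x \<in> topspace X \<Longrightarrow> \<exists>h. frame h x"
  unfolding frame_def using xi_frame by blast

text \<open>The standard projection moved by a frame; by \<open>Pi_frame\<close> the arbitrary
  choice of the frame has no effect.\<close>

definition Pi :: "real \<Rightarrow> 'g flow_pt \<Rightarrow> 'n dmat" where
  "Pi \<sigma> x = (SOME h. frame h x) ** pr \<sigma> ** matrix_inv (SOME h. frame h x)"

text \<open>The two cosets need not have a common representative that varies continuously. The matrix \<open>Z\<close> is
  built from separate continuous representatives and still carries \<open>pr \<sigma>\<close> to the projection at \<open>x\<close>,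
  which makes this projection independent of the frame and continuous.\<close>

lemma frame_intertwine:
  assumes h: "frame h x" and \<sigma>: "\<sigma> \<in> {1, -1}"
    and g: "g \<in> carrier G0" "xi \<sigma> (end_pt \<sigma> x) = g <#\<^bsub>G0\<^esub> stab0 (Wsub \<sigma>)"
    and g': "g' \<in> carrier G0" "xi (-\<sigma>) (end_pt (-\<sigma>) x) = g' <#\<^bsub>G0\<^esub> stab0 (Wsub (-\<sigma>))"
  defines "Z \<equiv> g ** pr \<sigma> + g' ** (mat 1 - pr \<sigma>)"
  shows "(h ** pr \<sigma> ** matrix_inv h) ** Z = Z ** pr \<sigma>"
proof -
  have hc: "h \<in> carrier G0" using h by (simp add: frame_def)
  have \<sigma>': "\<sigma> * \<sigma> = 1" "- \<sigma> \<in> {1, -1}" using \<sigma> by auto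
  define a where "a = matrix_inv h ** g"
  define b where "b = matrix_inv h ** g'"
  have a: "a \<in> stab0 (Wsub \<sigma>)"
    using lcoset_G0_eq_iff[OF g(1) hc, of "Wsub \<sigma>"] g(2) frame_xi[OF h \<sigma>] by (simp add: a_def)
  have b: "b \<in> stab0 (Wsub (- \<sigma>))"
    using lcoset_G0_eq_iff[OF g'(1) hc, of "Wsub (- \<sigma>)"] g'(2) frame_xi[OF h \<sigma>'(2)] by (simp add: b_def)
  have ga: "g = h ** a" "g' = h ** b" using hc by (simp_all add: a_def b_def matrix_mul_assoc)
  define Y where "Y = a ** pr \<sigma> + b ** (mat 1 - pr \<sigma>)"
  have Z: "Z = h ** Y"
    by (simp add: Z_def Y_def ga matrix_mul_assoc bounded_bilinear.add_right[OF bounded_bilinear_matrix_mult])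
  have Y: "pr \<sigma> ** Y = Y ** pr \<sigma>" unfolding Y_def by (rule pr_commute[OF \<sigma>'(1) a b])
  have "(h ** pr \<sigma> ** matrix_inv h) ** Z = h ** pr \<sigma> ** (matrix_inv h ** h) ** Y"
    unfolding Z by (simp only: matrix_mul_assoc)
  also have "\<dots> = h ** (pr \<sigma> ** Y)" using hc by (simp add: matrix_mul_assoc)
  also have "\<dots> = Z ** pr \<sigma>" unfolding Y Z by (simp only: matrix_mul_assoc)
  finally show ?thesis .
qed

text \<open>With both representatives equal to the chosen frame \<open>k\<close>, the intertwining
  matrix is \<open>k\<close> itself, so the two conjugates of \<open>pr \<sigma>\<close>
  agree.\<close>

lemma Pi_frame:
  assumes h: "frame h x" and \<sigma>: "\<sigma> \<in> {1, -1}"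
  shows "Pi \<sigma> x = h ** pr \<sigma> ** matrix_inv h"
proof -
  define k where "k = (SOME h. frame h x)"
  have k: "frame k x" unfolding k_def using h by (rule someI)
  have kc: "k \<in> carrier G0" using k by (simp add: frame_def)
  have "- \<sigma> \<in> {1, -1}" using \<sigma> by auto
  then have eq: "xi \<sigma> (end_pt \<sigma> x) = k <#\<^bsub>G0\<^esub> stab0 (Wsub \<sigma>)"
    "xi (-\<sigma>) (end_pt (-\<sigma>) x) = k <#\<^bsub>G0\<^esub> stab0 (Wsub (-\<sigma>))"
    using k \<sigma> unfolding frame_def by blast+
  have "(h ** pr \<sigma> ** matrix_inv h) ** (k ** pr \<sigma> + k ** (mat 1 - pr \<sigma>)) = (k ** pr \<sigma> + k ** (mat 1 - pr \<sigma>)) ** pr \<sigma>"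
    by (rule frame_intertwine[OF h \<sigma> kc eq(1) kc eq(2)])
  then have "(h ** pr \<sigma> ** matrix_inv h) ** k = k ** pr \<sigma>"
    by (simp add: bounded_bilinear.diff_right[OF bounded_bilinear_matrix_mult])
  then have "(h ** pr \<sigma> ** matrix_inv h) ** k ** matrix_inv k = k ** pr \<sigma> ** matrix_inv k" by simp
  moreover have "(h ** pr \<sigma> ** matrix_inv h) ** k ** matrix_inv k = h ** pr \<sigma> ** matrix_inv h"
    using kc by (simp add: matrix_mul_assoc[symmetric])
  ultimately show ?thesis by (simp add: Pi_def k_def)
qed

text \<open>Near \<open>x\<close> each boundary map has, separately, a representative close to the
  frame \<open>h\<close>. The intertwining matrix built from the two is then close to
  \<open>h\<close>, and \<open>projection_continuity\<close> transfers this to the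
  projections.\<close>

lemma continuous_map_Pi:
  assumes \<sigma>: "\<sigma> \<in> {1, -1}"
  shows "continuous_map X euclidean (Pi \<sigma>)"
proof -
  have \<sigma>': "- \<sigma> \<in> {1, -1}" using \<sigma> by auto
  have near: "\<exists>T. openin X T \<and> x \<in> T \<and> (\<forall>y\<in>T. norm (Pi \<sigma> y - Pi \<sigma> x) < e)" if x: "x \<in> topspace X" and e: "0 < e" for x e
  proof -
    obtain h where h: "frame h x" using frame_ex[OF x] by blast
    then have hc: "h \<in> carrier G0" by (simp add: frame_def)
    obtain \<delta> where d: "0 < \<delta>" and \<delta>: "\<forall>g g' Q. norm (g - h) < \<delta> \<longrightarrow> norm (g' - h) < \<delta> \<longrightarrow>
       Q ** (g ** pr \<sigma> + g' ** (mat 1 - pr \<sigma>)) = (g ** pr \<sigma> + g' ** (mat 1 - pr \<sigma>)) ** pr \<sigma> \<longrightarrow>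
       norm (Q - h ** pr \<sigma> ** matrix_inv h) < e"
      by (rule projection_continuity[OF hc e]) (rule that)
    define O' where "O' V = {g <#\<^bsub>G0\<^esub> stab0 V | g. g \<in> carrier G0 \<and> norm (g - h) < \<delta>}" for V :: "'n dvec set"
    define T where "T \<tau> = {y \<in> topspace X. (xi \<tau> \<circ> end_pt \<tau>) y \<in> O' (Wsub \<tau>)}" for \<tau>
    have T: "openin X (T \<tau>)" "x \<in> T \<tau>" if "\<tau> \<in> {1, -1}" for \<tau>
    proof -
      have "continuous_map X (coset_topology G0 (stab0 (Wsub \<tau>))) (xi \<tau> \<circ> end_pt \<tau>)"
        by (rule continuous_map_compose[OF continuous_map_end_pt xi_cont[OF that]])
      moreover have "openin (coset_topology G0 (stab0 (Wsub \<tau>))) (O' (Wsub \<tau>))"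
        unfolding O'_def by (rule openin_lcosets_near[OF hc])
      ultimately show "openin X (T \<tau>)" unfolding T_def by (rule openin_continuous_map_preimage)
      have "xi \<tau> (end_pt \<tau> x) = h <#\<^bsub>G0\<^esub> stab0 (Wsub \<tau>)" using h that unfolding frame_def by blast
      moreover have "norm (h - h) < \<delta>" using d by simp
      ultimately show "x \<in> T \<tau>" unfolding T_def O'_def using x hc by auto
    qed
    have "norm (Pi \<sigma> y - Pi \<sigma> x) < e" if "y \<in> T \<sigma> \<inter> T (- \<sigma>)" for y
    proof -
      obtain g where g: "g \<in> carrier G0" "norm (g - h) < \<delta>" "xi \<sigma> (end_pt \<sigma> y) = g <#\<^bsub>G0\<^esub> stab0 (Wsub \<sigma>)"
        using \<open>y \<in> T \<sigma> \<inter> T (- \<sigma>)\<close> by (auto simp: T_def O'_def)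
      obtain g' where g': "g' \<in> carrier G0" "norm (g' - h) < \<delta>" "xi (-\<sigma>) (end_pt (-\<sigma>) y) = g' <#\<^bsub>G0\<^esub> stab0 (Wsub (-\<sigma>))"
        using \<open>y \<in> T \<sigma> \<inter> T (- \<sigma>)\<close> by (auto simp: T_def O'_def)
      have y: "y \<in> topspace X" using that by (simp add: T_def)
      then obtain k where k: "frame k y" using frame_ex by blast
      show ?thesis
        unfolding Pi_frame[OF k \<sigma>] Pi_frame[OF h \<sigma>]
        using \<delta>[rule_format, OF g(2) g'(2)] frame_intertwine[OF k \<sigma> g(1,3) g'(1,3)] by blast
    qed
    then show ?thesis using T[OF \<sigma>] T[OF \<sigma>'] by (intro exI[of _ "T \<sigma> \<inter> T (- \<sigma>)"]) auto
  qed
  show ?thesis unfolding continuous_map_def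
  proof (intro conjI allI impI)
    fix U :: "'n dmat set" assume "openin euclidean U"
    then have U: "open U" by simp
    show "openin X {x \<in> topspace X. Pi \<sigma> x \<in> U}"
    proof (subst openin_subopen, rule ballI)
      fix x assume "x \<in> {x \<in> topspace X. Pi \<sigma> x \<in> U}"
      then have x: "x \<in> topspace X" "Pi \<sigma> x \<in> U" by auto
      obtain e where e: "0 < e" "\<And>Q. dist Q (Pi \<sigma> x) < e \<Longrightarrow> Q \<in> U" using U x(2) by (auto simp: open_dist)
      obtain T where T: "openin X T" "x \<in> T" "\<forall>y\<in>T. norm (Pi \<sigma> y - Pi \<sigma> x) < e" using near[OF x(1) e(1)] by blast
      have "T \<subseteq> {x \<in> topspace X. Pi \<sigma> x \<in> U}"
        using T openin_subset[OF T(1)] e(2) by (auto simp: dist_norm)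
      then show "\<exists>T. openin X T \<and> x \<in> T \<and> T \<subseteq> {x \<in> topspace X. Pi \<sigma> x \<in> U}" using T by blast
    qed
  qed simp
qed

section \<open>Vectors of the splitting as tangent vectors\<close>

context
  fixes x assumes x: "x \<in> topspace X"
begin

lemma Pi_apply:
  obtains h where "frame h x" "h \<in> carrier G0" "\<forall>\<sigma> v. \<sigma> \<in> {1, -1} \<longrightarrow> Pi \<sigma> x *v v = h *v (pr \<sigma> *v (matrix_inv h *v v))"
proof -
  obtain h where h: "frame h x" using frame_ex[OF x] by blast
  show thesis
  proof (rule that[OF h])
    show "h \<in> carrier G0" using h by (simp add: frame_def)
    show "\<forall>\<sigma> v. \<sigma> \<in> {1, -1} \<longrightarrow> Pi \<sigma> x *v v = h *v (pr \<sigma> *v (matrix_inv h *v v))"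
      using Pi_frame[OF h] by (simp add: matrix_vector_mul_assoc matrix_mul_assoc)
  qed
qed

lemma Pi_props:
  assumes \<sigma>: "\<sigma> \<in> {1, -1}"
  shows Pi_Pi: "Pi \<sigma> x *v (Pi \<sigma> x *v v) = Pi \<sigma> x *v v"
    and Pi_Pi_opp: "Pi \<sigma> x *v (Pi (- \<sigma>) x *v v) = 0"
    and Pi_adjoint: "nnform (Pi \<sigma> x *v v) w = nnform v (Pi (- \<sigma>) x *v w)"
    and Pi_e2n: "Pi \<sigma> x *v e2n = 0"
proof -
  have s: "- \<sigma> \<in> {1, -1}" "\<sigma> * \<sigma> = 1" using \<sigma> by auto
  obtain h where h: "h \<in> carrier G0" and P: "\<forall>\<sigma> v. \<sigma> \<in> {1, -1} \<longrightarrow> Pi \<sigma> x *v v = h *v (pr \<sigma> *v (matrix_inv h *v v))"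
    by (rule Pi_apply)
  note P1 = P[rule_format, OF \<sigma>] and P2 = P[rule_format, OF s(1)]
  show "Pi \<sigma> x *v (Pi \<sigma> x *v v) = Pi \<sigma> x *v v" using h by (simp add: P1 pr_pr[OF s(2)])
  show "Pi \<sigma> x *v (Pi (- \<sigma>) x *v v) = 0" using h by (simp add: P1 P2 pr_pr_opp[OF s(2)])
  show "nnform (Pi \<sigma> x *v v) w = nnform v (Pi (- \<sigma>) x *v w)"
  proof -
    have "nnform (h *v (pr \<sigma> *v (matrix_inv h *v v))) w = nnform (pr \<sigma> *v (matrix_inv h *v v)) (matrix_inv h *v w)"
      using nnform_G0[OF h, of _ "matrix_inv h *v w"] h by simp
    also have "\<dots> = nnform (matrix_inv h *v v) (pr (- \<sigma>) *v (matrix_inv h *v w))" by (rule pr_adjoint[OF s(2)])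
    also have "\<dots> = nnform v (h *v (pr (- \<sigma>) *v (matrix_inv h *v w)))"
      using nnform_G0[OF h, of "matrix_inv h *v v"] h by simp
    finally show ?thesis by (simp only: P1 P2)
  qed
  have "matrix_inv h *v e2n = e2n" by (rule G0_e2n[OF G0_inverse[OF h]])
  then show "Pi \<sigma> x *v e2n = 0" by (simp add: P1 pr_e2n[OF s(2)])
qed

lemma Pi_e2n_form: "\<sigma> \<in> {1, -1} \<Longrightarrow> nnform (Pi \<sigma> x *v v) e2n = 0"
  using Pi_e2n[of "- \<sigma>"] by (auto simp: Pi_adjoint)

lemma neutral_frame:
  assumes "frame h x" shows "neutral (Pi 1 x) (Pi (-1) x) (h *v en)"
proof -
  have h: "h \<in> carrier G0" using assms by (simp add: frame_def)
  have P: "Pi \<sigma> x *v v = h *v (pr \<sigma> *v (matrix_inv h *v v))" if "\<sigma> \<in> {1, -1}" for \<sigma> v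
    unfolding Pi_frame[OF assms that] by (simp add: matrix_vector_mul_assoc matrix_mul_assoc)
  show ?thesis
    by (rule neutral_transport[OF neutral_pr, of _ "matrix_inv h"])
      (use h P in \<open>simp_all add: nnform_G0 G0_e2n\<close>)
qed

text \<open>The resolution of the identity at \<nu> says that the two projections of \<nu> have sum
  zero, and applying either projection separates them.\<close>

lemma neutral_Pi:
  assumes n: "neutral (Pi 1 x) (Pi (-1) x) \<nu>" and \<sigma>: "\<sigma> \<in> {1, -1}"
  shows "Pi \<sigma> x *v \<nu> = 0" "nnform (Pi \<sigma> x *v v) \<nu> = 0"
proof -
  have "Pi 1 x *v \<nu> + Pi (-1) x *v \<nu> = 0"
    using neutral_decomp[OF n, of \<nu>] n by (simp add: neutral_def)
  then have s: "Pi \<tau> x *v (Pi 1 x *v \<nu> + Pi (-1) x *v \<nu>) = 0" for \<tau> by simp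
  have 1: "Pi 1 x *v \<nu> = 0"
    using s[of 1] Pi_Pi[of 1 \<nu>] Pi_Pi_opp[of 1 \<nu>] by (simp add: matrix_vector_right_distrib)
  have 2: "Pi (-1) x *v \<nu> = 0"
    using s[of "-1"] Pi_Pi[of "-1" \<nu>] Pi_Pi_opp[of "-1" \<nu>] by (simp add: matrix_vector_right_distrib)
  show "Pi \<sigma> x *v \<nu> = 0" using \<sigma> 1 2 by auto
  show "nnform (Pi \<sigma> x *v v) \<nu> = 0" unfolding Pi_adjoint[OF \<sigma>] using \<sigma> 1 2 by auto
qed

lemma Pi_isotropic: "\<sigma> \<in> {1, -1} \<Longrightarrow> nnform (Pi \<sigma> x *v v) (Pi \<sigma> x *v w) = 0"
  using Pi_Pi_opp[of "- \<sigma>" w] by (auto simp: Pi_adjoint)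

text \<open>The unipotent matrix fixes every vector orthogonal to \<open>Pi \<sigma> x *v v\<close>
  and \<nu>, in particular the whole image of \<open>Pi \<sigma> x\<close>, hence also the coset
  given by that image.\<close>

lemma unip_Pi_stab:
  assumes n: "neutral (Pi 1 x) (Pi (-1) x) \<nu>" and \<sigma>: "\<sigma> \<in> {1, -1}"
  shows "unip (Pi \<sigma> x *v v) \<nu> t \<in> carrier G0"
    "unip (Pi \<sigma> x *v v) \<nu> t \<in> coset_stab G0 (xi \<sigma> (end_pt \<sigma> x))"
proof -
  let ?w = "Pi \<sigma> x *v v"
  have ab: "nnform ?w ?w = 0" "nnform ?w \<nu> = 0" "nnform \<nu> \<nu> = 1" "nnform ?w e2n = 0" "nnform \<nu> e2n = 0"
    using n Pi_isotropic[OF \<sigma>] neutral_Pi(2)[OF n \<sigma>] Pi_e2n_form[OF \<sigma>] by (simp_all add: neutral_def)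
  show G: "unip ?w \<nu> t \<in> carrier G0" by (rule unip_G0[OF ab])
  obtain h where hf: "frame h x" and h: "h \<in> carrier G0" and P: "\<forall>\<sigma> v. \<sigma> \<in> {1, -1} \<longrightarrow> Pi \<sigma> x *v v = h *v (pr \<sigma> *v (matrix_inv h *v v))"
    by (rule Pi_apply)
  have xi: "xi \<sigma> (end_pt \<sigma> x) = h <#\<^bsub>G0\<^esub> stab0 (Wsub \<sigma>)" using hf \<sigma> unfolding frame_def by blast
  let ?k = "matrix_inv h ** (unip ?w \<nu> t ** h)"
  have "?k *v z = z" if z: "z \<in> Wsub \<sigma>" for z
  proof -
    have "\<sigma> * \<sigma> = 1" using \<sigma> by auto
    then have hz: "h *v z = Pi \<sigma> x *v (h *v z)"
      unfolding P[rule_format, OF \<sigma>] using h z by (simp add: pr_Wsub)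
    have "nnform (h *v z) ?w = 0" "nnform (h *v z) \<nu> = 0"
      by (subst hz, rule Pi_isotropic[OF \<sigma>]) (subst hz, rule neutral_Pi(2)[OF n \<sigma>])
    then have "unip ?w \<nu> t *v (h *v z) = h *v z" by (simp add: unip_apply[OF ab])
    then show ?thesis using h by (simp add: matrix_vector_mul_assoc[symmetric])
  qed
  then have "(*v) ?k ` Wsub \<sigma> = Wsub \<sigma>" by simp
  moreover have "?k \<in> carrier G0" by (intro G0_mult G0_inverse h G)
  ultimately have "?k \<in> stab0 (Wsub \<sigma>)" by (simp add: stab0_def)
  then have "(unip ?w \<nu> t ** h) <#\<^bsub>G0\<^esub> stab0 (Wsub \<sigma>) = h <#\<^bsub>G0\<^esub> stab0 (Wsub \<sigma>)"
    using lcoset_G0_eq_iff[OF G0_mult[OF G h] h] by blast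
  then show "unip ?w \<nu> t \<in> coset_stab G0 (xi \<sigma> (end_pt \<sigma> x))"
    unfolding coset_stab_def xi using G by (simp add: lcoset_G0_assoc[OF G h])
qed

text \<open>A vector \<open>w\<close> in the image of \<open>Pi \<sigma> x\<close> becomes the
  velocity \<open>skew w \<nu>\<close>. Through this map the Anosov contraction, which concerns
  tangent vectors, will be read as contraction in the linear space.\<close>

lemma skew_Pi_lie:
  assumes n: "neutral (Pi 1 x) (Pi (-1) x) \<nu>" and \<sigma>: "\<sigma> \<in> {1, -1}"
  shows "skew (Pi \<sigma> x *v v) \<nu> \<in> lie_algebra (carrier G0)"
    "skew (Pi \<sigma> x *v v) \<nu> \<in> lie_algebra (coset_stab G0 (xi \<sigma> (end_pt \<sigma> x)))"
  unfolding lie_algebra_def using unip_Pi_stab[OF n \<sigma>] unip_deriv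
  by (auto intro!: exI[of _ "unip (Pi \<sigma> x *v v) \<nu>"])

end


section \<open>Equivariance under the group\<close>

lemmas gromov_flow_axioms = gflow[unfolded gromov_flow_def Let_def]
lemmas flow_action = gromov_flow_axioms[THEN conjunct1]
lemmas act_proper = gromov_flow_axioms[THEN conjunct2, THEN conjunct2, THEN conjunct1]
lemmas act_cocompact = gromov_flow_axioms[THEN conjunct2, THEN conjunct2, THEN conjunct2, THEN conjunct1]
lemmas act_flow = gromov_flow_axioms[THEN conjunct2, THEN conjunct2, THEN conjunct2, THEN conjunct2, THEN conjunct1, rule_format]
lemmas act_fst = gromov_flow_axioms[THEN conjunct2, THEN conjunct2, THEN conjunct2, THEN conjunct2, THEN conjunct2, THEN conjunct1, rule_format]
lemmas act_axis = gromov_flow_axioms[THEN conjunct2, THEN conjunct2, THEN conjunct2, THEN conjunct2, THEN conjunct2, THEN conjunct2,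
  THEN conjunct1, rule_format]
lemmas flow_metric = gromov_flow_axioms[THEN conjunct2, THEN conjunct2, THEN conjunct2, THEN conjunct2, THEN conjunct2, THEN conjunct2,
  THEN conjunct2]

lemma metrizable_X:
  obtains d where "Metric_space (topspace X) d" "Metric_space.mtopology (topspace X) d = X"
  using flow_metric by (elim exE conjE)

lemma act_mult: "\<lbrakk>g \<in> carrier \<Gamma>; h \<in> carrier \<Gamma>; x \<in> topspace X\<rbrakk> \<Longrightarrow> act (g \<otimes> h) x = act g (act h x)"
  using group_action.composition_rule[OF flow_action] by blast

lemma act_one: "x \<in> topspace X \<Longrightarrow> act \<one> x = x"
  using group_action.id_eq_one[OF flow_action, symmetric] by (simp add: restrict_def)

lemma act_inv: "\<lbrakk>g \<in> carrier \<Gamma>; x \<in> topspace X\<rbrakk> \<Longrightarrow> act (inv g) (act g x) = x"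
  using act_mult[of "inv g" g x] by (simp add: act_one)

lemma end_pt_act:
  assumes "g \<in> carrier \<Gamma>" "x \<in> topspace X"
  shows "end_pt \<sigma> (act g x) = boundary_act \<Gamma> g (end_pt \<sigma> x)"
  using act_fst[of g "fst (fst x)" "snd (fst x)" "snd x"] assms by (simp add: end_pt_def)

lemma rho_G0: "g \<in> carrier \<Gamma> \<Longrightarrow> \<rho> g \<in> carrier G0"
  using hom_in_carrier[OF rho_hom] .

lemma rho_inv:
  assumes g: "g \<in> carrier \<Gamma>" shows "\<rho> (inv g) = matrix_inv (\<rho> g)"
proof -
  have "group_hom \<Gamma> G0 \<rho>" using rho_hom group_G0 by (simp add: group_hom_def group_hom_axioms_def is_group)
  then have "\<rho> (inv g) = inv\<^bsub>G0\<^esub> (\<rho> g)" using g by (rule group_hom.hom_inv)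
  then show ?thesis by (simp add: inv_G0 rho_G0 g)
qed

lemma frame_flow: "frame h (flow T x) \<longleftrightarrow> frame h x"
  by (simp add: frame_def)

lemma Pi_flow: "Pi \<sigma> (flow T x) = Pi \<sigma> x"
  by (simp add: local.Pi_def frame_flow)

lemma frame_act:
  assumes g: "g \<in> carrier \<Gamma>" and x: "x \<in> topspace X" and h: "frame h x"
  shows "frame (\<rho> g ** h) (act g x)"
  unfolding frame_def
proof (intro conjI ballI)
  have hc: "h \<in> carrier G0" using h by (simp add: frame_def)
  show "\<rho> g ** h \<in> carrier G0" by (rule G0_mult[OF rho_G0[OF g] hc])
  fix \<sigma> :: real assume \<sigma>: "\<sigma> \<in> {1, -1}"
  show "xi \<sigma> (end_pt \<sigma> (act g x)) = (\<rho> g ** h) <#\<^bsub>G0\<^esub> stab0 (Wsub \<sigma>)"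
    unfolding end_pt_act[OF g x] xi_equiv[OF \<sigma> g end_pt_boundary[OF x]] frame_xi[OF h \<sigma>]
    by (rule lcoset_G0_assoc[OF rho_G0[OF g] hc])
qed

lemma Pi_act:
  assumes g: "g \<in> carrier \<Gamma>" and x: "x \<in> topspace X" and \<sigma>: "\<sigma> \<in> {1, -1}"
  shows "Pi \<sigma> (act g x) *v (\<rho> g *v v) = \<rho> g *v (Pi \<sigma> x *v v)"
proof -
  obtain h where h: "frame h x" using frame_ex[OF x] by blast
  have hc: "h \<in> carrier G0" using h by (simp add: frame_def)
  note r = rho_G0[OF g]
  have "matrix_inv (\<rho> g ** h) = matrix_inv h ** matrix_inv (\<rho> g)"
  proof (rule matrix_inv_unique)
    have "matrix_inv h ** matrix_inv (\<rho> g) ** (\<rho> g ** h) = matrix_inv h ** (matrix_inv (\<rho> g) ** \<rho> g) ** h"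
      by (simp only: matrix_mul_assoc)
    then show "matrix_inv h ** matrix_inv (\<rho> g) ** (\<rho> g ** h) = mat 1" using r hc by simp
  qed
  then show ?thesis
    unfolding Pi_frame[OF frame_act[OF g x h] \<sigma>] Pi_frame[OF h \<sigma>]
    using r by (simp add: matrix_vector_mul_assoc[symmetric])
qed

section \<open>Uniform estimates over compact sets\<close>

lemma Pi_bounded:
  assumes "compactin X K"
  obtains b where "1 \<le> b" "\<forall>x\<in>K. \<forall>\<sigma>\<in>{1, -1}. norm (Pi \<sigma> x) \<le> b"
proof -
  have "\<exists>b. \<forall>x\<in>K. norm (Pi \<sigma> x) \<le> b" if "\<sigma> \<in> {1, -1}" for \<sigma>
  proof -
    have "compact (Pi \<sigma> ` K)" using image_compactin[OF assms continuous_map_Pi[OF that]] by simp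
    then have "bounded (Pi \<sigma> ` K)" by (rule compact_imp_bounded)
    then obtain b where "\<forall>y\<in>Pi \<sigma> ` K. norm y \<le> b" unfolding bounded_iff by (elim exE)
    then show ?thesis by (intro exI[of _ b] ballI) simp
  qed
  then have "\<exists>b. \<forall>x\<in>K. norm (Pi 1 x) \<le> b" "\<exists>b. \<forall>x\<in>K. norm (Pi (-1) x) \<le> b" by simp_all
  then obtain b1 b2 where b: "\<forall>x\<in>K. norm (Pi 1 x) \<le> b1" "\<forall>x\<in>K. norm (Pi (-1) x) \<le> b2" by (elim exE)
  show thesis
  proof (rule that[of "max 1 (max b1 b2)"], simp, intro ballI)
    fix x \<sigma> assume "x \<in> K" "\<sigma> \<in> {1, -1 :: real}"
    then show "norm (Pi \<sigma> x) \<le> max 1 (max b1 b2)"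
      using b(1)[rule_format, of x] b(2)[rule_format, of x] by (elim insertE) simp_all
  qed
qed

text \<open>Test the resolution of the identity on \<open>Inn *v \<nu>\<close>, whose pairing with
  \<nu> is the squared euclidean norm: the cube of \<open>norm \<nu>\<close> is then at most
  \<open>(2 * b + 2) * norm \<nu>\<close>.\<close>

lemma neutral_norm_le:
  assumes b: "norm (Pi 1 x) \<le> b" "norm (Pi (-1) x) \<le> b" "1 \<le> b" and n: "neutral (Pi 1 x) (Pi (-1) x) \<nu>"
  shows "norm \<nu> \<le> 2 * b + 2"
proof (rule ccontr)
  assume big: "\<not> norm \<nu> \<le> 2 * b + 2"
  define v where "v = Inn *v \<nu>"
  have nv: "norm v = norm \<nu>" by (simp add: v_def)
  have "Inn *v v = \<nu>" using Inn_Inn[where 'n='n] by (simp add: v_def matrix_vector_mul_assoc)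
  then have "nnform v \<nu> = \<nu> \<bullet> \<nu>" unfolding nnform_sym[of v] by (simp add: nnform_def)
  then have "(\<nu> \<bullet> \<nu>) *\<^sub>R \<nu> = v - Pi 1 x *v v - Pi (-1) x *v v + nnform v e2n *\<^sub>R e2n"
    using neutral_decomp[OF n, of v] by (simp add: algebra_simps)
  then have "norm ((\<nu> \<bullet> \<nu>) *\<^sub>R \<nu>) = norm (v - Pi 1 x *v v - Pi (-1) x *v v + nnform v e2n *\<^sub>R e2n)" by simp
  also have "\<dots> \<le> norm v + norm (Pi 1 x *v v) + norm (Pi (-1) x *v v) + norm (nnform v e2n *\<^sub>R (e2n :: 'n dvec))"
    using norm_triangle_ineq[of "v - Pi 1 x *v v - Pi (-1) x *v v" "nnform v e2n *\<^sub>R e2n"]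
      norm_triangle_ineq4[of "v - Pi 1 x *v v" "Pi (-1) x *v v"] norm_triangle_ineq4[of v "Pi 1 x *v v"] by linarith
  also have "\<dots> \<le> norm \<nu> + b * norm \<nu> + b * norm \<nu> + norm \<nu>"
    using abs_nnform_le[of v e2n] b by (intro add_mono) (auto intro!: norm_matrix_vector_bound simp: nv)
  finally have "norm \<nu> * norm \<nu> * norm \<nu> \<le> (2 * b + 2) * norm \<nu>"
    by (simp add: dot_square_norm power2_eq_square algebra_simps)
  moreover have "0 < norm \<nu>" using big b by linarith
  ultimately have "norm \<nu> * norm \<nu> \<le> 2 * b + 2" by simp
  moreover have "1 * norm \<nu> \<le> norm \<nu> * norm \<nu>" using big b by (intro mult_right_mono) auto
  ultimately show False using big by simp
qed

lemma subspace_g0: "subspace (lie_algebra (carrier (G0 :: 'n dmat monoid)))"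
  by (rule subspace_lie_algebra[OF mat1_G0 G0_mult])

text \<open>Continuity in \<open>x\<close> is available for each fixed \<open>Y\<close>. An
  orthonormal basis of the Lie algebra and the seminorm laws make the bound uniform in
  \<open>Y\<close>.\<close>

lemma N_upper:
  assumes K: "compactin X K"
  obtains A where "0 \<le> A" "\<forall>x\<in>K. \<forall>Y\<in>lie_algebra (carrier G0). N x Y \<le> A * norm Y"
proof -
  let ?g = "lie_algebra (carrier (G0 :: 'n dmat monoid))"
  obtain B where B: "B \<subseteq> ?g" "pairwise orthogonal B" "\<And>Z. Z \<in> B \<Longrightarrow> norm Z = 1" "independent B" "span B = ?g"
    using orthonormal_basis_subspace[OF subspace_g0] by metis
  have fin: "finite B" using B(4) by (rule independent_imp_finite)
  have "\<exists>a. \<forall>x\<in>K. N x Z \<le> a" if "Z \<in> B" for Z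
  proof -
    have "compact ((\<lambda>x. N x Z) ` K)" using image_compactin[OF K N_cont] B(1) that by fastforce
    then have "bounded ((\<lambda>x. N x Z) ` K)" by (rule compact_imp_bounded)
    then show ?thesis unfolding bounded_iff by (metis abs_le_D1 imageI real_norm_def)
  qed
  then obtain a where a: "\<And>Z x. Z \<in> B \<Longrightarrow> x \<in> K \<Longrightarrow> N x Z \<le> a Z" by metis
  define A where "A = (\<Sum>Z\<in>B. \<bar>a Z\<bar>)"
  show thesis
  proof (rule that[of A])
    show "0 \<le> A" by (simp add: A_def sum_nonneg)
    show "\<forall>x\<in>K. \<forall>Y\<in>?g. N x Y \<le> A * norm Y"
    proof (intro ballI)
      fix x Y assume x: "x \<in> K" and Y: "Y \<in> ?g"
      have xX: "x \<in> topspace X" using compactin_subset_topspace[OF K] x by blast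
      note E = N_norm[OF xX] subspace_g0
      have "N x (\<Sum>Z\<in>D. (Y \<bullet> Z) *\<^sub>R Z) \<le> (\<Sum>Z\<in>D. \<bar>a Z\<bar> * norm Y)" if "D \<subseteq> B" for D
        using finite_subset[OF that fin] that
      proof (induction D)
        case empty
        then show ?case using euclidean_norm_mod_scale[OF E, of 0 0] subspace_0[OF subspace_g0] by simp
      next
        case (insert Z D)
        have Zg: "Z \<in> ?g" using insert B(1) by blast
        have Dg: "(\<Sum>Z\<in>D. (Y \<bullet> Z) *\<^sub>R Z) \<in> ?g"
          using insert B(1) by (intro subspace_sum[OF subspace_g0] subspace_scale[OF subspace_g0]) auto
        have "N x ((Y \<bullet> Z) *\<^sub>R Z) \<le> \<bar>a Z\<bar> * norm Y"
        proof -
          have "\<bar>Y \<bullet> Z\<bar> \<le> norm Y" using Cauchy_Schwarz_ineq2[of Y Z] B(3) insert by simp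
          moreover have "0 \<le> N x Z" "N x Z \<le> \<bar>a Z\<bar>"
            using euclidean_norm_mod_nonneg[OF E Zg] a[of Z x] insert x by auto
          ultimately have "\<bar>Y \<bullet> Z\<bar> * N x Z \<le> norm Y * \<bar>a Z\<bar>" by (intro mult_mono) auto
          then show ?thesis by (simp add: euclidean_norm_mod_scale[OF E Zg] mult.commute)
        qed
        moreover have "N x ((Y \<bullet> Z) *\<^sub>R Z + (\<Sum>Z\<in>D. (Y \<bullet> Z) *\<^sub>R Z))
            \<le> N x ((Y \<bullet> Z) *\<^sub>R Z) + N x (\<Sum>Z\<in>D. (Y \<bullet> Z) *\<^sub>R Z)"
          by (rule euclidean_norm_mod_triangle[OF E subspace_scale[OF subspace_g0 Zg] Dg])
        moreover have "N x (\<Sum>Z\<in>D. (Y \<bullet> Z) *\<^sub>R Z) \<le> (\<Sum>Z\<in>D. \<bar>a Z\<bar> * norm Y)" using insert by auto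
        ultimately show ?case using insert.hyps by simp
      qed
      from this[OF subset_refl] show "N x Y \<le> A * norm Y"
        using orthonormal_basis_expand[OF B(2,3) _ fin, of Y] Y B(5) by (simp add: A_def sum_distrib_right)
    qed
  qed
qed

text \<open>Let \<open>w\<close> be the projected vector. A vanishing norm puts
  \<open>skew w \<nu>\<close> in the Lie algebra of the common stabilizer, so it maps the image of
  \<open>Pi (- \<sigma>) x\<close> to itself. But there it sends \<open>z\<close> to
  \<open>nnform z w\<close> times \<nu>, which lies outside that image unless it is zero. Hence
  \<open>w\<close> is orthogonal to the dual summand, and so zero.\<close>

lemma skew_null_zero:
  assumes x: "x \<in> topspace X" and n: "neutral (Pi 1 x) (Pi (-1) x) \<nu>" and \<sigma>: "\<sigma> \<in> {1, -1}"
    and 0: "N x (skew (Pi \<sigma> x *v v) \<nu>) = 0"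
  shows "Pi \<sigma> x *v v = 0"
proof -
  let ?w = "Pi \<sigma> x *v v"
  let ?X = "skew ?w \<nu>"
  have \<sigma>': "- \<sigma> \<in> {1, -1}" using \<sigma> by auto
  have "?X \<in> lie_algebra (coset_stab G0 (xi 1 (end_pt 1 x)) \<inter> coset_stab G0 (xi (-1) (end_pt (-1) x)))"
    using 0 euclidean_norm_mod_zero[OF N_norm[OF x] subspace_g0 skew_Pi_lie(1)[OF x n \<sigma>]] by blast
  then obtain c where c: "\<And>t. c t \<in> coset_stab G0 (xi (-\<sigma>) (end_pt (-\<sigma>) x))" "c 0 = mat 1"
    "(c has_vector_derivative ?X) (at 0)"
    unfolding lie_algebra_def using \<sigma> by fastforce
  obtain h where hf: "frame h x" and h: "h \<in> carrier G0"
    and P: "\<forall>\<sigma> v. \<sigma> \<in> {1, -1} \<longrightarrow> Pi \<sigma> x *v v = h *v (pr \<sigma> *v (matrix_inv h *v v))"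
    by (rule Pi_apply[OF x])
  have s1: "- \<sigma> * - \<sigma> = 1" using \<sigma> by auto
  have inv: "Pi (-\<sigma>) x *v (c t *v (Pi (-\<sigma>) x *v z)) = c t *v (Pi (-\<sigma>) x *v z)" for t z
  proof -
    have ct: "c t \<in> carrier G0" and "c t <#\<^bsub>G0\<^esub> (h <#\<^bsub>G0\<^esub> stab0 (Wsub (- \<sigma>))) = h <#\<^bsub>G0\<^esub> stab0 (Wsub (- \<sigma>))"
      using c(1)[of t] unfolding coset_stab_def frame_xi[OF hf \<sigma>'] by auto
    then have "matrix_inv h ** (c t ** h) \<in> stab0 (Wsub (- \<sigma>))"
      using lcoset_G0_eq_iff[OF G0_mult[OF ct h] h] by (simp add: lcoset_G0_assoc[OF ct h])
    then have im: "(*v) (matrix_inv h ** (c t ** h)) ` Wsub (- \<sigma>) = Wsub (- \<sigma>)" by (simp add: stab0_def)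
    let ?p = "pr (- \<sigma>) *v (matrix_inv h *v z)"
    have "(matrix_inv h ** (c t ** h)) *v ?p \<in> (*v) (matrix_inv h ** (c t ** h)) ` Wsub (- \<sigma>)"
      by (rule imageI[OF pr_in_Wsub[OF s1]])
    then have "(matrix_inv h ** (c t ** h)) *v ?p \<in> Wsub (- \<sigma>)" unfolding im .
    then have "pr (- \<sigma>) *v ((matrix_inv h ** (c t ** h)) *v ?p) = (matrix_inv h ** (c t ** h)) *v ?p"
      by (rule pr_Wsub[OF s1])
    then have "h *v (pr (- \<sigma>) *v ((matrix_inv h ** (c t ** h)) *v ?p)) = h *v ((matrix_inv h ** (c t ** h)) *v ?p)" by simp
    then show ?thesis
      unfolding P[rule_format, OF \<sigma>'] using h by (simp add: matrix_vector_mul_assoc[symmetric])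
  qed
  \<comment> \<open>The invariance of the image along the curve \<open>c\<close> is differentiated
    at 0.\<close>
  have XP: "Pi (-\<sigma>) x *v (?X *v (Pi (-\<sigma>) x *v z)) = ?X *v (Pi (-\<sigma>) x *v z)" for z
  proof -
    have d: "((\<lambda>t. c t *v (Pi (-\<sigma>) x *v z)) has_vector_derivative ?X *v (Pi (-\<sigma>) x *v z)) (at 0)"
      using has_vector_derivative_matrix_vector[OF c(3) has_vector_derivative_const] by simp
    have "((\<lambda>t. Pi (-\<sigma>) x *v (c t *v (Pi (-\<sigma>) x *v z))) has_vector_derivative
        Pi (-\<sigma>) x *v (?X *v (Pi (-\<sigma>) x *v z))) (at 0)"
      using has_vector_derivative_matrix_vector[OF has_vector_derivative_const d] by simp
    then have "((\<lambda>t. c t *v (Pi (-\<sigma>) x *v z)) has_vector_derivative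
        Pi (-\<sigma>) x *v (?X *v (Pi (-\<sigma>) x *v z))) (at 0)" unfolding inv .
    then show ?thesis using d by (rule vector_derivative_unique_at)
  qed
  show ?thesis
  proof (rule nnform_nondeg)
    fix z
    let ?z = "Pi (-\<sigma>) x *v z"
    have "?X *v ?z = nnform ?z ?w *\<^sub>R \<nu>"
      unfolding skew_apply using neutral_Pi(2)[OF x n \<sigma>'] by simp
    then have "nnform ?z ?w *\<^sub>R \<nu> = Pi (-\<sigma>) x *v (nnform ?z ?w *\<^sub>R \<nu>)" using XP[of z] by simp
    also have "\<dots> = 0" by (simp add: matrix_vector_mult_scaleR neutral_Pi(1)[OF x n \<sigma>'])
    finally have "nnform ?z ?w *\<^sub>R \<nu> = 0" .
    moreover have "\<nu> \<noteq> 0" using n by (auto simp: neutral_def)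
    ultimately have "nnform ?z ?w = 0" by simp
    then have "nnform z ?w = 0" using Pi_adjoint[OF x \<sigma>', of z ?w] Pi_Pi[OF x \<sigma>, of v] by simp
    then show "nnform ?w z = 0" by (subst nnform_sym)
  qed
qed


text \<open>Unit vectors whose tangent norms tend to 0 would have a limit contradicting
  \<open>skew_null_zero\<close>. As \<open>N\<close> is continuous for a fixed tangent vector, the
  limit vector is inserted at every \<open>x (q k)\<close> and the error is controlled by
  \<open>N_upper\<close>.\<close>

lemma N_lower_sequence:
  assumes K: "compactin X K" and \<sigma>: "\<sigma> \<in> {1, -1}"
    and x: "\<And>k. x k \<in> K" and n: "\<And>k. neutral (Pi 1 (x k)) (Pi (-1) (x k)) (\<nu> k)"
    and w: "\<And>k. norm (w k) = 1" "\<And>k. Pi \<sigma> (x k) *v w k = w k"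
    and small: "\<And>k. N (x k) (skew (w k) (\<nu> k)) \<le> 1 / real (Suc k)"
  shows False
proof -
  obtain d where d: "Metric_space (topspace X) d" "Metric_space.mtopology (topspace X) d = X"
    by (rule metrizable_X)
  obtain b where b: "1 \<le> b" "\<forall>x\<in>K. \<forall>\<sigma>\<in>{1, -1}. norm (Pi \<sigma> x) \<le> b" using Pi_bounded[OF K] .
  have KX: "K \<subseteq> topspace X" by (rule compactin_subset_topspace[OF K])
  have "range x \<subseteq> K" using x by blast
  moreover have "\<forall>s :: nat \<Rightarrow> _. range s \<subseteq> K \<longrightarrow> (\<exists>l r. l \<in> K \<and> strict_mono r \<and> limitin X (s \<circ> r) l sequentially)"
    by (rule Metric_space.compactin_sequentially[OF d(1), of K, unfolded d(2), THEN iffD1, OF K, THEN conjunct2])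
  ultimately obtain z r where z: "z \<in> K" "strict_mono r" "limitin X (x \<circ> r) z sequentially" by meson
  have zX: "z \<in> topspace X" using KX z(1) by blast
  have "bounded (range (\<lambda>k. (w (r k), \<nu> (r k))))"
  proof -
    have "norm (w (r k), \<nu> (r k)) \<le> 1 + (2 * b + 2)" for k
    proof -
      have "norm (\<nu> (r k)) \<le> 2 * b + 2"
        by (rule neutral_norm_le[OF _ _ b(1) n]) (use b(2) x in auto)
      then show ?thesis using norm_Pair_le[of "w (r k)" "\<nu> (r k)"] w(1)[of "r k"] by simp
    qed
    then show ?thesis by (intro boundedI[of _ "1 + (2 * b + 2)"]) auto
  qed
  then obtain l r' where r': "strict_mono (r' :: nat \<Rightarrow> nat)" "((\<lambda>k. (w (r k), \<nu> (r k))) \<circ> r') \<longlonglongrightarrow> l"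
    using bounded_imp_convergent_subsequence by blast
  define W V q where "W = fst l" and "V = snd l" and "q = r \<circ> r'"
  have q: "strict_mono q" unfolding q_def by (rule strict_mono_o[OF z(2) r'(1)])
  have lim: "(\<lambda>k. w (q k)) \<longlonglongrightarrow> W" "(\<lambda>k. \<nu> (q k)) \<longlonglongrightarrow> V"
    using tendsto_fst[OF r'(2)] tendsto_snd[OF r'(2)] by (simp_all add: W_def V_def q_def o_def)
  have xz: "limitin X (x \<circ> q) z sequentially"
    using limitin_subsequence[OF r'(1) z(3)] by (simp add: q_def o_assoc)
  have Plim: "(\<lambda>k. Pi \<tau> (x (q k))) \<longlonglongrightarrow> Pi \<tau> z" if "\<tau> \<in> {1, -1}" for \<tau>
    using continuous_map_limit[OF continuous_map_Pi[OF that] xz] by (simp add: o_def)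
  have W1: "norm W = 1"
    using tendsto_norm[OF lim(1)] by (simp add: w(1) LIMSEQ_const_iff)
  have PW: "Pi \<sigma> z *v W = W"
    using LIMSEQ_unique[OF tendsto_matrix_vector[OF Plim[OF \<sigma>] lim(1)]] lim(1) by (simp add: w(2))
  have nV: "neutral (Pi 1 z) (Pi (-1) z) V"
  proof -
    have nk: "nnform (\<nu> (q k)) (\<nu> (q k)) = 1" "nnform (\<nu> (q k)) e2n = 0" for k
      using n[of "q k"] by (simp_all add: neutral_def)
    have "(\<lambda>k. nnform (\<nu> (q k)) (\<nu> (q k))) \<longlonglongrightarrow> nnform V V" "(\<lambda>k. nnform (\<nu> (q k)) e2n) \<longlonglongrightarrow> nnform V e2n"
      by (intro tendsto_intros lim)+
    then have 1: "nnform V V = 1" "nnform V e2n = 0" unfolding nk by (simp_all add: LIMSEQ_const_iff)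
    have "Pi 1 z *v v + Pi (-1) z *v v + nnform v V *\<^sub>R V - nnform v e2n *\<^sub>R e2n = v" for v
    proof -
      have "(\<lambda>k. Pi 1 (x (q k)) *v v + Pi (-1) (x (q k)) *v v + nnform v (\<nu> (q k)) *\<^sub>R \<nu> (q k) - nnform v e2n *\<^sub>R e2n)
          \<longlonglongrightarrow> Pi 1 z *v v + Pi (-1) z *v v + nnform v V *\<^sub>R V - nnform v e2n *\<^sub>R e2n"
        by (intro tendsto_intros lim Plim) auto
      then show ?thesis unfolding neutral_decomp[OF n] by (simp add: LIMSEQ_const_iff)
    qed
    then show ?thesis using 1 unfolding neutral_def by (intro conjI allI)
  qed
  let ?g = "lie_algebra (carrier (G0 :: 'n dmat monoid))"
  have Yk: "skew (w k) (\<nu> k) \<in> ?g" for k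
  proof -
    have "x k \<in> topspace X" using x KX by blast
    from skew_Pi_lie(1)[OF this n \<sigma>, of "w k"] show ?thesis by (simp add: w(2))
  qed
  have Y: "skew W V \<in> ?g" using skew_Pi_lie(1)[OF zX nV \<sigma>, of W] by (simp add: PW)
  obtain A where A: "0 \<le> A" "\<forall>x\<in>K. \<forall>Y\<in>?g. N x Y \<le> A * norm Y" using N_upper[OF K] .
  have Ylim: "(\<lambda>k. skew (w (q k)) (\<nu> (q k))) \<longlonglongrightarrow> skew W V" by (intro tendsto_intros lim)
  have "(\<lambda>k. N (x (q k)) (skew W V)) \<longlonglongrightarrow> N z (skew W V)"
    using continuous_map_limit[OF N_cont[OF Y] xz] by (simp add: o_def)
  moreover have "(\<lambda>k. 1 / real (Suc (q k)) + A * norm (skew W V - skew (w (q k)) (\<nu> (q k)))) \<longlonglongrightarrow> 0 + A * norm (skew W V - skew W V)"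
  proof (intro tendsto_add tendsto_mult tendsto_const tendsto_norm tendsto_diff Ylim)
    show "(\<lambda>k. 1 / real (Suc (q k))) \<longlonglongrightarrow> 0"
      using LIMSEQ_subseq_LIMSEQ[OF LIMSEQ_inverse_real_of_nat q] by (simp add: o_def inverse_eq_divide)
  qed
  moreover have "N (x (q k)) (skew W V) \<le> 1 / real (Suc (q k)) + A * norm (skew W V - skew (w (q k)) (\<nu> (q k)))" for k
  proof -
    let ?D = "skew W V - skew (w (q k)) (\<nu> (q k))"
    have xX: "x (q k) \<in> topspace X" using x KX by blast
    have D: "?D \<in> ?g" by (rule subspace_diff[OF subspace_g0 Y Yk])
    have "N (x (q k)) (skew (w (q k)) (\<nu> (q k)) + ?D) \<le> N (x (q k)) (skew (w (q k)) (\<nu> (q k))) + N (x (q k)) ?D"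
      by (rule euclidean_norm_mod_triangle[OF N_norm[OF xX] subspace_g0 Yk D])
    moreover have "N (x (q k)) ?D \<le> A * norm ?D" using A(2) x D by blast
    ultimately show ?thesis using small[of "q k"] by simp
  qed
  ultimately have "N z (skew W V) \<le> 0"
    using LIMSEQ_le[of "\<lambda>k. N (x (q k)) (skew W V)" "N z (skew W V)"] by fastforce
  moreover have "0 \<le> N z (skew W V)" by (rule euclidean_norm_mod_nonneg[OF N_norm[OF zX] subspace_g0 Y])
  ultimately have "N z (skew (Pi \<sigma> z *v W) V) = 0" by (simp add: PW)
  then have "Pi \<sigma> z *v W = 0" by (rule skew_null_zero[OF zX nV \<sigma>])
  then show False using W1 by (simp add: PW)
qed

lemma skew_scale: "skew (r *\<^sub>R a) b = r *\<^sub>R skew a b"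
  by (simp add: skew_def vec_eq_iff matrix_vector_mult_scaleR algebra_simps)

text \<open>By compactness: failure for every \<open>1 / real (Suc k)\<close> in place of
  \<open>a\<close>, after normalizing the vectors, is the situation excluded by
  \<open>N_lower_sequence\<close>.\<close>

lemma N_lower:
  assumes K: "compactin X K" and \<sigma>: "\<sigma> \<in> {1, -1}"
  obtains a where "0 < a" "\<forall>x\<in>K. \<forall>v \<nu>. neutral (Pi 1 x) (Pi (-1) x) \<nu> \<longrightarrow>
     a * norm (Pi \<sigma> x *v v) \<le> N x (skew (Pi \<sigma> x *v v) \<nu>)"
proof (rule ccontr)
  assume no: "\<not> thesis"
  have "\<exists>p. fst p \<in> K \<and> neutral (Pi 1 (fst p)) (Pi (-1) (fst p)) (snd (snd p)) \<and> norm (fst (snd p)) = 1 \<and>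
      Pi \<sigma> (fst p) *v fst (snd p) = fst (snd p) \<and> N (fst p) (skew (fst (snd p)) (snd (snd p))) \<le> 1 / real (Suc k)" for k
  proof -
    have "\<not> (\<forall>x\<in>K. \<forall>v \<nu>. neutral (Pi 1 x) (Pi (-1) x) \<nu> \<longrightarrow>
       (1 / real (Suc k)) * norm (Pi \<sigma> x *v v) \<le> N x (skew (Pi \<sigma> x *v v) \<nu>))"
    proof
      assume h: "\<forall>x\<in>K. \<forall>v \<nu>. neutral (Pi 1 x) (Pi (-1) x) \<nu> \<longrightarrow>
       (1 / real (Suc k)) * norm (Pi \<sigma> x *v v) \<le> N x (skew (Pi \<sigma> x *v v) \<nu>)"
      have "thesis" by (rule that[OF _ h]) simp
      with no show False ..
    qed
    then obtain x v \<nu> where x: "x \<in> K" and n: "neutral (Pi 1 x) (Pi (-1) x) \<nu>"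
      and lt: "N x (skew (Pi \<sigma> x *v v) \<nu>) < (1 / real (Suc k)) * norm (Pi \<sigma> x *v v)"
      by (auto simp: not_le)
    have xX: "x \<in> topspace X" using compactin_subset_topspace[OF K] x by blast
    define w where "w = Pi \<sigma> x *v v"
    have wg: "skew w \<nu> \<in> lie_algebra (carrier G0)" unfolding w_def by (rule skew_Pi_lie(1)[OF xX n \<sigma>])
    have "w \<noteq> 0" using lt euclidean_norm_mod_nonneg[OF N_norm[OF xX] subspace_g0 wg] by (auto simp: w_def[symmetric])
    define w' where "w' = (1 / norm w) *\<^sub>R w"
    have "norm w' = 1" using \<open>w \<noteq> 0\<close> by (simp add: w'_def)
    moreover have "Pi \<sigma> x *v w' = w'" by (simp add: w'_def w_def matrix_vector_mult_scaleR Pi_Pi[OF xX \<sigma>])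
    moreover have "N x (skew w' \<nu>) \<le> 1 / real (Suc k)"
    proof -
      have "N x (skew w' \<nu>) = (1 / norm w) * N x (skew w \<nu>)"
        unfolding w'_def skew_scale by (subst euclidean_norm_mod_scale[OF N_norm[OF xX] subspace_g0 wg]) simp
      also have "\<dots> \<le> (1 / norm w) * ((1 / real (Suc k)) * norm w)"
        using lt unfolding w_def[symmetric] by (intro mult_left_mono) auto
      also have "\<dots> = 1 / real (Suc k)" using \<open>w \<noteq> 0\<close> by simp
      finally show ?thesis .
    qed
    ultimately show ?thesis using x n by (intro exI[of _ "(x, w', \<nu>)"]) simp
  qed
  then obtain p where p: "\<And>k. fst (p k) \<in> K \<and> neutral (Pi 1 (fst (p k))) (Pi (-1) (fst (p k))) (snd (snd (p k))) \<and>
      norm (fst (snd (p k))) = 1 \<and> Pi \<sigma> (fst (p k)) *v fst (snd (p k)) = fst (snd (p k)) \<and>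
      N (fst (p k)) (skew (fst (snd (p k))) (snd (snd (p k)))) \<le> 1 / real (Suc k)" by metis
  show False
    by (rule N_lower_sequence[OF K \<sigma>, of "\<lambda>k. fst (p k)" "\<lambda>k. snd (snd (p k))" "\<lambda>k. fst (snd (p k))"])
      (use p in simp_all)
qed

text \<open>Pass from \<open>w\<close> to the tangent vector \<open>skew w \<nu>\<close>, compare at
  \<open>y'\<close>, translate by \<open>g\<close>, use the decay along the flow from
  \<open>y\<close>, and return to vectors. \<open>N_lower\<close> and \<open>N_upper\<close> make
  both changes of norm uniform over \<open>K\<close>.\<close>

lemma contraction:
  assumes K: "compactin X K"
  obtains A where "1 \<le> A" "\<forall>\<sigma>\<in>{1, -1}. \<forall>y\<in>K. \<forall>y'\<in>K. \<forall>g\<in>carrier \<Gamma>. \<forall>T v. flow T y = act g y' \<longrightarrow> 0 \<le> \<sigma> * T \<longrightarrow>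
     norm (\<rho> (inv g) *v (Pi \<sigma> y *v v)) \<le> A * exp (- c * \<bar>T\<bar>) * norm (Pi \<sigma> y *v v)"
proof -
  have KX: "K \<subseteq> topspace X" by (rule compactin_subset_topspace[OF K])
  obtain b where b: "1 \<le> b" "\<forall>x\<in>K. \<forall>\<sigma>\<in>{1, -1}. norm (Pi \<sigma> x) \<le> b" using Pi_bounded[OF K] .
  obtain B where B: "0 \<le> B" "\<forall>x\<in>K. \<forall>Y\<in>lie_algebra (carrier G0). N x Y \<le> B * norm Y" using N_upper[OF K] .
  obtain a1 where a1: "0 < a1" "\<forall>x\<in>K. \<forall>v \<nu>. neutral (Pi 1 x) (Pi (-1) x) \<nu> \<longrightarrow>
     a1 * norm (Pi 1 x *v v) \<le> N x (skew (Pi 1 x *v v) \<nu>)" by (rule N_lower[OF K, of 1]) simp_all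
  obtain a2 where a2: "0 < a2" "\<forall>x\<in>K. \<forall>v \<nu>. neutral (Pi 1 x) (Pi (-1) x) \<nu> \<longrightarrow>
     a2 * norm (Pi (-1) x *v v) \<le> N x (skew (Pi (-1) x *v v) \<nu>)" by (rule N_lower[OF K, of "-1"]) simp_all
  define a where "a = min a1 a2"
  have a: "0 < a" using a1 a2 by (simp add: a_def)
  have low: "a * norm (Pi \<sigma> x *v v) \<le> N x (skew (Pi \<sigma> x *v v) \<nu>)"
    if "\<sigma> \<in> {1, -1}" "x \<in> K" "neutral (Pi 1 x) (Pi (-1) x) \<nu>" for \<sigma> x v \<nu>
  proof -
    have "a * norm (Pi 1 x *v v) \<le> a1 * norm (Pi 1 x *v v)" "a * norm (Pi (-1) x *v v) \<le> a2 * norm (Pi (-1) x *v v)"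
      by (simp_all add: a_def mult_right_mono)
    then show ?thesis using that a1(2)[rule_format, OF that(2,3), of v] a2(2)[rule_format, OF that(2,3), of v]
      by (elim insertE) auto
  qed
  obtain k where k: "0 < k" "\<forall>a b :: 'n dvec. norm (skew a b) \<le> norm a * norm b * k" using norm_skew_le by blast
  \<comment> \<open>\<open>C\<close> comes from the flow, \<open>B\<close> and \<open>a\<close> from
    the comparison of norms, \<open>2 * b + 2\<close> from \<nu>, and \<open>k\<close> from the
    bilinear map \<open>skew\<close>.\<close>
  define A where "A = max 1 (C * (B * ((2 * b + 2) * k)) / a)"
  show thesis
  proof (rule that[of A], simp add: A_def, intro ballI allI impI)
    fix \<sigma> y y' g T v
    assume \<sigma>: "\<sigma> \<in> {1, -1 :: real}" and y: "y \<in> K" and y': "y' \<in> K" and g: "g \<in> carrier \<Gamma>"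
      and E: "flow T y = act g y'" and T: "0 \<le> \<sigma> * T"
    have yX: "y \<in> topspace X" "y' \<in> topspace X" using y y' KX by auto
    obtain h where h: "frame h y" using frame_ex[OF yX(1)] by blast
    obtain \<nu> where n: "neutral (Pi 1 y) (Pi (-1) y) \<nu>" using neutral_frame[OF yX(1) h] by blast
    have \<nu>: "norm \<nu> \<le> 2 * b + 2" by (rule neutral_norm_le[OF _ _ b(1) n]) (use b(2) y in auto)
    have gi: "inv g \<in> carrier \<Gamma>" using g by simp
    have rr: "\<rho> g *v (\<rho> (inv g) *v z) = z" for z using rho_G0[OF g] by (simp add: rho_inv[OF g])
    let ?w = "Pi \<sigma> y *v v"
    have P': "Pi \<tau> y *v (\<rho> g *v z) = \<rho> g *v (Pi \<tau> y' *v z)" if "\<tau> \<in> {1, -1}" for \<tau> z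
      using Pi_act[OF g yX(2) that, of z] Pi_flow[of \<tau> T y] by (simp add: E)
    have w': "\<rho> (inv g) *v ?w = Pi \<sigma> y' *v (\<rho> (inv g) *v v)"
    proof -
      have "\<rho> (inv g) *v ?w = \<rho> (inv g) *v (\<rho> g *v (Pi \<sigma> y' *v (\<rho> (inv g) *v v)))"
        using P'[OF \<sigma>, of "\<rho> (inv g) *v v"] by (simp add: rr)
      then show ?thesis using rho_G0[OF g] by (simp add: rho_inv[OF g])
    qed
    have n': "neutral (Pi 1 y') (Pi (-1) y') (\<rho> (inv g) *v \<nu>)"
    proof (rule neutral_transport[OF n, of _ "\<rho> g"])
      show "nnform (\<rho> (inv g) *v u) (\<rho> (inv g) *v z) = nnform u z" for u z by (rule nnform_G0[OF rho_G0[OF gi]])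
      show "\<rho> (inv g) *v e2n = e2n" by (rule G0_e2n[OF rho_G0[OF gi]])
      have P'': "Pi \<tau> y' *v (\<rho> (inv g) *v z) = \<rho> (inv g) *v (Pi \<tau> y *v z)" if "\<tau> \<in> {1, -1}" for \<tau> z
        using P'[OF that, of "\<rho> (inv g) *v z"] rho_G0[OF g] by (simp add: rr) (simp add: rho_inv[OF g])
      show "Pi 1 y' *v (\<rho> (inv g) *v z) = \<rho> (inv g) *v (Pi 1 y *v z)"
        "Pi (-1) y' *v (\<rho> (inv g) *v z) = \<rho> (inv g) *v (Pi (-1) y *v z)" for z
        by (rule P'', simp)+
    qed (use rho_G0[OF g] in \<open>simp add: rho_inv[OF g]\<close>)
    have lie: "skew ?w \<nu> \<in> lie_algebra (carrier G0)" "skew ?w \<nu> \<in> lie_algebra (coset_stab G0 (xi \<sigma> (end_pt \<sigma> y)))"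
      by (rule skew_Pi_lie[OF yX(1) n \<sigma>])+
    have sT: "\<sigma> * (\<sigma> * T) = T" "\<sigma> * T = \<bar>T\<bar>" using \<sigma> T by auto
    have lie': "skew (\<rho> (inv g) *v ?w) (\<rho> (inv g) *v \<nu>) \<in> lie_algebra (carrier G0)"
      unfolding w' by (rule skew_Pi_lie(1)[OF yX(2) n' \<sigma>])
    have conj: "\<rho> g ** skew (\<rho> (inv g) *v ?w) (\<rho> (inv g) *v \<nu>) ** matrix_inv (\<rho> g) = skew ?w \<nu>"
      unfolding skew_conj[OF rho_G0[OF g]] rr ..
    have "a * norm (\<rho> (inv g) *v ?w) \<le> N y' (skew (\<rho> (inv g) *v ?w) (\<rho> (inv g) *v \<nu>))"
      unfolding w' by (rule low[OF \<sigma> y' n'])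
    also have "\<dots> = N (act g y') (skew ?w \<nu>)"
      unfolding N_equiv[OF g yX(2) lie', symmetric] conj ..
    also have "\<dots> = N (flow (\<sigma> * (\<sigma> * T)) y) (skew ?w \<nu>)" by (simp only: E sT(1))
    also have "\<dots> \<le> C * exp (- c * (\<sigma> * T)) * N y (skew ?w \<nu>)"
      by (rule N_contr[OF \<sigma> yX(1) lie(2) T])
    also have "\<dots> \<le> C * exp (- c * \<bar>T\<bar>) * (B * (norm ?w * (2 * b + 2) * k))"
    proof -
      have "N y (skew ?w \<nu>) \<le> B * norm (skew ?w \<nu>)" using B(2) y lie(1) by blast
      also have "\<dots> \<le> B * (norm ?w * norm \<nu> * k)" using k(2) B(1) by (intro mult_left_mono) auto
      also have "\<dots> \<le> B * (norm ?w * (2 * b + 2) * k)"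
        using \<nu> k(1) B(1) by (intro mult_left_mono mult_right_mono) auto
      finally show ?thesis unfolding sT(2) using pos by (intro mult_left_mono) auto
    qed
    finally have "a * norm (\<rho> (inv g) *v ?w) \<le> C * exp (- c * \<bar>T\<bar>) * (B * (norm ?w * (2 * b + 2) * k))" .
    then have "norm (\<rho> (inv g) *v ?w) \<le> (C * exp (- c * \<bar>T\<bar>) * (B * (norm ?w * (2 * b + 2) * k))) / a"
      using a by (simp add: pos_le_divide_eq mult.commute)
    also have "\<dots> = (C * (B * ((2 * b + 2) * k)) / a) * (exp (- c * \<bar>T\<bar>) * norm ?w)" by (simp add: mult_ac)
    also have "\<dots> \<le> A * (exp (- c * \<bar>T\<bar>) * norm ?w)" unfolding A_def by (intro mult_right_mono) auto
    finally show "norm (\<rho> (inv g) *v ?w) \<le> A * exp (- c * \<bar>T\<bar>) * norm ?w" by (simp only: mult.assoc)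
  qed
qed

end

section \<open>Hyperbolic groups\<close>

locale hyperbolic_group = group \<Gamma> for \<Gamma> :: "('g, 'm) monoid_scheme" (structure) +
  fixes S :: "'g set" and \<delta> :: real
  assumes fin_S: "finite S" and S_carrier: "S \<subseteq> carrier \<Gamma>" and gen_S: "generate \<Gamma> S = carrier \<Gamma>"
    and four_point: "\<lbrakk>x \<in> carrier \<Gamma>; y \<in> carrier \<Gamma>; z \<in> carrier \<Gamma>\<rbrakk> \<Longrightarrow>
      min (gromov_prod \<Gamma> S \<one> x y) (gromov_prod \<Gamma> S \<one> y z) - \<delta> \<le> gromov_prod \<Gamma> S \<one> x z"
begin

section \<open>Words and their length\<close>

abbreviation len :: "'g \<Rightarrow> nat" where "len \<equiv> word_length \<Gamma> S"
abbreviation letters :: "'g set" where "letters \<equiv> S \<union> m_inv \<Gamma> ` S"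
abbreviation eval_word :: "'g list \<Rightarrow> 'g" where "eval_word ws \<equiv> foldr (\<otimes>) ws \<one>"
abbreviation gp :: "'g \<Rightarrow> 'g \<Rightarrow> real" where "gp \<equiv> gromov_prod \<Gamma> S \<one>"

lemma letters_carrier: "letters \<subseteq> carrier \<Gamma>"
  using S_carrier by auto

lemma eval_word_closed: "set ws \<subseteq> letters \<Longrightarrow> eval_word ws \<in> carrier \<Gamma>"
proof (induction ws)
  case (Cons w ws)
  then have "w \<in> carrier \<Gamma>" using letters_carrier by auto
  then show ?case using Cons by simp
qed simp

lemma eval_word_append:
  "set ws \<subseteq> letters \<Longrightarrow> set vs \<subseteq> letters \<Longrightarrow> eval_word (ws @ vs) = eval_word ws \<otimes> eval_word vs"
proof (induction ws)
  case Nil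
  then show ?case using eval_word_closed by simp
next
  case (Cons w ws)
  then have "w \<in> carrier \<Gamma>" using letters_carrier by auto
  then show ?case using Cons eval_word_closed[of ws] eval_word_closed[of vs] by (simp add: m_assoc)
qed

lemma letters_inv: "w \<in> letters \<Longrightarrow> inv w \<in> letters"
proof -
  assume "w \<in> letters"
  then consider "w \<in> S" | s where "s \<in> S" "w = inv s" by auto
  then show ?thesis
  proof cases
    case 1 then show ?thesis by simp
  next
    case 2
    then have "inv w = s" using S_carrier by auto
    then show ?thesis using 2 by simp
  qed
qed

lemma eval_word_inv:
  "set ws \<subseteq> letters \<Longrightarrow> eval_word (rev (map (m_inv \<Gamma>) ws)) = inv (eval_word ws)"
proof (induction ws)
  case (Cons w ws)
  have w: "w \<in> letters" "w \<in> carrier \<Gamma>" "set ws \<subseteq> letters" using Cons.prems letters_carrier by auto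
  have ws': "set (rev (map (m_inv \<Gamma>) ws)) \<subseteq> letters" using w(3) letters_inv by auto
  have "eval_word (rev (map (m_inv \<Gamma>) (w # ws))) = eval_word (rev (map (m_inv \<Gamma>) ws)) \<otimes> eval_word [inv w]"
    using eval_word_append[OF ws', of "[inv w]"] letters_inv[OF w(1)] by simp
  also have "\<dots> = inv (eval_word ws) \<otimes> inv w" using Cons.IH[OF w(3)] w by simp
  also have "\<dots> = inv (eval_word (w # ws))" using w eval_word_closed[OF w(3)] by (simp add: inv_mult_group)
  finally show ?case .
qed simp

lemma word_ex: "g \<in> carrier \<Gamma> \<Longrightarrow> \<exists>ws. set ws \<subseteq> letters \<and> eval_word ws = g"
proof -
  assume "g \<in> carrier \<Gamma>"
  then have "g \<in> generate \<Gamma> S" using gen_S by simp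
  then show ?thesis
  proof (induction rule: generate.induct)
    case one then show ?case by (intro exI[of _ "[]"]) simp
  next
    case (incl h) then show ?case using S_carrier by (intro exI[of _ "[h]"]) auto
  next
    case (inv h) then show ?case using S_carrier by (intro exI[of _ "[inv h]"]) auto
  next
    case (eng h1 h2)
    then obtain ws vs where "set ws \<subseteq> letters" "eval_word ws = h1" "set vs \<subseteq> letters" "eval_word vs = h2" by blast
    then show ?case using eval_word_append[of ws vs] by (intro exI[of _ "ws @ vs"]) simp
  qed
qed

lemma geodesic_word:
  assumes "g \<in> carrier \<Gamma>"
  obtains ws where "length ws = len g" "set ws \<subseteq> letters" "eval_word ws = g"
proof -
  have "\<exists>k ws. length ws = k \<and> set ws \<subseteq> letters \<and> eval_word ws = g" using word_ex[OF assms] by blast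
  from LeastI_ex[OF this] show thesis using that unfolding word_length_def by blast
qed

lemma len_le: "set ws \<subseteq> letters \<Longrightarrow> len (eval_word ws) \<le> length ws"
  unfolding word_length_def by (rule Least_le) blast

lemma len_one [simp]: "len \<one> = 0"
  using len_le[of "[]"] by simp

lemma len_mult: "g \<in> carrier \<Gamma> \<Longrightarrow> h \<in> carrier \<Gamma> \<Longrightarrow> len (g \<otimes> h) \<le> len g + len h"
proof -
  assume g: "g \<in> carrier \<Gamma>" and h: "h \<in> carrier \<Gamma>"
  obtain ws where ws: "length ws = len g" "set ws \<subseteq> letters" "eval_word ws = g" by (rule geodesic_word[OF g])
  obtain vs where vs: "length vs = len h" "set vs \<subseteq> letters" "eval_word vs = h" by (rule geodesic_word[OF h])
  show ?thesis using len_le[of "ws @ vs"] ws vs by (simp add: eval_word_append del: foldr_append)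
qed

lemma len_inv: "g \<in> carrier \<Gamma> \<Longrightarrow> len (inv g) = len g"
proof -
  have le: "len (inv h) \<le> len h" if h: "h \<in> carrier \<Gamma>" for h
  proof -
    obtain ws where ws: "length ws = len h" "set ws \<subseteq> letters" "eval_word ws = h" by (rule geodesic_word[OF h])
    have "set (rev (map (m_inv \<Gamma>) ws)) \<subseteq> letters" using ws(2) letters_inv by auto
    from len_le[OF this] show ?thesis unfolding eval_word_inv[OF ws(2)] ws(3) using ws(1) by simp
  qed
  assume "g \<in> carrier \<Gamma>"
  then show ?thesis using le[of g] le[of "inv g"] by simp
qed

lemma finite_len_ball: "finite {g \<in> carrier \<Gamma>. len g \<le> k}"
proof (rule finite_subset)
  show "{g \<in> carrier \<Gamma>. len g \<le> k} \<subseteq> eval_word ` {ws. set ws \<subseteq> letters \<and> length ws \<le> k}"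
  proof
    fix g assume "g \<in> {g \<in> carrier \<Gamma>. len g \<le> k}"
    then have g: "g \<in> carrier \<Gamma>" "len g \<le> k" by auto
    obtain ws where "length ws = len g" "set ws \<subseteq> letters" "eval_word ws = g" by (rule geodesic_word[OF g(1)])
    then show "g \<in> eval_word ` {ws. set ws \<subseteq> letters \<and> length ws \<le> k}" using g(2) by (intro image_eqI[of _ _ ws]) simp_all
  qed
  have "finite letters" using fin_S by simp
  then show "finite (eval_word ` {ws. set ws \<subseteq> letters \<and> length ws \<le> k})" by (intro finite_imageI finite_lists_length_le)
qed

text \<open>Take the first \<open>k\<close> letters of a geodesic word; the two inequalities place
  \<open>z\<close> on a geodesic from the identity to \<open>g\<close>.\<close>

lemma prefix_ex:
  assumes g: "g \<in> carrier \<Gamma>" and k: "k \<le> len g"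
  shows "\<exists>z. z \<in> carrier \<Gamma> \<and> len z \<le> k \<and> len (inv z \<otimes> g) + k \<le> len g"
proof -
  obtain ws where ws: "length ws = len g" "set ws \<subseteq> letters" "eval_word ws = g" by (rule geodesic_word[OF g])
  have s: "set (take k ws) \<subseteq> letters" "set (drop k ws) \<subseteq> letters"
    using ws(2) set_take_subset[of k ws] set_drop_subset[of k ws] by blast+
  let ?z = "eval_word (take k ws)"
  have z: "?z \<in> carrier \<Gamma>" "eval_word (drop k ws) \<in> carrier \<Gamma>" using eval_word_closed s by blast+
  have "g = ?z \<otimes> eval_word (drop k ws)"
    using eval_word_append[OF s] ws(3) by (simp only: append_take_drop_id)
  then have "inv ?z \<otimes> g = eval_word (drop k ws)" using z by (simp add: m_assoc[symmetric])
  then have "len (inv ?z \<otimes> g) \<le> len g - k" using len_le[OF s(2)] ws(1) by simp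
  moreover have "len ?z \<le> k" using len_le[OF s(1)] ws(1) k by simp
  ultimately show ?thesis using z k by (intro exI[of _ ?z]) simp
qed

section \<open>The Gromov product at the identity\<close>

lemma gp_eq: "x \<in> carrier \<Gamma> \<Longrightarrow> y \<in> carrier \<Gamma> \<Longrightarrow> gp x y = (real (len x) + real (len y) - real (len (inv x \<otimes> y))) / 2"
  by (simp add: gromov_prod_def word_dist_def)

lemma len_quotient_sym: "x \<in> carrier \<Gamma> \<Longrightarrow> y \<in> carrier \<Gamma> \<Longrightarrow> len (inv x \<otimes> y) = len (inv y \<otimes> x)"
  using len_inv[of "inv x \<otimes> y"] by (simp add: inv_mult_group)

lemma gp_sym: "x \<in> carrier \<Gamma> \<Longrightarrow> y \<in> carrier \<Gamma> \<Longrightarrow> gp x y = gp y x"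
  by (simp add: gp_eq len_quotient_sym[of x y])

lemma gp_le_len: "x \<in> carrier \<Gamma> \<Longrightarrow> y \<in> carrier \<Gamma> \<Longrightarrow> gp x y \<le> real (len x)"
proof -
  assume x: "x \<in> carrier \<Gamma>" and y: "y \<in> carrier \<Gamma>"
  have "len (x \<otimes> (inv x \<otimes> y)) \<le> len x + len (inv x \<otimes> y)" using x y by (intro len_mult) auto
  then have "len y \<le> len x + len (inv x \<otimes> y)" using x y by (simp add: m_assoc[symmetric])
  then show ?thesis using x y by (simp add: gp_eq)
qed

text \<open>The product of \<open>x\<close> and \<open>inv g\<close> at the identity is that of
  \<open>g \<otimes> x\<close> and the identity at base point \<open>g\<close>. Hence an end
  avoiding the direction of \<open>inv g\<close> is translated by a large \<open>g\<close> close to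
  the direction of \<open>g\<close>.\<close>

lemma gp_translate_sum:
  assumes "g \<in> carrier \<Gamma>" "x \<in> carrier \<Gamma>"
  shows "gp (g \<otimes> x) g + gp x (inv g) = real (len g)"
proof -
  have "len (inv (g \<otimes> x) \<otimes> g) = len x"
    using assms len_inv[of x] by (simp add: inv_mult_group m_assoc)
  moreover have "len (inv x \<otimes> inv g) = len (g \<otimes> x)"
    using assms len_inv[of "g \<otimes> x"] by (simp add: inv_mult_group)
  ultimately show ?thesis using assms by (simp add: gp_eq len_inv field_simps)
qed

lemma gp_translate:
  assumes "g \<in> carrier \<Gamma>" "x \<in> carrier \<Gamma>" "y \<in> carrier \<Gamma>"
  shows "gp x y - real (len g) \<le> gp (g \<otimes> x) (g \<otimes> y)"
proof -
  have le: "real (len z) - real (len g) \<le> real (len (g \<otimes> z))" if "z \<in> carrier \<Gamma>" for z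
  proof -
    have "len (inv g \<otimes> (g \<otimes> z)) \<le> len (inv g) + len (g \<otimes> z)" using assms that by (intro len_mult) auto
    then show ?thesis using assms that by (simp add: m_assoc[symmetric] len_inv)
  qed
  have "inv (g \<otimes> x) \<otimes> (g \<otimes> y) = inv x \<otimes> ((inv g \<otimes> g) \<otimes> y)"
    using assms by (simp only: inv_mult_group m_assoc inv_closed m_closed)
  then have "inv (g \<otimes> x) \<otimes> (g \<otimes> y) = inv x \<otimes> y" using assms by simp
  then show ?thesis using le[of x] le[of y] assms by (simp add: gp_eq field_simps)
qed

section \<open>Boundary points and the action on them\<close>

lemma seqs_carrier: "x \<in> gromov_seqs \<Gamma> S \<Longrightarrow> x i \<in> carrier \<Gamma>"
  by (auto simp: gromov_seqs_def)

lemma same_end_sym: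
  assumes "x \<in> gromov_seqs \<Gamma> S" "y \<in> gromov_seqs \<Gamma> S" "same_end \<Gamma> S x y"
  shows "same_end \<Gamma> S y x"
  unfolding same_end_def
proof
  fix r
  obtain N where N: "\<And>i j. i \<ge> N \<Longrightarrow> j \<ge> N \<Longrightarrow> r \<le> gp (x i) (y j)" using assms(3) unfolding same_end_def by blast
  show "\<exists>N. \<forall>i\<ge>N. \<forall>j\<ge>N. r \<le> gp (y i) (x j)"
    using N gp_sym seqs_carrier assms by (intro exI[of _ N]) auto
qed

lemma same_end_trans:
  assumes "x \<in> gromov_seqs \<Gamma> S" "y \<in> gromov_seqs \<Gamma> S" "z \<in> gromov_seqs \<Gamma> S"
    "same_end \<Gamma> S x y" "same_end \<Gamma> S y z"
  shows "same_end \<Gamma> S x z"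
  unfolding same_end_def
proof
  fix r
  obtain N where N: "\<And>i j. i \<ge> N \<Longrightarrow> j \<ge> N \<Longrightarrow> r + \<delta> \<le> gp (x i) (y j)" using assms(4) unfolding same_end_def by blast
  obtain N' where N': "\<And>i j. i \<ge> N' \<Longrightarrow> j \<ge> N' \<Longrightarrow> r + \<delta> \<le> gp (y i) (z j)" using assms(5) unfolding same_end_def by blast
  show "\<exists>N. \<forall>i\<ge>N. \<forall>j\<ge>N. r \<le> gp (x i) (z j)"
  proof (intro exI[of _ "max N N'"] allI impI)
    fix i j assume "max N N' \<le> i" "max N N' \<le> j"
    then show "r \<le> gp (x i) (z j)"
      using N[of i "max N N'"] N'[of "max N N'" j] four_point[of "x i" "y (max N N')" "z j"] assms seqs_carrier by fastforce
  qed
qed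

lemma end_class_eq_iff:
  assumes x: "x \<in> gromov_seqs \<Gamma> S" and y: "y \<in> gromov_seqs \<Gamma> S"
  shows "end_class \<Gamma> S x = end_class \<Gamma> S y \<longleftrightarrow> same_end \<Gamma> S x y"
proof
  assume eq: "end_class \<Gamma> S x = end_class \<Gamma> S y"
  have "y \<in> end_class \<Gamma> S x" unfolding eq using y by (simp add: end_class_def gromov_seqs_def)
  then show "same_end \<Gamma> S x y" by (simp add: end_class_def)
next
  assume s: "same_end \<Gamma> S x y"
  show "end_class \<Gamma> S x = end_class \<Gamma> S y"
  proof (intro equalityI subsetI)
    fix z assume "z \<in> end_class \<Gamma> S x"
    then show "z \<in> end_class \<Gamma> S y"
      using same_end_trans[OF y x _ same_end_sym[OF x y s]] by (simp add: end_class_def)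
  next
    fix z assume "z \<in> end_class \<Gamma> S y"
    then show "z \<in> end_class \<Gamma> S x" using same_end_trans[OF x y _ s] by (simp add: end_class_def)
  qed
qed

lemma end_class_self: "x \<in> gromov_seqs \<Gamma> S \<Longrightarrow> x \<in> end_class \<Gamma> S x"
  by (simp add: end_class_def gromov_seqs_def)

lemma end_class_boundary: "x \<in> gromov_seqs \<Gamma> S \<Longrightarrow> end_class \<Gamma> S x \<in> boundary \<Gamma> S"
  by (simp add: boundary_def)

lemma same_end_translate:
  assumes "g \<in> carrier \<Gamma>" "\<And>i. x i \<in> carrier \<Gamma>" "\<And>i. y i \<in> carrier \<Gamma>" "same_end \<Gamma> S x y"
  shows "same_end \<Gamma> S (\<lambda>i. g \<otimes> x i) (\<lambda>i. g \<otimes> y i)"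
  unfolding same_end_def
proof
  fix r
  obtain N where N: "\<And>i j. i \<ge> N \<Longrightarrow> j \<ge> N \<Longrightarrow> r + real (len g) \<le> gp (x i) (y j)" using assms(4) unfolding same_end_def by blast
  show "\<exists>N. \<forall>i\<ge>N. \<forall>j\<ge>N. r \<le> gp (g \<otimes> x i) (g \<otimes> y j)"
  proof (intro exI[of _ N] allI impI)
    fix i j assume "N \<le> i" "N \<le> j"
    then show "r \<le> gp (g \<otimes> x i) (g \<otimes> y j)"
      using N[of i j] gp_translate[OF assms(1), of "x i" "y j"] assms by auto
  qed
qed

lemma seqs_translate: "g \<in> carrier \<Gamma> \<Longrightarrow> x \<in> gromov_seqs \<Gamma> S \<Longrightarrow> (\<lambda>i. g \<otimes> x i) \<in> gromov_seqs \<Gamma> S"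
  using same_end_translate[of g x x] by (auto simp: gromov_seqs_def)

lemma boundary_act_end_class:
  assumes g: "g \<in> carrier \<Gamma>" and x: "x \<in> gromov_seqs \<Gamma> S"
  shows "boundary_act \<Gamma> g (end_class \<Gamma> S x) = end_class \<Gamma> S (\<lambda>i. g \<otimes> x i)"
proof
  show "boundary_act \<Gamma> g (end_class \<Gamma> S x) \<subseteq> end_class \<Gamma> S (\<lambda>i. g \<otimes> x i)"
    using seqs_translate[OF g] same_end_translate[OF g] x seqs_carrier
    by (auto simp: boundary_act_def end_class_def)
  show "end_class \<Gamma> S (\<lambda>i. g \<otimes> x i) \<subseteq> boundary_act \<Gamma> g (end_class \<Gamma> S x)"
  proof
    fix y assume "y \<in> end_class \<Gamma> S (\<lambda>i. g \<otimes> x i)"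
    then have y: "y \<in> gromov_seqs \<Gamma> S" "same_end \<Gamma> S (\<lambda>i. g \<otimes> x i) y" by (simp_all add: end_class_def)
    have gi: "inv g \<in> carrier \<Gamma>" using g by simp
    define z where "z i = inv g \<otimes> y i" for i
    have z: "z \<in> gromov_seqs \<Gamma> S" unfolding z_def[abs_def] by (rule seqs_translate[OF gi y(1)])
    have "same_end \<Gamma> S (\<lambda>i. inv g \<otimes> (g \<otimes> x i)) z"
      unfolding z_def[abs_def] using seqs_carrier[OF x] seqs_carrier[OF y(1)] g
      by (intro same_end_translate[OF gi _ _ y(2)]) auto
    moreover have "(\<lambda>i. inv g \<otimes> (g \<otimes> x i)) = x" using seqs_carrier[OF x] g by (simp add: m_assoc[symmetric])
    ultimately have "z \<in> end_class \<Gamma> S x" using z by (simp add: end_class_def)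
    moreover have "y = (\<lambda>i. g \<otimes> z i)" using seqs_carrier[OF y(1)] g by (simp add: z_def m_assoc[symmetric])
    ultimately show "y \<in> boundary_act \<Gamma> g (end_class \<Gamma> S x)" unfolding boundary_act_def by blast
  qed
qed

section \<open>Compactness at infinity\<close>

text \<open>For each \<open>n\<close> there are finitely many geodesic prefixes of length
  \<open>n\<close>, so a diagonal subsequence eventually has a constant prefix for every
  \<open>n\<close>. Two elements with a common prefix of length \<open>n\<close> have Gromov product
  at least \<open>n\<close>.\<close>

lemma convergent_subsequence:
  assumes g: "\<And>k. g k \<in> carrier \<Gamma>" and len: "\<And>k. k \<le> len (g k)"
  obtains r where "strict_mono r" "(g \<circ> r) \<in> gromov_seqs \<Gamma> S"
proof -
  define pre where "pre n h = (SOME z. z \<in> carrier \<Gamma> \<and> len z \<le> n \<and> len (inv z \<otimes> h) + n \<le> len h)" for n h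
  have pre: "pre n h \<in> carrier \<Gamma> \<and> len (pre n h) \<le> n \<and> len (inv (pre n h) \<otimes> h) + n \<le> len h"
    if "h \<in> carrier \<Gamma>" "n \<le> len h" for n h
    unfolding pre_def by (rule someI_ex[OF prefix_ex[OF that]])
  define P where "P n s \<longleftrightarrow> (\<exists>z. \<forall>k. n \<le> len (g (s k)) \<longrightarrow> pre n (g (s k)) = z)" for n and s :: "nat \<Rightarrow> nat"
  interpret subseqs P
  proof
    fix n and s :: "nat \<Rightarrow> nat" assume "strict_mono s"
    \<comment> \<open>An element shorter than \<open>n\<close> gets the identity as default prefix;
      \<open>P n\<close> says nothing about such elements.\<close>
    define f where "f k = (if n \<le> len (g (s k)) then pre n (g (s k)) else \<one>)" for k
    have "range f \<subseteq> {h \<in> carrier \<Gamma>. len h \<le> n}" using pre g by (auto simp: f_def)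
    then have "finite (range f)" using finite_len_ball finite_subset by blast
    then obtain k0 where "infinite {k \<in> UNIV. f k = f k0}"
      using pigeonhole_infinite[of "UNIV :: nat set" f] by auto
    then have "infinite {k. f k = f k0}" by simp
    then obtain r' where r': "strict_mono (r' :: nat \<Rightarrow> nat)" "\<And>k. r' k \<in> {k. f k = f k0}"
      using infinite_enumerate[of "{k. f k = f k0}"] by blast
    have "P n (s \<circ> r')" unfolding P_def
    proof (intro exI[of _ "f k0"] allI impI)
      fix k assume "n \<le> len (g ((s \<circ> r') k))"
      then have "pre n (g ((s \<circ> r') k)) = f (r' k)" by (simp add: f_def)
      then show "pre n (g ((s \<circ> r') k)) = f k0" using r'(2)[of k] by simp
    qed
    then show "\<exists>r'. strict_mono r' \<and> P n (s \<circ> r')" using r'(1) by blast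
  qed
  have dP: "P k (diagseq \<circ> ((+) (Suc k)))" for k
  proof (rule diagseq_holds)
    fix r s :: "nat \<Rightarrow> nat" and n assume "P n s"
    then show "P n (s \<circ> r)" unfolding P_def by auto
  qed
  \<comment> \<open>\<open>Suc n\<close>, since \<open>P n\<close> holds for the diagonal sequence
    from that index on.\<close>
  have same: "real n \<le> gp (g (diagseq i)) (g (diagseq j))" if i: "Suc n \<le> i" and j: "Suc n \<le> j" for n i j
  proof -
    obtain z where z: "\<And>k. n \<le> len (g (diagseq (Suc n + k))) \<Longrightarrow> pre n (g (diagseq (Suc n + k))) = z"
      using dP[of n] unfolding P_def o_def by blast
    have big: "n \<le> len (g (diagseq k))" if "Suc n \<le> k" for k
    proof -
      have "k \<le> diagseq k" using subseq_diagseq by (rule strict_mono_imp_increasing)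
      also have "\<dots> \<le> len (g (diagseq k))" by (rule len)
      finally show ?thesis using that by simp
    qed
    have pz: "pre n (g (diagseq k)) = z" if "Suc n \<le> k" for k
      using z[of "k - Suc n"] big[OF that] that by simp
    let ?a = "g (diagseq i)" and ?b = "g (diagseq j)"
    have za: "z \<in> carrier \<Gamma>" "len (inv z \<otimes> ?a) + n \<le> len ?a" using pre[OF g big[OF i]] by (simp_all add: pz[OF i])
    have zb: "len (inv z \<otimes> ?b) + n \<le> len ?b" using pre[OF g big[OF j]] by (simp add: pz[OF j])
    have "inv ?a \<otimes> ?b = (inv ?a \<otimes> z) \<otimes> (inv z \<otimes> ?b)"
    proof -
      have "(inv ?a \<otimes> z) \<otimes> (inv z \<otimes> ?b) = inv ?a \<otimes> ((z \<otimes> inv z) \<otimes> ?b)"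
        using g za(1) by (simp only: m_assoc m_closed inv_closed)
      then show ?thesis using g za(1) by simp
    qed
    then have "len (inv ?a \<otimes> ?b) \<le> len (inv ?a \<otimes> z) + len (inv z \<otimes> ?b)"
      using len_mult[of "inv ?a \<otimes> z" "inv z \<otimes> ?b"] g za(1) by simp
    also have "len (inv ?a \<otimes> z) = len (inv z \<otimes> ?a)" using g za(1) by (intro len_quotient_sym) auto
    finally show ?thesis using za(2) zb g by (simp add: gp_eq)
  qed
  show thesis
  proof (rule that[OF subseq_diagseq])
    have "same_end \<Gamma> S (g \<circ> diagseq) (g \<circ> diagseq)" unfolding same_end_def
    proof
      fix r :: real
      obtain n :: nat where "r \<le> real n" using real_arch_simple by blast
      then show "\<exists>N. \<forall>i\<ge>N. \<forall>j\<ge>N. r \<le> gp ((g \<circ> diagseq) i) ((g \<circ> diagseq) j)"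
        using same[of n] by (intro exI[of _ "Suc n"]) (auto intro: order_trans)
    qed
    then show "g \<circ> diagseq \<in> gromov_seqs \<Gamma> S" using g by (auto simp: gromov_seqs_def)
  qed
qed

text \<open>The four-point condition is applied through \<open>g (r k)\<close>, which is close to
  the limit by convergence of the subsequence and close to the end \<open>p (r k)\<close> by
  \<open>near\<close>; since \<open>k \<le> r k\<close>, both products are large.\<close>

lemma limitin_boundary:
  assumes gs: "(\<lambda>k. g (r k)) \<in> gromov_seqs \<Gamma> S" and r: "strict_mono r"
    and x: "\<And>k. x k \<in> gromov_seqs \<Gamma> S" "\<And>k. p k = end_class \<Gamma> S (x k)"
    and near: "\<And>k j. i k \<le> j \<Longrightarrow> real k \<le> gp (g k) (x k j)"
  shows "limitin (boundary_topology \<Gamma> S) (\<lambda>k. p (r k)) (end_class \<Gamma> S (\<lambda>k. g (r k))) sequentially"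
  unfolding limitin_def
proof (intro conjI allI impI)
  let ?p = "end_class \<Gamma> S (\<lambda>k. g (r k))"
  show "?p \<in> topspace (boundary_topology \<Gamma> S)"
    by (simp add: topspace_boundary_topology end_class_boundary[OF gs])
  fix U assume "openin (boundary_topology \<Gamma> S) U \<and> ?p \<in> U"
  then have "\<exists>R. boundary_nbhd \<Gamma> S R ?p \<subseteq> U" by (simp add: openin_boundary_topology)
  then obtain R where R: "boundary_nbhd \<Gamma> S R ?p \<subseteq> U" ..
  obtain N where N: "\<And>i j. N \<le> i \<Longrightarrow> N \<le> j \<Longrightarrow> R + \<delta> \<le> gp (g (r i)) (g (r j))"
  proof -
    have "same_end \<Gamma> S (\<lambda>k. g (r k)) (\<lambda>k. g (r k))" using gs by (simp add: gromov_seqs_def)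
    then have "\<exists>N. \<forall>i\<ge>N. \<forall>j\<ge>N. R + \<delta> \<le> gp (g (r i)) (g (r j))" unfolding same_end_def by (rule spec)
    then show thesis using that by blast
  qed
  obtain N' :: nat where N': "R + \<delta> \<le> real N'" using real_arch_simple by blast
  have "p (r k) \<in> U" if k: "max N N' \<le> k" for k
  proof -
    have "p (r k) \<in> boundary_nbhd \<Gamma> S R ?p"
      unfolding boundary_nbhd_def
    proof (intro CollectI conjI bexI)
      show "p (r k) \<in> boundary \<Gamma> S" unfolding x(2) by (rule end_class_boundary[OF x(1)])
      show "(\<lambda>k. g (r k)) \<in> ?p" by (rule end_class_self[OF gs])
      show "x (r k) \<in> p (r k)" unfolding x(2) by (rule end_class_self[OF x(1)])
      show "\<exists>N. \<forall>i\<ge>N. \<forall>j\<ge>N. R \<le> gp (g (r i)) (x (r k) j)"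
      proof (intro exI[of _ "max N (i (r k))"] allI impI)
        fix a j assume a: "max N (i (r k)) \<le> a" and j: "max N (i (r k)) \<le> j"
        have "R + \<delta> \<le> gp (g (r a)) (g (r k))" using N[of a k] a k by simp
        moreover have "R + \<delta> \<le> gp (g (r k)) (x (r k) j)"
        proof -
          have "k \<le> r k" using r by (rule strict_mono_imp_increasing)
          then have "R + \<delta> \<le> real (r k)" using N' k by linarith
          also have "\<dots> \<le> gp (g (r k)) (x (r k) j)" using near[of "r k" j] j by simp
          finally show ?thesis .
        qed
        ultimately show "R \<le> gp (g (r a)) (x (r k) j)"
          using four_point[OF seqs_carrier[OF gs, of a] seqs_carrier[OF gs, of k] seqs_carrier[OF x(1), of "r k" j]]
          by linarith
      qed
    qed
    then show ?thesis by (rule subsetD[OF R])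
  qed
  then show "\<forall>\<^sub>F k in sequentially. p (r k) \<in> U" by (rule eventually_sequentiallyI)
qed


section \<open>Geodesics passing near the identity\<close>

text \<open>A bounded product means that geodesics joining the two ends pass within bounded distance
  of the identity. The time coordinate is frozen at 0, so compactness is a matter of the pairs
  alone.\<close>

definition near_pairs :: "real \<Rightarrow> 'g flow_pt set" where
  "near_pairs M = {((p, q), 0) | p q. \<exists>x\<in>gromov_seqs \<Gamma> S. \<exists>y\<in>gromov_seqs \<Gamma> S.
     p = end_class \<Gamma> S x \<and> q = end_class \<Gamma> S y \<and> (\<exists>N. \<forall>i\<ge>N. \<forall>j\<ge>N. gp (x i) (y j) \<le> M)}"

lemma not_same_end:
  assumes "\<forall>i\<ge>N. \<forall>j\<ge>N. gp (x i) (y j) \<le> M"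
  shows "\<not> same_end \<Gamma> S x y"
proof
  assume "same_end \<Gamma> S x y"
  then have "\<exists>N. \<forall>i\<ge>N. \<forall>j\<ge>N. M + 1 \<le> gp (x i) (y j)" unfolding same_end_def by (rule spec)
  then obtain N' where "\<forall>i\<ge>N'. \<forall>j\<ge>N'. M + 1 \<le> gp (x i) (y j)" ..
  then have "M + 1 \<le> gp (x (max N N')) (y (max N N'))" by simp
  moreover have "gp (x (max N N')) (y (max N N')) \<le> M" using assms by simp
  ultimately show False by simp
qed

lemma near_pair_topspace:
  assumes x: "x \<in> gromov_seqs \<Gamma> S" and y: "y \<in> gromov_seqs \<Gamma> S" and le: "\<forall>i\<ge>N. \<forall>j\<ge>N. gp (x i) (y j) \<le> M"
  shows "((end_class \<Gamma> S x, end_class \<Gamma> S y), t) \<in> topspace (flow_topology \<Gamma> S)"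
  using not_same_end[OF le] end_class_eq_iff[OF x y] end_class_boundary[OF x] end_class_boundary[OF y]
  by (simp add: topspace_flow_topology boundary_pairs_def)

text \<open>Far along the representatives of the \<open>k\<close>-th pair lie elements
  \<open>g k\<close> and \<open>h k\<close> whose products with their own ends are at least
  \<open>k\<close>. Subsequences of these converge at infinity, and the bound \<open>M\<close> on
  the product of \<open>g k\<close> and \<open>h k\<close> keeps the two limits apart.\<close>

lemma near_pairs_sequence:
  fixes s :: "nat \<Rightarrow> 'g flow_pt"
  assumes s: "range s \<subseteq> near_pairs M"
  shows "\<exists>l r. l \<in> topspace (flow_topology \<Gamma> S) \<and> strict_mono r \<and> limitin (flow_topology \<Gamma> S) (s \<circ> r) l sequentially"
proof -
  have "\<exists>w. fst w \<in> gromov_seqs \<Gamma> S \<and> snd w \<in> gromov_seqs \<Gamma> S \<and>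
      s k = ((end_class \<Gamma> S (fst w), end_class \<Gamma> S (snd w)), 0) \<and>
      (\<exists>N. \<forall>i\<ge>N. \<forall>j\<ge>N. gp (fst w i) (snd w j) \<le> M)" for k
  proof -
    have "s k \<in> near_pairs M" using s by blast
    then obtain p q x y where "s k = ((p, q), 0)" "x \<in> gromov_seqs \<Gamma> S" "y \<in> gromov_seqs \<Gamma> S"
      "p = end_class \<Gamma> S x" "q = end_class \<Gamma> S y" "\<exists>N. \<forall>i\<ge>N. \<forall>j\<ge>N. gp (x i) (y j) \<le> M"
      unfolding near_pairs_def by blast
    then show ?thesis by (intro exI[of _ "(x, y)"]) simp
  qed
  then obtain w where w: "\<And>k. fst (w k) \<in> gromov_seqs \<Gamma> S \<and> snd (w k) \<in> gromov_seqs \<Gamma> S \<and>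
      s k = ((end_class \<Gamma> S (fst (w k)), end_class \<Gamma> S (snd (w k))), 0) \<and>
      (\<exists>N. \<forall>i\<ge>N. \<forall>j\<ge>N. gp (fst (w k) i) (snd (w k) j) \<le> M)" by metis
  define x y where "x k = fst (w k)" and "y k = snd (w k)" for k
  have x: "x k \<in> gromov_seqs \<Gamma> S" and y: "y k \<in> gromov_seqs \<Gamma> S" and
    sk: "s k = ((end_class \<Gamma> S (x k), end_class \<Gamma> S (y k)), 0)" for k
    using w[of k] by (simp_all add: x_def y_def)
  have "\<exists>n. (\<forall>i\<ge>n. \<forall>j\<ge>n. gp (x k i) (y k j) \<le> M) \<and> (\<forall>i\<ge>n. \<forall>j\<ge>n. real k \<le> gp (x k i) (x k j)) \<and>
      (\<forall>i\<ge>n. \<forall>j\<ge>n. real k \<le> gp (y k i) (y k j))" for k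
  proof -
    obtain n1 where 1: "\<forall>i\<ge>n1. \<forall>j\<ge>n1. gp (x k i) (y k j) \<le> M" using w[of k] by (auto simp: x_def y_def)
    have "same_end \<Gamma> S (x k) (x k)" "same_end \<Gamma> S (y k) (y k)" using x y by (simp_all add: gromov_seqs_def)
    then have "\<exists>n. \<forall>i\<ge>n. \<forall>j\<ge>n. real k \<le> gp (x k i) (x k j)" "\<exists>n. \<forall>i\<ge>n. \<forall>j\<ge>n. real k \<le> gp (y k i) (y k j)"
      unfolding same_end_def by (simp_all only:)
    then obtain n2 n3 where 2: "\<forall>i\<ge>n2. \<forall>j\<ge>n2. real k \<le> gp (x k i) (x k j)" and 3: "\<forall>i\<ge>n3. \<forall>j\<ge>n3. real k \<le> gp (y k i) (y k j)"
      by (elim exE)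
    show ?thesis using 1 2 3 by (intro exI[of _ "max n1 (max n2 n3)"]) simp
  qed
  then obtain n where n: "\<And>k. (\<forall>i\<ge>n k. \<forall>j\<ge>n k. gp (x k i) (y k j) \<le> M) \<and> (\<forall>i\<ge>n k. \<forall>j\<ge>n k. real k \<le> gp (x k i) (x k j)) \<and>
      (\<forall>i\<ge>n k. \<forall>j\<ge>n k. real k \<le> gp (y k i) (y k j))" by metis
  define g h where "g k = x k (n k)" and "h k = y k (n k)" for k
  have gc: "g k \<in> carrier \<Gamma>" and hc: "h k \<in> carrier \<Gamma>" for k
    using seqs_carrier[OF x] seqs_carrier[OF y] by (simp_all add: g_def h_def)
  have gx: "real k \<le> gp (g k) (x k j)" and hy: "real k \<le> gp (h k) (y k j)" if "n k \<le> j" for k j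
    using n[of k] that by (simp_all add: g_def h_def)
  have gh: "gp (g k) (h k) \<le> M" for k using n[of k] by (simp add: g_def h_def)
  have leng: "k \<le> len (g k)" "k \<le> len (h k)" for k
  proof -
    have "real k \<le> real (len (g k))" using gx[of k "n k"] gp_le_len[OF gc seqs_carrier[OF x]] by (meson order_refl order_trans)
    then show "k \<le> len (g k)" by simp
    have "real k \<le> real (len (h k))" using hy[of k "n k"] gp_le_len[OF hc seqs_carrier[OF y]] by (meson order_refl order_trans)
    then show "k \<le> len (h k)" by simp
  qed
  obtain r1 where r1: "strict_mono r1" "g \<circ> r1 \<in> gromov_seqs \<Gamma> S"
    by (rule convergent_subsequence[of g]) (use gc leng in simp_all)
  have "k \<le> len (h (r1 k))" for k
    using leng(2)[of "r1 k"] strict_mono_imp_increasing[OF r1(1), of k] by simp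
  then obtain r2 where r2: "strict_mono r2" "(\<lambda>k. h (r1 k)) \<circ> r2 \<in> gromov_seqs \<Gamma> S"
    by (rule_tac convergent_subsequence[of "\<lambda>k. h (r1 k)"]) (use hc in simp_all)
  define r where "r = r1 \<circ> r2"
  have r: "strict_mono r" unfolding r_def by (rule strict_mono_o[OF r1(1) r2(1)])
  have hr: "(\<lambda>k. h (r k)) \<in> gromov_seqs \<Gamma> S" using r2(2) by (simp add: r_def o_def)
  have gr: "(\<lambda>k. g (r k)) \<in> gromov_seqs \<Gamma> S"
  proof -
    have "same_end \<Gamma> S (\<lambda>k. g (r k)) (\<lambda>k. g (r k))" unfolding same_end_def
    proof
      fix R
      have "same_end \<Gamma> S (g \<circ> r1) (g \<circ> r1)" using r1(2) by (simp add: gromov_seqs_def)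
      then have "\<exists>N. \<forall>i\<ge>N. \<forall>j\<ge>N. R \<le> gp ((g \<circ> r1) i) ((g \<circ> r1) j)" unfolding same_end_def by (rule spec)
      then obtain N where N: "\<forall>i\<ge>N. \<forall>j\<ge>N. R \<le> gp ((g \<circ> r1) i) ((g \<circ> r1) j)" ..
      show "\<exists>N. \<forall>i\<ge>N. \<forall>j\<ge>N. R \<le> gp (g (r i)) (g (r j))"
      proof (intro exI[of _ N] allI impI)
        fix i j assume "N \<le> i" "N \<le> j"
        then have "N \<le> r2 i" "N \<le> r2 j" using strict_mono_imp_increasing[OF r2(1)] by (meson order_trans)+
        then show "R \<le> gp (g (r i)) (g (r j))" using N by (simp add: r_def)
      qed
    qed
    then show ?thesis using gc by (auto simp: gromov_seqs_def)
  qed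
  let ?p = "end_class \<Gamma> S (\<lambda>k. g (r k))" and ?q = "end_class \<Gamma> S (\<lambda>k. h (r k))"
  have "\<not> same_end \<Gamma> S (\<lambda>k. g (r k)) (\<lambda>k. h (r k))"
  proof
    assume "same_end \<Gamma> S (\<lambda>k. g (r k)) (\<lambda>k. h (r k))"
    then have "\<exists>N. \<forall>i\<ge>N. \<forall>j\<ge>N. M + 1 \<le> gp (g (r i)) (h (r j))" unfolding same_end_def by (rule spec)
    then obtain N where "\<forall>i\<ge>N. \<forall>j\<ge>N. M + 1 \<le> gp (g (r i)) (h (r j))" ..
    then have "M + 1 \<le> gp (g (r N)) (h (r N))" by simp
    then show False using gh[of "r N"] by simp
  qed
  then have pq: "?p \<noteq> ?q" using end_class_eq_iff[OF gr hr] by blast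
  then have l: "((?p, ?q), 0) \<in> topspace (flow_topology \<Gamma> S)"
    by (simp add: topspace_flow_topology boundary_pairs_def end_class_boundary[OF gr] end_class_boundary[OF hr])
  have lp: "limitin (boundary_topology \<Gamma> S) (\<lambda>k. end_class \<Gamma> S (x (r k))) ?p sequentially"
    by (rule limitin_boundary[OF gr r x refl gx])
  have lq: "limitin (boundary_topology \<Gamma> S) (\<lambda>k. end_class \<Gamma> S (y (r k))) ?q sequentially"
    by (rule limitin_boundary[OF hr r y refl hy])
  have sub: "(end_class \<Gamma> S (x k), end_class \<Gamma> S (y k)) \<in> boundary_pairs \<Gamma> S" for k
  proof -
    have "\<forall>i\<ge>n k. \<forall>j\<ge>n k. gp (x k i) (y k j) \<le> M" using n[of k] by blast
    from near_pair_topspace[OF x y this, of 0] show ?thesis by (simp add: topspace_flow_topology)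
  qed
  have "limitin (flow_topology \<Gamma> S) (s \<circ> r) ((?p, ?q), 0) sequentially"
    unfolding flow_topology_def limitin_pairwise limitin_subtopology
    using lp lq pq sub end_class_boundary[OF gr] end_class_boundary[OF hr]
    by (simp add: o_def sk boundary_pairs_def)
  then show ?thesis using l r by blast
qed

text \<open>Sequential compactness passes to the closure by the Bolzano-Weierstrass property, which
  is where a metric of the flow topology enters.\<close>

lemma near_pairs_relatively_compact:
  assumes d: "Metric_space (topspace (flow_topology \<Gamma> S)) d" "Metric_space.mtopology (topspace (flow_topology \<Gamma> S)) d = flow_topology \<Gamma> S"
  shows "\<exists>K. compactin (flow_topology \<Gamma> S) K \<and> near_pairs M \<subseteq> K"
proof -
  let ?X = "flow_topology \<Gamma> S"
  have sub: "near_pairs M \<subseteq> topspace ?X"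
  proof
    fix z assume "z \<in> near_pairs M"
    then show "z \<in> topspace ?X" unfolding near_pairs_def using near_pair_topspace by blast
  qed
  have "\<forall>T. T \<subseteq> near_pairs M \<and> infinite T \<longrightarrow> topspace ?X \<inter> ?X derived_set_of T \<noteq> {}"
    by (rule Metric_space.Bolzano_Weierstrass_property[OF d(1) sub sub, unfolded d(2), THEN iffD1])
      (intro allI impI near_pairs_sequence)
  then have "compactin ?X (?X closure_of (near_pairs M))"
    using Metric_space.compact_closure_of_eq_Bolzano_Weierstrass[OF d(1), of "near_pairs M", unfolded d(2)] by blast
  moreover have "near_pairs M \<subseteq> ?X closure_of (near_pairs M)" by (rule closure_of_subset[OF sub])
  ultimately show ?thesis by blast
qed

text \<open>If \<open>g\<close> were close to both ends, the four-point condition through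
  \<open>g\<close> would give late terms of \<open>a\<close> and \<open>b\<close> a large
  product.\<close>

lemma bounded_product_choice:
  assumes a: "a \<in> gromov_seqs \<Gamma> S" and b: "b \<in> gromov_seqs \<Gamma> S" and ab: "\<not> same_end \<Gamma> S a b"
  obtains M N where "\<forall>g\<in>carrier \<Gamma>. \<exists>c\<in>{a, b}. \<forall>i\<ge>N. gp (c i) g \<le> M"
proof -
  obtain R where R: "\<And>N. \<exists>i\<ge>N. \<exists>j\<ge>N. gp (a i) (b j) < R" using ab unfolding same_end_def by (meson not_le)
  have aa: "same_end \<Gamma> S a a" "same_end \<Gamma> S b b" using a b by (simp_all add: gromov_seqs_def)
  then have "\<exists>N. \<forall>i\<ge>N. \<forall>j\<ge>N. R + 2 * \<delta> \<le> gp (a i) (a j)" "\<exists>N. \<forall>i\<ge>N. \<forall>j\<ge>N. R + 2 * \<delta> \<le> gp (b i) (b j)"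
    unfolding same_end_def by (simp_all only:)
  then obtain N1 N2 where N1: "\<forall>i\<ge>N1. \<forall>j\<ge>N1. R + 2 * \<delta> \<le> gp (a i) (a j)" and N2: "\<forall>i\<ge>N2. \<forall>j\<ge>N2. R + 2 * \<delta> \<le> gp (b i) (b j)"
    by (elim exE)
  define N where "N = max N1 N2"
  obtain i0 j0 where ij: "N \<le> i0" "N \<le> j0" "gp (a i0) (b j0) < R" using R by blast
  note ac = seqs_carrier[OF a] and bc = seqs_carrier[OF b]
  have dpos: "0 \<le> \<delta>" using four_point[of \<one> \<one> \<one>] by simp
  \<comment> \<open>One late pair has product below \<open>R\<close>; two uses of the four-point
    condition, each costing \<delta>, extend this to all late pairs.\<close>
  have bound: "gp (a i) (b j) < R + 2 * \<delta>" if i: "N \<le> i" and j: "N \<le> j" for i j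
  proof (rule ccontr)
    assume "\<not> gp (a i) (b j) < R + 2 * \<delta>"
    moreover have "R + 2 * \<delta> \<le> gp (a i0) (a i)" "R + 2 * \<delta> \<le> gp (b j) (b j0)"
      using N1 N2 i j ij by (simp_all add: N_def)
    ultimately show False
      using four_point[OF ac[of i0] ac[of i] bc[of j]] four_point[OF ac[of i0] bc[of j] bc[of j0]] ij(3) dpos by linarith
  qed
  show thesis
  proof (rule that[of N "R + 3 * \<delta>"], rule ballI, rule ccontr)
    fix g assume g: "g \<in> carrier \<Gamma>" and no: "\<not> (\<exists>c\<in>{a, b}. \<forall>i\<ge>N. gp (c i) g \<le> R + 3 * \<delta>)"
    then obtain i j where i: "N \<le> i" "R + 3 * \<delta> < gp (a i) g" and j: "N \<le> j" "R + 3 * \<delta> < gp (b j) g"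
      by (auto simp: not_le)
    have "gp g (b j) = gp (b j) g" by (rule gp_sym[OF g bc])
    then show False using four_point[OF ac[of i] g bc[of j]] bound[OF i(1) j(1)] i(2) j(2) by linarith
  qed
qed

text \<open>Far from the identity, a group element \<open>g\<close> lies close to a bi-infinite geodesic that also
  passes close to the identity: one end avoids the direction of \<open>g\<close>, and the other is the
  \<open>g\<close>-translate of an end that avoids the direction of the inverse of \<open>g\<close>.\<close>

lemma translated_near_pairs:
  assumes a: "a \<in> gromov_seqs \<Gamma> S" and b: "b \<in> gromov_seqs \<Gamma> S" and ab: "\<not> same_end \<Gamma> S a b"
  obtains M R where "\<forall>g\<in>carrier \<Gamma>. R < real (len g) \<longrightarrow> (\<exists>p\<in>boundary \<Gamma> S. \<exists>q\<in>boundary \<Gamma> S. ((p, q), 0) \<in> near_pairs M \<and>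
      ((boundary_act \<Gamma> (inv g) p, boundary_act \<Gamma> (inv g) q), 0) \<in> near_pairs M)"
proof -
  obtain M N where MN: "\<forall>g\<in>carrier \<Gamma>. \<exists>c\<in>{a, b}. \<forall>i\<ge>N. gp (c i) g \<le> M"
    by (rule bounded_product_choice[OF a b ab])
  \<comment> \<open>The product of \<open>g \<otimes> d i\<close> with \<open>g\<close> is at least
    \<open>len g - M\<close>, hence above \<open>M + \<delta>\<close>, whereas that of
    \<open>g\<close> with \<open>c j\<close> is at most \<open>M\<close>. In the four-point
    condition the minimum must therefore be the product of \<open>g \<otimes> d i\<close> and
    \<open>c j\<close>, which gives its bound.\<close>
  have key: "\<forall>i\<ge>N. \<forall>j\<ge>N. gp (g \<otimes> d i) (c j) \<le> M + \<delta>"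
    if g: "g \<in> carrier \<Gamma>" and far: "2 * M + \<delta> < real (len g)" and d: "\<And>i. d i \<in> carrier \<Gamma>" and c: "\<And>i. c i \<in> carrier \<Gamma>"
      and dM: "\<forall>i\<ge>N. gp (d i) (inv g) \<le> M" and cM: "\<forall>i\<ge>N. gp (c i) g \<le> M" for g c d
  proof (intro allI impI)
    fix i j assume i: "N \<le> i" and j: "N \<le> j"
    have gd: "g \<otimes> d i \<in> carrier \<Gamma>" using g d by simp
    have "real (len g) - M \<le> gp (g \<otimes> d i) g" using gp_translate_sum[OF g d[of i]] dM i by (smt (verit))
    moreover have "gp g (g \<otimes> d i) = gp (g \<otimes> d i) g" by (rule gp_sym[OF g gd])
    moreover have "gp g (c j) \<le> M" using cM j gp_sym[OF g c[of j]] by simp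
    ultimately show "gp (g \<otimes> d i) (c j) \<le> M + \<delta>"
      using four_point[OF g gd c[of j]] far by linarith
  qed
  show thesis
  proof (rule that[of "2 * M + \<delta>" "M + \<delta>"], intro ballI impI)
    fix g assume g: "g \<in> carrier \<Gamma>" and far: "2 * M + \<delta> < real (len g)"
    have gi: "inv g \<in> carrier \<Gamma>" "2 * M + \<delta> < real (len (inv g))" using g far by (simp_all add: len_inv)
    obtain c where c: "c \<in> {a, b}" "\<forall>i\<ge>N. gp (c i) g \<le> M" using MN g by blast
    obtain d where d: "d \<in> {a, b}" "\<forall>i\<ge>N. gp (d i) (inv g) \<le> M" using MN gi(1) by blast
    have cs: "c \<in> gromov_seqs \<Gamma> S" and ds: "d \<in> gromov_seqs \<Gamma> S" using c d a b by auto
    note cc = seqs_carrier[OF cs] and dc = seqs_carrier[OF ds]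
    let ?x = "\<lambda>i. g \<otimes> d i" and ?y = "\<lambda>i. inv g \<otimes> c i"
    have xs: "?x \<in> gromov_seqs \<Gamma> S" and ys: "?y \<in> gromov_seqs \<Gamma> S" by (rule seqs_translate[OF g ds], rule seqs_translate[OF gi(1) cs])
    have 1: "\<forall>i\<ge>N. \<forall>j\<ge>N. gp (?x i) (c j) \<le> M + \<delta>" by (rule key[OF g far dc cc d(2) c(2)])
    have "\<forall>i\<ge>N. \<forall>j\<ge>N. gp (?y i) (d j) \<le> M + \<delta>"
      by (rule key[OF gi cc dc _ d(2)]) (use c(2) g in simp)
    then have 2: "\<forall>i\<ge>N. \<forall>j\<ge>N. gp (d i) (?y j) \<le> M + \<delta>"
      using gp_sym[OF dc seqs_carrier[OF ys]] by simp
    have bp: "boundary_act \<Gamma> (inv g) (end_class \<Gamma> S ?x) = end_class \<Gamma> S d"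
    proof -
      have "(\<lambda>i. inv g \<otimes> (g \<otimes> d i)) = d" using dc g by (simp add: m_assoc[symmetric])
      then show ?thesis using boundary_act_end_class[OF gi(1) xs] by simp
    qed
    have bq: "boundary_act \<Gamma> (inv g) (end_class \<Gamma> S c) = end_class \<Gamma> S ?y"
      by (rule boundary_act_end_class[OF gi(1) cs])
    have "((end_class \<Gamma> S ?x, end_class \<Gamma> S c), 0) \<in> near_pairs (M + \<delta>)"
      unfolding near_pairs_def using xs cs 1 by blast
    moreover have "((end_class \<Gamma> S d, end_class \<Gamma> S ?y), 0) \<in> near_pairs (M + \<delta>)"
      unfolding near_pairs_def using ds ys 2 by blast
    ultimately show "\<exists>p\<in>boundary \<Gamma> S. \<exists>q\<in>boundary \<Gamma> S. ((p, q), 0) \<in> near_pairs (M + \<delta>) \<and>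
      ((boundary_act \<Gamma> (inv g) p, boundary_act \<Gamma> (inv g) q), 0) \<in> near_pairs (M + \<delta>)"
      using end_class_boundary[OF xs] end_class_boundary[OF cs] unfolding bp[symmetric] bq[symmetric] by blast
  qed
qed

end

section \<open>The theorem\<close>

text \<open>In each component the expansion at \<open>x\<close> is a power series with positive
  radius of convergence, hence differentiable at its centre.\<close>

lemma real_analytic_on_differentiable:
  fixes f :: "real \<Rightarrow> 'v::euclidean_space"
  assumes f: "real_analytic_on f I" and I: "open I" "x \<in> I"
  shows "f differentiable (at x)"
proof -
  obtain a r where r: "0 < r" and sums: "\<And>y. y \<in> I \<Longrightarrow> \<bar>y - x\<bar> < r \<Longrightarrow> (\<lambda>k. (y - x) ^ k *\<^sub>R a k) sums f y"
    using f I(2) unfolding real_analytic_on_def by blast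
  obtain e where e: "0 < e" "ball x e \<subseteq> I" using I by (meson open_contains_ball)
  define s where "s = min r e"
  have s: "0 < s" using r e by (simp add: s_def)
  have sums': "(\<lambda>k. z ^ k *\<^sub>R a k) sums f (x + z)" if "\<bar>z\<bar> < s" for z
    using sums[of "x + z"] that e(2) by (auto simp: s_def dist_real_def subset_iff)
  have "(\<lambda>y. f y \<bullet> i) differentiable (at x)" for i
  proof -
    have si: "(\<lambda>k. (a k \<bullet> i) * z ^ k) sums (f (x + z) \<bullet> i)" if "\<bar>z\<bar> < s" for z
      using bounded_linear.sums[OF bounded_linear_inner_left[of i] sums'[OF that]] by (simp add: mult.commute)
    have "summable (\<lambda>k. (a k \<bullet> i) * (s / 2) ^ k)" using si[of "s / 2"] s by (simp add: sums_iff)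
    then have "((\<lambda>z. \<Sum>k. (a k \<bullet> i) * z ^ k) has_field_derivative (\<Sum>k. diffs (\<lambda>k. a k \<bullet> i) k * 0 ^ k)) (at 0)"
      using s by (intro termdiffs_strong) auto
    then have "((\<lambda>z. f (x + z) \<bullet> i) has_field_derivative (\<Sum>k. diffs (\<lambda>k. a k \<bullet> i) k * 0 ^ k)) (at 0)"
    proof (rule has_field_derivative_transform_within_open[where S = "{-s<..<s}"])
      show "(\<Sum>k. (a k \<bullet> i) * z ^ k) = f (x + z) \<bullet> i" if "z \<in> {-s<..<s}" for z
        using si[of z] that by (simp add: sums_iff abs_less_iff)
    qed (use s in auto)
    then have "((\<lambda>y. f y \<bullet> i) has_field_derivative (\<Sum>k. diffs (\<lambda>k. a k \<bullet> i) k * 0 ^ k)) (at x)"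
      using DERIV_shift[of "\<lambda>y. f y \<bullet> i" _ 0 x] by (simp add: add.commute)
    then show ?thesis by (auto simp: real_differentiable_def)
  qed
  then show ?thesis by (subst differentiable_componentwise_within) simp
qed

section \<open>Orbit segments between points of a compact set\<close>

lemma flow_0 [simp]: "flow 0 x = x"
  by (simp add: flow_def split: prod.split)

lemma flow_flow: "flow s (flow t x) = flow (s + t) x"
  by (simp add: flow_def add_ac split: prod.split)

lemma continuous_map_flow:
  fixes \<Gamma> :: "('g, 'm) monoid_scheme"
  shows "continuous_map (prod_topology (flow_topology \<Gamma> S) euclideanreal) (flow_topology \<Gamma> S) (\<lambda>p. flow (snd p) (fst p))"
proof -
  let ?Z = "subtopology (prod_topology (boundary_topology \<Gamma> S) (boundary_topology \<Gamma> S)) (boundary_pairs \<Gamma> S)"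
  let ?Y = "prod_topology (prod_topology ?Z euclideanreal) euclideanreal"
  have 1: "continuous_map ?Y ?Z (fst \<circ> fst)" "continuous_map ?Y euclideanreal (snd \<circ> fst)"
    by (rule continuous_map_compose[OF continuous_map_fst continuous_map_fst],
        rule continuous_map_compose[OF continuous_map_fst continuous_map_snd])
  have 2: "continuous_map ?Y euclideanreal snd" by (rule continuous_map_snd)
  have "continuous_map ?Y (prod_topology ?Z euclideanreal) (\<lambda>p. ((fst \<circ> fst) p, (snd \<circ> fst) p + snd p))"
    by (intro continuous_map_pairedI 1(1) continuous_map_add 1(2) 2)
  moreover have "(\<lambda>p. ((fst \<circ> fst) p, (snd \<circ> fst) p + snd p)) = (\<lambda>p :: 'g flow_pt \<times> real. flow (snd p) (fst p))"
    by (auto simp: flow_def fun_eq_iff)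
  ultimately show ?thesis by (simp add: flow_topology_def)
qed

context anosov_flow begin

definition step :: "'g flow_pt set \<Rightarrow> real \<Rightarrow> 'g flow_pt \<Rightarrow> 'g \<Rightarrow> 'g flow_pt \<Rightarrow> bool" where
  "step K T y g y' \<longleftrightarrow> y \<in> K \<and> y' \<in> K \<and> g \<in> carrier \<Gamma> \<and> flow T y = act g y'"

lemma step_ex:
  assumes "K0 \<subseteq> K" "(\<Union>\<gamma>\<in>carrier \<Gamma>. act \<gamma> ` K0) = topspace X" "K \<subseteq> topspace X" "y \<in> K"
  shows "\<exists>g y'. step K T y g y'"
proof -
  have "flow T y \<in> topspace X" using assms by (intro flow_topspace) auto
  then have "flow T y \<in> (\<Union>\<gamma>\<in>carrier \<Gamma>. act \<gamma> ` K0)" using assms(2) by simp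
  then obtain g y' where "g \<in> carrier \<Gamma>" "y' \<in> K0" "flow T y = act g y'" by blast
  then show ?thesis using assms unfolding step_def by blast
qed

lemma step_div:
  assumes K: "K \<subseteq> topspace X" and 1: "step K T y g y'" and 2: "step K T' y h y''"
  shows "step K (T' - T) y' (inv g \<otimes> h) y''"
proof -
  have g: "g \<in> carrier \<Gamma>" "h \<in> carrier \<Gamma>" and y: "y' \<in> topspace X" "y'' \<in> topspace X"
    and e: "flow T y = act g y'" "flow T' y = act h y''" using 1 2 K by (auto simp: step_def)
  have "flow (T' - T) y' = act (inv g) (act g (flow (T' - T) y'))" using g y by (simp add: act_inv flow_topspace)
  also have "act g (flow (T' - T) y') = flow (T' - T) (act g y')" by (rule act_flow[OF g(1) y(1)])
  also have "\<dots> = flow T' y" unfolding e(1)[symmetric] flow_flow by simp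
  also have "act (inv g) (flow T' y) = act (inv g \<otimes> h) y''" unfolding e(2) using g y by (simp add: act_mult)
  finally show ?thesis using 1 2 g by (simp add: step_def)
qed

text \<open>Flowing \<open>K\<close> over a compact time interval gives a compact set, to which
  properness applies; \<open>K\<close> is adjoined so that \<open>y'\<close> and
  \<open>act g y'\<close> lie in the same set.\<close>

lemma finite_step:
  assumes K: "compactin X K"
  shows "finite {g. \<exists>T\<in>{T0..T1}. \<exists>y y'. step K T y g y'}"
proof -
  define K2 where "K2 = K \<union> (\<lambda>p. flow (snd p) (fst p)) ` (K \<times> {T0..T1})"
  have "compactin (prod_topology X euclideanreal) (K \<times> {T0..T1})" using K by (simp add: compactin_Times)
  then have "compactin X ((\<lambda>p. flow (snd p) (fst p)) ` (K \<times> {T0..T1}))"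
    by (rule image_compactin[OF _ continuous_map_flow])
  then have "compactin X K2" unfolding K2_def by (intro compactin_Un K)
  then have fin: "finite {h \<in> carrier \<Gamma>. act h ` K2 \<inter> K2 \<noteq> {}}" using act_proper unfolding acts_properly_def by blast
  have "{g. \<exists>T\<in>{T0..T1}. \<exists>y y'. step K T y g y'} \<subseteq> {h \<in> carrier \<Gamma>. act h ` K2 \<inter> K2 \<noteq> {}}"
  proof
    fix g assume "g \<in> {g. \<exists>T\<in>{T0..T1}. \<exists>y y'. step K T y g y'}"
    then obtain T y y' where T: "T \<in> {T0..T1}" and s: "y \<in> K" "y' \<in> K" "g \<in> carrier \<Gamma>" "flow T y = act g y'"
      unfolding step_def by (elim CollectE bexE exE conjE)
    have "flow T y \<in> K2" unfolding K2_def using T s(1) by (intro UnI2 image_eqI[of _ _ "(y, T)"]) auto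
    then have "act g y' \<in> act g ` K2 \<inter> K2" using s by (simp add: K2_def)
    then show "g \<in> {h \<in> carrier \<Gamma>. act h ` K2 \<inter> K2 \<noteq> {}}" using s(3) by blast
  qed
  then show ?thesis using fin by (rule finite_subset)
qed

text \<open>Off the flow space the action has the junk value \<open>undefined\<close>, which is the same for all points of
  the axis, whereas a translation along the axis is injective.\<close>

lemma axis_ends_in_flow_space:
  assumes g: "g \<in> carrier \<Gamma>" and inf: "\<forall>k>0. g [^] (k::nat) \<noteq> \<one>"
  shows "((attracting \<Gamma> S g, repelling \<Gamma> S g), t) \<in> topspace X"
proof (rule ccontr)
  let ?z = "\<lambda>t :: real. ((attracting \<Gamma> S g, repelling \<Gamma> S g), t)"
  assume "?z t \<notin> topspace X"
  then have out: "?z r \<notin> topspace X" for r by (simp add: topspace_flow_topology)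
  have "\<exists>l>0. \<forall>t. act g (?z t) = flow l (?z t)" using act_axis[OF g] inf by blast
  then obtain l where l: "\<And>t. act g (?z t) = flow l (?z t)" by blast
  have "act g \<in> Bij (topspace X)"
  proof -
    have "act \<in> hom \<Gamma> (BijGroup (topspace X))" using flow_action
      by (simp add: group_action_def group_hom_def group_hom_axioms_def)
    then have "act g \<in> carrier (BijGroup (topspace X))" using g by (rule hom_in_carrier)
    then show ?thesis by (simp add: BijGroup_def)
  qed
  then have "act g (?z r) = undefined" for r using out by (simp add: Bij_def extensional_def)
  then have "flow l (?z 0) = flow l (?z 1)" unfolding l[symmetric] by simp
  then show False by (simp add: flow_def)
qed

text \<open>\<open>Wsub 1\<close> has dimension \<open>CARD('n) - 1\<close>, which is positive; an
  index other than the maximum gives a nonzero vector in it.\<close>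

lemma Pi_one_nonzero:
  assumes x: "x \<in> topspace X" and n: "CARD('n) \<ge> 2"
  shows "\<exists>v. Pi 1 x *v v \<noteq> 0"
proof -
  obtain j :: 'n where j: "j \<noteq> Max UNIV"
  proof (rule ccontr)
    assume h: "\<not> thesis"
    have "UNIV = {Max UNIV :: 'n}" using h that by auto
    then have "CARD('n) = card {Max UNIV :: 'n}" by (rule arg_cong)
    then show False using n by simp
  qed
  define w :: "'n dvec" where "w = axis (Inl j) 1 + axis (Inr j) 1"
  have "w $ Inl j = 1" by (simp add: w_def axis_def)
  then have w0: "w \<noteq> 0" by auto
  have w: "w \<in> Wsub 1" using j by (auto simp: Wsub_eq w_def axis_def)
  obtain h where h: "h \<in> carrier G0" and P: "\<forall>\<sigma> v. \<sigma> \<in> {1, -1} \<longrightarrow> Pi \<sigma> x *v v = h *v (pr \<sigma> *v (matrix_inv h *v v))"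
    by (rule Pi_apply[OF x])
  have "Pi 1 x *v (h *v w) = h *v w" using P h pr_Wsub[of 1 w] w by simp
  moreover have "h *v w \<noteq> 0"
  proof
    assume "h *v w = 0"
    then have "matrix_inv h *v (h *v w) = 0" by simp
    then show False using h w0 by simp
  qed
  ultimately show ?thesis by metis
qed

end

section \<open>Affine actions and the remaining reductions\<close>

lemma carrier_Ga [simp]: "carrier Ga = carrier G0 \<times> R0"
  and mult_Ga [simp]: "mult Ga (g, v) (h, w) = (g ** h, g *v w + v)"
  and one_Ga [simp]: "one Ga = (mat 1, 0)"
  by (simp_all add: Ga_def)

lemma compactin_R0_cball: "compactin (top_of_set R0) (R0 \<inter> cball 0 R)"
proof -
  have "closed (R0 :: 'a dvec set)" unfolding R0_def by (rule closed_span)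
  then have "compact (R0 \<inter> cball 0 R :: 'a dvec set)" by (intro closed_Int_compact compact_cball)
  then show ?thesis by (simp add: compactin_subtopology)
qed

text \<open>The vectors \<open>u (g [^] i)\<close> form the orbit of the origin under a finite
  cyclic group of affine maps, and the barycentre of this orbit is fixed.\<close>

lemma (in group) torsion_fixed_point:
  fixes \<rho> :: "'a \<Rightarrow> ('n::{finite,linorder}) dmat" and u :: "'a \<Rightarrow> 'n dvec"
  assumes u: "\<And>x y. x \<in> carrier G \<Longrightarrow> y \<in> carrier G \<Longrightarrow> u (x \<otimes> y) = \<rho> x *v u y + u x"
    and R0: "\<And>x. x \<in> carrier G \<Longrightarrow> u x \<in> R0" and g: "g \<in> carrier G" and k: "0 < k" "g [^] (k::nat) = \<one>"
    and u1: "u \<one> = 0"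
  shows "\<exists>z\<in>R0. \<rho> g *v z + u g = z"
proof -
  define w where "w = (\<Sum>i<k. u (g [^] i))"
  have sR: "subspace (R0 :: 'n dvec set)" by (simp add: R0_def)
  have wR: "w \<in> R0" unfolding w_def using g by (intro subspace_sum[OF sR] R0) simp
  have "\<rho> g *v w + real k *\<^sub>R u g = (\<Sum>i<k. \<rho> g *v u (g [^] i) + u g)"
    by (simp add: w_def sum.distrib linear_sum[OF matrix_vector_mul_linear] sum_constant_scaleR
        del: sum_constant)
  also have "\<dots> = (\<Sum>i<k. u (g [^] Suc i))"
  proof (rule sum.cong[OF refl])
    fix i assume "i \<in> {..<k}"
    have "g [^] Suc i = g \<otimes> g [^] i" using g by (metis nat_pow_Suc2)
    then show "\<rho> g *v u (g [^] i) + u g = u (g [^] Suc i)" using u[of g "g [^] i"] g by simp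
  qed
  also have "\<dots> = w"
  proof -
    have "(\<Sum>i<k. u (g [^] Suc i)) + u (g [^] (0::nat)) = (\<Sum>i<Suc k. u (g [^] i))"
      by (simp only: sum.lessThan_Suc_shift add.commute)
    also have "\<dots> = w + u (g [^] k)" by (simp only: sum.lessThan_Suc w_def)
    finally show ?thesis using k(2) u1 by simp
  qed
  finally have eq: "\<rho> g *v w + real k *\<^sub>R u g = w" .
  have "\<rho> g *v ((1 / real k) *\<^sub>R w) + u g = (1 / real k) *\<^sub>R (\<rho> g *v w + real k *\<^sub>R u g)"
    using k(1) by (simp add: matrix_vector_mult_scaleR scaleR_add_right)
  also have "\<dots> = (1 / real k) *\<^sub>R w" unfolding eq ..
  finally show ?thesis using subspace_scale[OF sR wR] by blast
qed

lemma word_hyperbolic_group: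
  assumes "word_hyperbolic \<Gamma> S"
  obtains \<delta> where "hyperbolic_group \<Gamma> S \<delta>"
proof -
  have g: "group \<Gamma>" using assms by (simp add: word_hyperbolic_def)
  then have one: "\<one>\<^bsub>\<Gamma>\<^esub> \<in> carrier \<Gamma>" by (simp add: group.is_monoid monoid.one_closed)
  obtain \<delta> where d: "\<forall>w\<in>carrier \<Gamma>. \<forall>x\<in>carrier \<Gamma>. \<forall>y\<in>carrier \<Gamma>. \<forall>z\<in>carrier \<Gamma>.
        min (gromov_prod \<Gamma> S w x y) (gromov_prod \<Gamma> S w y z) - \<delta> \<le> gromov_prod \<Gamma> S w x z"
    using assms unfolding word_hyperbolic_def by blast
  have "hyperbolic_group \<Gamma> S \<delta>"
    unfolding hyperbolic_group_def hyperbolic_group_axioms_def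
    using assms g d one by (simp add: word_hyperbolic_def)
  then show thesis by (rule that)
qed

lemma anosov_flow_of_anosov:
  fixes \<rho> :: "'g \<Rightarrow> ('n::{finite,linorder}) dmat"
  assumes g: "group \<Gamma>" and flow: "gromov_flow \<Gamma> S act" and rho: "\<rho> \<in> hom \<Gamma> G0"
    and an: "anosov \<Gamma> S act G0 P0plus P0minus \<rho>"
  obtains xi N C c where "anosov_flow \<Gamma> S act \<rho> xi N C c"
proof -
  obtain \<xi>plus \<xi>minus C c N where
    cont: "continuous_map (boundary_topology \<Gamma> S) (coset_topology G0 P0plus) \<xi>plus"
      "continuous_map (boundary_topology \<Gamma> S) (coset_topology G0 P0minus) \<xi>minus"
    and equiv: "\<forall>\<gamma>\<in>carrier \<Gamma>. \<forall>p\<in>boundary \<Gamma> S.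
           \<xi>plus (boundary_act \<Gamma> \<gamma> p) = \<rho> \<gamma> <#\<^bsub>G0\<^esub> \<xi>plus p \<and>
           \<xi>minus (boundary_act \<Gamma> \<gamma> p) = \<rho> \<gamma> <#\<^bsub>G0\<^esub> \<xi>minus p"
    and trans: "\<forall>(p, q)\<in>boundary_pairs \<Gamma> S. \<exists>h\<in>carrier G0.
           \<xi>plus p = h <#\<^bsub>G0\<^esub> P0plus \<and> \<xi>minus q = h <#\<^bsub>G0\<^esub> P0minus"
    and Cc: "C > 0" "c > 0"
    and N1: "\<forall>p q s. ((p, q), s) \<in> topspace (flow_topology \<Gamma> S) \<longrightarrow>
              euclidean_norm_mod (lie_algebra (carrier G0))
                (lie_algebra (coset_stab G0 (\<xi>plus p) \<inter> coset_stab G0 (\<xi>minus q))) (N ((p, q), s))"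
    and N2: "\<forall>X\<in>lie_algebra (carrier G0).
              continuous_map (flow_topology \<Gamma> S) euclideanreal (\<lambda>x. N x X)"
    and N3: "\<forall>\<gamma>\<in>carrier \<Gamma>. \<forall>x\<in>topspace (flow_topology \<Gamma> S). \<forall>X\<in>lie_algebra (carrier G0).
              N (act \<gamma> x) (\<rho> \<gamma> ** X ** matrix_inv (\<rho> \<gamma>)) = N x X"
    and N4: "\<forall>p q s. ((p, q), s) \<in> topspace (flow_topology \<Gamma> S) \<longrightarrow>
              (\<forall>X\<in>lie_algebra (coset_stab G0 (\<xi>minus q)). \<forall>t\<ge>0.
                 N (flow (- t) ((p, q), s)) X \<le> C * exp (- c * t) * N ((p, q), s) X) \<and>
              (\<forall>X\<in>lie_algebra (coset_stab G0 (\<xi>plus p)). \<forall>t\<ge>0.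
                 N (flow t ((p, q), s)) X \<le> C * exp (- c * t) * N ((p, q), s) X)"
    using an unfolding anosov_def by (elim exE conjE)
  define xi where "xi \<sigma> = (if \<sigma> = 1 then \<xi>plus else \<xi>minus)" for \<sigma> :: real
  have xi: "xi 1 = \<xi>plus" "xi (-1) = \<xi>minus" by (simp_all add: xi_def)
  have e: "end_pt 1 x = fst (fst x)" "end_pt (-1) x = snd (fst x)" for x :: "'g flow_pt"
    by (simp_all add: end_pt_def)
  have "anosov_flow \<Gamma> S act \<rho> xi N C c"
    unfolding anosov_flow_def anosov_flow_axioms_def
  proof (intro conjI allI impI)
    fix \<sigma> :: real assume \<sigma>: "\<sigma> \<in> {1, -1}"
    show "continuous_map (boundary_topology \<Gamma> S) (coset_topology G0 (stab0 (Wsub \<sigma>))) (xi \<sigma>)"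
      using \<sigma> cont by (auto simp: xi P0plus_def P0minus_def)
    show "xi \<sigma> (boundary_act \<Gamma> \<gamma> p) = \<rho> \<gamma> <#\<^bsub>G0\<^esub> xi \<sigma> p" if "\<gamma> \<in> carrier \<Gamma>" "p \<in> boundary \<Gamma> S" for \<gamma> p
      using \<sigma> equiv that by (auto simp: xi)
  next
    fix x :: "'g flow_pt" assume x: "x \<in> topspace (flow_topology \<Gamma> S)"
    obtain p q s where pq: "x = ((p, q), s)" by (metis prod.exhaust)
    have "(p, q) \<in> boundary_pairs \<Gamma> S" using x by (simp add: topspace_flow_topology pq)
    then obtain h where "h \<in> carrier G0" "\<xi>plus p = h <#\<^bsub>G0\<^esub> P0plus" "\<xi>minus q = h <#\<^bsub>G0\<^esub> P0minus"
      using trans by blast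
    then show "\<exists>h\<in>carrier G0. \<forall>\<sigma>\<in>{1, -1}. xi \<sigma> (end_pt \<sigma> x) = h <#\<^bsub>G0\<^esub> stab0 (Wsub \<sigma>)"
      by (intro bexI[of _ h]) (auto simp: xi e pq P0plus_def P0minus_def)
    show "euclidean_norm_mod (lie_algebra (carrier G0))
        (lie_algebra (coset_stab G0 (xi 1 (end_pt 1 x)) \<inter> coset_stab G0 (xi (-1) (end_pt (-1) x)))) (N x)"
      using N1 x by (simp add: pq e xi)
  next
    fix Y :: "'n dmat" assume "Y \<in> lie_algebra (carrier G0)"
    then show "continuous_map (flow_topology \<Gamma> S) euclideanreal (\<lambda>x. N x Y)" using N2 by blast
  next
    fix \<gamma> x and Y :: "'n dmat" assume "\<gamma> \<in> carrier \<Gamma>" "x \<in> topspace (flow_topology \<Gamma> S)" "Y \<in> lie_algebra (carrier G0)"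
    then show "N (act \<gamma> x) (\<rho> \<gamma> ** Y ** matrix_inv (\<rho> \<gamma>)) = N x Y" using N3 by blast
  next
    fix \<sigma> t :: real and x :: "'g flow_pt" and Y :: "'n dmat"
    assume \<sigma>: "\<sigma> \<in> {1, -1}" and x: "x \<in> topspace (flow_topology \<Gamma> S)"
      and Y: "Y \<in> lie_algebra (coset_stab G0 (xi \<sigma> (end_pt \<sigma> x)))" and t: "0 \<le> t"
    obtain p q s where pq: "x = ((p, q), s)" by (metis prod.exhaust)
    show "N (flow (\<sigma> * t) x) Y \<le> C * exp (- c * t) * N x Y"
      using \<sigma> Y t N4[rule_format, of p q s] x unfolding pq by (auto simp: xi e)
  qed (use g flow rho Cc in auto)
  then show thesis by (rule that)
qed

lemma hom_GG_one:
  fixes \<rho> :: "'g \<Rightarrow> ('n::finite) dmat"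
  assumes g: "group \<Gamma>" and h: "\<rho> \<in> hom \<Gamma> GG"
  shows "\<rho> \<one>\<^bsub>\<Gamma>\<^esub> = mat 1"
proof -
  interpret group \<Gamma> by (rule g)
  let ?e = "\<rho> \<one>\<^bsub>\<Gamma>\<^esub>"
  have "?e \<in> carrier GG" using h by (rule hom_in_carrier) simp
  then have inv: "matrix_inv ?e ** ?e = mat 1" by (intro SOnn_inverse(2) GG_SOnn)
  have "?e ** ?e = ?e" using hom_mult[OF h, of "\<one>\<^bsub>\<Gamma>\<^esub>" "\<one>\<^bsub>\<Gamma>\<^esub>"] by simp
  then have "matrix_inv ?e ** (?e ** ?e) = matrix_inv ?e ** ?e" by simp
  then show ?thesis by (simp add: matrix_mul_assoc inv)
qed

text \<open>Balls of \<open>R0\<close> are compact. Properness concerns the image in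
  \<open>Ga\<close>, and injectivity brings the finiteness back to the group.\<close>

lemma margulis_spacetime_finite_returns:
  fixes \<rho> :: "'g \<Rightarrow> ('n::{finite,linorder}) dmat"
  assumes "margulis_spacetime \<Gamma> (\<lambda>\<gamma>. (\<rho> \<gamma>, u \<gamma>))"
  shows "finite {g \<in> carrier \<Gamma>. \<exists>z\<in>R0. norm z \<le> R \<and> norm (\<rho> g *v z + u g) \<le> R}" (is "finite ?F")
proof -
  let ?\<tau> = "\<lambda>\<gamma>. (\<rho> \<gamma>, u \<gamma>)"
  let ?K = "R0 \<inter> cball 0 R :: 'n dvec set"
  have hom: "?\<tau> \<in> hom \<Gamma> Ga" and inj: "inj_on ?\<tau> (carrier \<Gamma>)"
    and proper: "acts_properly (?\<tau> ` carrier \<Gamma>) (top_of_set R0) affine_act"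
    using assms by (simp_all add: margulis_spacetime_def)
  have "finite {h \<in> ?\<tau> ` carrier \<Gamma>. affine_act h ` ?K \<inter> ?K \<noteq> {}}"
    using proper compactin_R0_cball unfolding acts_properly_def by blast
  moreover have "?\<tau> ` ?F \<subseteq> {h \<in> ?\<tau> ` carrier \<Gamma>. affine_act h ` ?K \<inter> ?K \<noteq> {}}"
  proof
    fix h assume "h \<in> ?\<tau> ` ?F"
    then obtain g z where g: "g \<in> carrier \<Gamma>" "h = ?\<tau> g" and z: "z \<in> R0" "norm z \<le> R" "norm (\<rho> g *v z + u g) \<le> R"
      by blast
    have "?\<tau> g \<in> carrier Ga" using hom g(1) by (rule hom_in_carrier)
    then have G: "\<rho> g \<in> carrier G0" "u g \<in> R0" by simp_all
    have "\<rho> g *v z + u g \<in> R0"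
      using z(1) G(2) nnform_G0[OF G(1), of z e2n] G0_e2n[OF G(1)] by (simp add: R0_iff nnform_simps)
    then have "affine_act h z \<in> affine_act h ` ?K \<inter> ?K" using z g(2) by (auto simp: affine_act_def)
    then show "h \<in> {h \<in> ?\<tau> ` carrier \<Gamma>. affine_act h ` ?K \<inter> ?K \<noteq> {}}" using g by blast
  qed
  ultimately have "finite (?\<tau> ` ?F)" by (rule finite_subset[rotated])
  moreover have "inj_on ?\<tau> ?F" using inj by (rule inj_on_subset) blast
  ultimately show ?thesis by (rule finite_imageD)
qed

text \<open>A torsion element fixes a barycentre, so freeness makes its image trivial, and
  injectivity concludes.\<close>

lemma margulis_spacetime_torsion_free:
  fixes \<rho> :: "'g \<Rightarrow> ('n::{finite,linorder}) dmat"
  assumes grp: "group \<Gamma>" and rho: "\<rho> \<in> hom \<Gamma> GG" and ms: "margulis_spacetime \<Gamma> (\<lambda>\<gamma>. (\<rho> \<gamma>, u \<gamma>))"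
    and g: "g \<in> carrier \<Gamma>" and k: "0 < k" "g [^]\<^bsub>\<Gamma>\<^esub> (k::nat) = \<one>\<^bsub>\<Gamma>\<^esub>"
  shows "g = \<one>\<^bsub>\<Gamma>\<^esub>"
proof -
  interpret group \<Gamma> by (rule grp)
  let ?\<tau> = "\<lambda>\<gamma>. (\<rho> \<gamma>, u \<gamma>)"
  have hom: "?\<tau> \<in> hom \<Gamma> Ga" and inj: "inj_on ?\<tau> (carrier \<Gamma>)"
    and free: "acts_freely Ga (?\<tau> ` carrier \<Gamma>) R0 affine_act"
    using ms by (simp_all add: margulis_spacetime_def)
  have u: "u (x \<otimes>\<^bsub>\<Gamma>\<^esub> y) = \<rho> x *v u y + u x" if "x \<in> carrier \<Gamma>" "y \<in> carrier \<Gamma>" for x y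
    using hom_mult[OF hom that] by simp
  have R0: "u x \<in> R0" if "x \<in> carrier \<Gamma>" for x using hom_in_carrier[OF hom that] by simp
  have one: "\<rho> \<one>\<^bsub>\<Gamma>\<^esub> = mat 1" by (rule hom_GG_one[OF grp rho])
  have u1: "u \<one>\<^bsub>\<Gamma>\<^esub> = 0" using u[of "\<one>\<^bsub>\<Gamma>\<^esub>" "\<one>\<^bsub>\<Gamma>\<^esub>"] one by simp
  have "\<exists>z\<in>R0. \<rho> g *v z + u g = z" by (rule torsion_fixed_point[OF u R0 g k u1])
  then obtain z where z: "z \<in> R0" "affine_act (?\<tau> g) z = z" by (auto simp: affine_act_def)
  have "?\<tau> g = \<one>\<^bsub>Ga\<^esub>" by (rule free[unfolded acts_freely_def, rule_format, OF imageI[OF g] z])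
  then have "?\<tau> g = (mat 1, 0)" by simp
  then have "?\<tau> g = ?\<tau> \<one>\<^bsub>\<Gamma>\<^esub>" using one u1 by simp
  then show ?thesis using inj g by (auto dest: inj_onD)
qed

lemma acts_properly_Hnn:
  fixes \<rho> :: "'g \<Rightarrow> ('n::{finite,linorder}) dmat"
  assumes "\<And>R. finite {g \<in> carrier \<Gamma>. \<exists>v. nnform v v = -1 \<and> norm v \<le> R \<and> norm (\<rho> g *v v) \<le> R}"
  shows "acts_properly (\<rho> ` carrier \<Gamma>) (top_of_set (Hnn :: 'n dvec set)) (*v)"
  unfolding acts_properly_def
proof (intro allI impI)
  fix K :: "'n dvec set" assume "compactin (top_of_set Hnn) K"
  then have K: "compact K" "K \<subseteq> Hnn" by (simp_all add: compactin_subtopology)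
  obtain R where R: "\<forall>v\<in>K. norm v \<le> R" using compact_imp_bounded[OF K(1)] unfolding bounded_iff by blast
  have Hnn: "nnform v v = -1" if v: "v \<in> Hnn" for v :: "'n dvec"
  proof -
    obtain g :: "'n dmat" where g: "g \<in> carrier GG" "v = g *v e2n" using v unfolding Hnn_def by blast
    show ?thesis unfolding g(2) SOnn_form[OF GG_SOnn[OF g(1)]] by (rule nnform_e2n)
  qed
  let ?F = "{g \<in> carrier \<Gamma>. \<exists>v. nnform v v = -1 \<and> norm v \<le> R \<and> norm (\<rho> g *v v) \<le> R}"
  have "{h \<in> \<rho> ` carrier \<Gamma>. (*v) h ` K \<inter> K \<noteq> {}} \<subseteq> \<rho> ` ?F"
  proof
    fix h assume "h \<in> {h \<in> \<rho> ` carrier \<Gamma>. (*v) h ` K \<inter> K \<noteq> {}}"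
    then obtain g v where g: "g \<in> carrier \<Gamma>" "h = \<rho> g" and v: "v \<in> K" "\<rho> g *v v \<in> K" by blast
    then have "nnform v v = -1" "norm v \<le> R" "norm (\<rho> g *v v) \<le> R" using Hnn K(2) R by blast+
    then show "h \<in> \<rho> ` ?F" using g by blast
  qed
  then show "finite {h \<in> \<rho> ` carrier \<Gamma>. (*v) h ` K \<inter> K \<noteq> {}}"
    using assms[of R] by (rule finite_subset[OF _ finite_imageI])
qed

text \<open>The element of infinite order supplies two different ends, those of its axis. With them
  \<open>translated_near_pairs\<close> shows that, for \<open>g\<close> far from the identity, some
  flow line and its translate by \<open>inv g\<close> both meet the compact set containing the near
  pairs.\<close>

lemma (in hyperbolic_group) exceptional_finite:
  assumes an: "anosov_flow \<Gamma> S act \<rho> xi N C c"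
    and inf: "g0 \<in> carrier \<Gamma>" "\<forall>k>0. g0 [^] (k::nat) \<noteq> \<one>"
  obtains K where "compactin (flow_topology \<Gamma> S) K" 
    "\<exists>K0\<subseteq>K. (\<Union>\<gamma>\<in>carrier \<Gamma>. act \<gamma> ` K0) = topspace (flow_topology \<Gamma> S)"
    "finite {g \<in> carrier \<Gamma>. \<not> (\<exists>T y y'. anosov_flow.step \<Gamma> act K T y g y')}"
proof -
  interpret A: anosov_flow \<Gamma> S act \<rho> xi N C c by (rule an)
  have z: "((attracting \<Gamma> S g0, repelling \<Gamma> S g0), 0) \<in> topspace (flow_topology \<Gamma> S)"
    by (rule A.axis_ends_in_flow_space[OF inf])
  then have ends: "attracting \<Gamma> S g0 \<in> boundary \<Gamma> S" "repelling \<Gamma> S g0 \<in> boundary \<Gamma> S"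
    "attracting \<Gamma> S g0 \<noteq> repelling \<Gamma> S g0"
    by (simp_all add: topspace_flow_topology boundary_pairs_def)
  obtain a where a: "a \<in> gromov_seqs \<Gamma> S" "attracting \<Gamma> S g0 = end_class \<Gamma> S a" using ends(1) unfolding boundary_def by blast
  obtain b where b: "b \<in> gromov_seqs \<Gamma> S" "repelling \<Gamma> S g0 = end_class \<Gamma> S b" using ends(2) unfolding boundary_def by blast
  have ab: "\<not> same_end \<Gamma> S a b" using ends(3) end_class_eq_iff[OF a(1) b(1)] by (simp add: a(2) b(2))
  obtain M R where MR: "\<forall>g\<in>carrier \<Gamma>. R < real (len g) \<longrightarrow> (\<exists>p\<in>boundary \<Gamma> S. \<exists>q\<in>boundary \<Gamma> S. ((p, q), 0) \<in> near_pairs M \<and>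
      ((boundary_act \<Gamma> (inv g) p, boundary_act \<Gamma> (inv g) q), 0) \<in> near_pairs M)"
    by (rule translated_near_pairs[OF a(1) b(1) ab])
  obtain d where d: "Metric_space (topspace A.X) d" "Metric_space.mtopology (topspace A.X) d = A.X"
    by (rule A.metrizable_X)
  obtain K1 where K1: "compactin A.X K1" "near_pairs M \<subseteq> K1" using near_pairs_relatively_compact[OF d] by blast
  obtain K0 where K0: "compactin A.X K0" "(\<Union>\<gamma>\<in>carrier \<Gamma>. act \<gamma> ` K0) = topspace A.X" using A.act_cocompact by blast
  \<comment> \<open>Translates of \<open>K0\<close> cover the flow space, so every orbit can be
    followed; \<open>K1\<close> contains the near pairs.\<close>
  define K where "K = K0 \<union> K1"
  have K: "compactin A.X K" unfolding K_def by (rule compactin_Un[OF K0(1) K1(1)])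
  have KX: "K \<subseteq> topspace A.X" by (rule compactin_subset_topspace[OF K])
  have step: "\<exists>T y y'. A.step K T y g y'" if g: "g \<in> carrier \<Gamma>" and far: "R < real (len g)" for g
  proof -
    obtain p q where pq: "((p, q), 0) \<in> near_pairs M"
      "((boundary_act \<Gamma> (inv g) p, boundary_act \<Gamma> (inv g) q), 0) \<in> near_pairs M" using MR g far by blast
    have gi: "inv g \<in> carrier \<Gamma>" using g by simp
    let ?x = "((p, q), 0 :: real)" and ?y = "((boundary_act \<Gamma> (inv g) p, boundary_act \<Gamma> (inv g) q), 0 :: real)"
    have K': "?x \<in> K" "?y \<in> K" using pq K1(2) by (auto simp: K_def)
    then have X: "?x \<in> topspace A.X" "?y \<in> topspace A.X" using KX by auto
    \<comment> \<open>The action on the flow space covers the one on pairs of ends but may shift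
      time; \<open>s\<close> is the shift, and the segment found has length
      \<open>- s\<close>.\<close>
    define s where "s = snd (act (inv g) ?x)"
    have "fst (act (inv g) ?x) = fst ?y" using A.act_fst[OF gi X(1)] by simp
    then have "act (inv g) ?x = (fst ?y, s)" unfolding s_def by (metis prod.collapse)
    then have "act (inv g) ?x = flow s ?y" by (simp add: flow_def)
    then have "act g (act (inv g) ?x) = flow s (act g ?y)" using A.act_flow[OF g X(2)] by simp
    moreover have "act g (act (inv g) ?x) = ?x" using A.act_inv[OF gi X(1)] g by simp
    ultimately have "flow (- s) ?x = flow (- s) (flow s (act g ?y))" by simp
    then have "flow (- s) ?x = act g ?y" by (simp add: flow_flow)
    then have "A.step K (- s) ?x g ?y" using K' g by (simp add: A.step_def)
    then show ?thesis by blast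
  qed
  have "{g \<in> carrier \<Gamma>. \<not> (\<exists>T y y'. A.step K T y g y')} \<subseteq> {g \<in> carrier \<Gamma>. len g \<le> nat \<lceil>R\<rceil>}"
  proof
    fix g assume "g \<in> {g \<in> carrier \<Gamma>. \<not> (\<exists>T y y'. A.step K T y g y')}"
    then have g: "g \<in> carrier \<Gamma>" "\<not> (\<exists>T y y'. A.step K T y g y')" by blast+
    then have "\<not> R < real (len g)" using step by blast
    then have "len g \<le> nat \<lceil>R\<rceil>" by linarith
    then show "g \<in> {g \<in> carrier \<Gamma>. len g \<le> nat \<lceil>R\<rceil>}" using g(1) by simp
  qed
  then have "finite {g \<in> carrier \<Gamma>. \<not> (\<exists>T y y'. A.step K T y g y')}" using finite_len_ball by (rule finite_subset)
  then show thesis using that[OF K] K0(2) K_def by blast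
qed

section \<open>Assembly: the flow of the representation is a neutral dynamics\<close>

theorem corollary1p1:
  fixes \<Gamma> :: "('g, 'm) monoid_scheme"
    and S :: "'g set"
    and act :: "'g \<Rightarrow> 'g flow_pt \<Rightarrow> 'g flow_pt"
    and \<rho> :: "real \<Rightarrow> 'g \<Rightarrow> ('n::{finite,linorder}) dmat"
  assumes "CARD('n) \<ge> 2"
    and "word_hyperbolic \<Gamma> S"
    and "gromov_flow \<Gamma> S act"
    and "\<forall>t\<in>{-1<..<1}. \<rho> t \<in> hom \<Gamma> GG"
    and "\<forall>\<gamma>\<in>carrier \<Gamma>. real_analytic_on (\<lambda>t. \<rho> t \<gamma>) {-1<..<1}"
    and "\<rho> 0 \<in> hom \<Gamma> G0"
    and "anosov \<Gamma> S act G0 P0plus P0minus (\<rho> 0)"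
    and "margulis_spacetime \<Gamma> (\<lambda>\<gamma>. (\<rho> 0 \<gamma>, tangent_vector \<rho> \<gamma> *v e2n))"
  shows "\<exists>\<epsilon>>0. \<epsilon> \<le> 1 \<and> (\<forall>t. 0 < \<bar>t\<bar> \<and> \<bar>t\<bar> < \<epsilon> \<longrightarrow>
           acts_properly (\<rho> t ` carrier \<Gamma>) (top_of_set (Hnn :: 'n dvec set)) (*v))"
proof (cases "\<exists>g\<in>carrier \<Gamma>. \<forall>k>0. g [^]\<^bsub>\<Gamma>\<^esub> (k::nat) \<noteq> \<one>\<^bsub>\<Gamma>\<^esub>")
  case False
  \<comment> \<open>Every element is torsion here, hence trivial, and any \<epsilon> will
    do.\<close>
  have grp: "group \<Gamma>" using assms(2) by (simp add: word_hyperbolic_def)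
  have r0: "\<rho> 0 \<in> hom \<Gamma> GG" using assms(4) by simp
  have "carrier \<Gamma> \<subseteq> {\<one>\<^bsub>\<Gamma>\<^esub>}"
  proof
    fix g assume g: "g \<in> carrier \<Gamma>"
    then obtain k :: nat where "0 < k" "g [^]\<^bsub>\<Gamma>\<^esub> k = \<one>\<^bsub>\<Gamma>\<^esub>" using False by blast
    then show "g \<in> {\<one>\<^bsub>\<Gamma>\<^esub>}" using margulis_spacetime_torsion_free[OF grp r0 assms(8) g] by simp
  qed
  then have "finite (carrier \<Gamma>)" by (rule finite_subset) simp
  then show ?thesis unfolding acts_properly_def by (intro exI[of _ 1]) simp
next
  case True
  then obtain g0 where g0: "g0 \<in> carrier \<Gamma>" "\<forall>k>0. g0 [^]\<^bsub>\<Gamma>\<^esub> (k::nat) \<noteq> \<one>\<^bsub>\<Gamma>\<^esub>" by blast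
  obtain \<delta> where hyp: "hyperbolic_group \<Gamma> S \<delta>" by (rule word_hyperbolic_group[OF assms(2)])
  interpret H: hyperbolic_group \<Gamma> S \<delta> by (rule hyp)
  have grp: "group \<Gamma>" by (rule H.is_group)
  obtain xi N C c where an: "anosov_flow \<Gamma> S act (\<rho> 0) xi N C c"
    by (rule anosov_flow_of_anosov[OF grp assms(3,6,7)])
  interpret A: anosov_flow \<Gamma> S act "\<rho> 0" xi N C c by (rule an)
  obtain K where K: "compactin A.X K" and K0: "\<exists>K0\<subseteq>K. (\<Union>\<gamma>\<in>carrier \<Gamma>. act \<gamma> ` K0) = topspace A.X"
    and exc: "finite {g \<in> carrier \<Gamma>. \<not> (\<exists>T y y'. A.step K T y g y')}"
    by (rule H.exceptional_finite[OF an g0])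
  obtain K0 where K0: "K0 \<subseteq> K" "(\<Union>\<gamma>\<in>carrier \<Gamma>. act \<gamma> ` K0) = topspace A.X" using K0 by blast
  have KX: "K \<subseteq> topspace A.X" by (rule compactin_subset_topspace[OF K])
  obtain b where b: "1 \<le> b" "\<forall>x\<in>K. \<forall>\<sigma>\<in>{1, -1}. norm (A.Pi \<sigma> x) \<le> b" by (rule A.Pi_bounded[OF K])
  obtain D where D: "1 \<le> D" "\<forall>\<sigma>\<in>{1, -1}. \<forall>y\<in>K. \<forall>y'\<in>K. \<forall>g\<in>carrier \<Gamma>. \<forall>T v. flow T y = act g y' \<longrightarrow> 0 \<le> \<sigma> * T \<longrightarrow>
     norm (\<rho> 0 (inv\<^bsub>\<Gamma>\<^esub> g) *v (A.Pi \<sigma> y *v v)) \<le> D * exp (- c * \<bar>T\<bar>) * norm (A.Pi \<sigma> y *v v)"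
    by (rule A.contraction[OF K])
  let ?u = "\<lambda>\<gamma>. tangent_vector \<rho> \<gamma> *v e2n"
  have hom: "(\<lambda>\<gamma>. (\<rho> 0 \<gamma>, ?u \<gamma>)) \<in> hom \<Gamma> Ga" using assms(8) by (simp add: margulis_spacetime_def)
  \<comment> \<open>\<open>2 * b + 2\<close> bounds the neutral vectors and is also larger than the
    bound \<open>b\<close> of the projections, so one constant serves both.\<close>
  have dyn: "neutral_dynamics \<Gamma> \<rho> K (A.step K) A.Pi D c (2 * b + 2)"
    unfolding neutral_dynamics_def neutral_dynamics_axioms_def
  proof (intro conjI allI impI)
    show "group \<Gamma>" by (rule grp)
    show "\<rho> t (g \<otimes>\<^bsub>\<Gamma>\<^esub> h) = \<rho> t g ** \<rho> t h" if "t \<in> {-1<..<1}" "g \<in> carrier \<Gamma>" "h \<in> carrier \<Gamma>" for t g h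
      using hom_mult[OF assms(4)[rule_format, OF that(1)] that(2,3)] by simp
    show "\<rho> t \<one>\<^bsub>\<Gamma>\<^esub> = mat 1" if "t \<in> {-1<..<1}" for t
      by (rule hom_GG_one[OF grp assms(4)[rule_format, OF that]])
    show "nnform (\<rho> t g *v v) (\<rho> t g *v w) = nnform v w" if "t \<in> {-1<..<1}" "g \<in> carrier \<Gamma>" for t g v w
      by (rule SOnn_form[OF GG_SOnn[OF hom_in_carrier[OF assms(4)[rule_format, OF that(1)] that(2)]]])
    show "\<rho> 0 g *v e2n = e2n" if "g \<in> carrier \<Gamma>" for g by (rule G0_e2n[OF A.rho_G0[OF that]])
    show "(\<lambda>t. \<rho> t g) differentiable at 0" if "g \<in> carrier \<Gamma>" for g
      using assms(5) that by (intro real_analytic_on_differentiable[of _ "{-1<..<1}"]) auto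
    show "?u g \<in> R0" if "g \<in> carrier \<Gamma>" for g using hom_in_carrier[OF hom that] by simp
    show "?u (g \<otimes>\<^bsub>\<Gamma>\<^esub> h) = \<rho> 0 g *v ?u h + ?u g" if "g \<in> carrier \<Gamma>" "h \<in> carrier \<Gamma>" for g h
      using hom_mult[OF hom that] by simp
    show "finite {g \<in> carrier \<Gamma>. \<exists>z\<in>R0. norm z \<le> R \<and> norm (\<rho> 0 g *v z + ?u g) \<le> R}" for R
      by (rule margulis_spacetime_finite_returns[OF assms(8)])
    show "g \<in> carrier \<Gamma>" "y \<in> K" "y' \<in> K" if "A.step K T y g y'" for T y g y'
      using that by (simp_all add: A.step_def)
    show "A.step K 0 y \<one>\<^bsub>\<Gamma>\<^esub> y" if "y \<in> K" for y
      using that KX A.act_one[of y] by (auto simp: A.step_def)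
    show "\<exists>g y'. A.step K T y g y'" if "y \<in> K" for y T by (rule A.step_ex[OF K0 KX that])
    show "A.step K (T' - T) y' (inv\<^bsub>\<Gamma>\<^esub> g \<otimes>\<^bsub>\<Gamma>\<^esub> h) y''" if "A.step K T y g y'" "A.step K T' y h y''" for T y g y' T' h y''
      by (rule A.step_div[OF KX that])
    show "finite {g. \<exists>T\<in>{T0..T1}. \<exists>y y'. A.step K T y g y'}" for T0 T1 by (rule A.finite_step[OF K])
    show "finite {g \<in> carrier \<Gamma>. \<not> (\<exists>T y y'. A.step K T y g y')}" by (rule exc)
    show "0 < c" by (rule A.pos(2))
    show "1 \<le> D" by (rule D(1))
    show "1 \<le> 2 * b + 2" using b by simp
    show "nnform (A.Pi \<sigma> y *v v) e2n = 0" if "\<sigma> \<in> {1, -1}" "y \<in> K" for \<sigma> y v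
      using A.Pi_e2n_form[OF _ that(1)] KX that(2) by blast
    show "norm (A.Pi \<sigma> y *v v) \<le> (2 * b + 2) * norm v" if "\<sigma> \<in> {1, -1}" "y \<in> K" for \<sigma> y v
      by (rule norm_matrix_vector_bound) (use b that in fastforce)+
    show "\<exists>v. A.Pi 1 y *v v \<noteq> 0" if "y \<in> K" for y
      using A.Pi_one_nonzero[OF _ assms(1)] KX that by blast
    show "A.Pi \<sigma> y *v (\<rho> 0 g *v v) = \<rho> 0 g *v (A.Pi \<sigma> y' *v v)" if "\<sigma> \<in> {1, -1}" "A.step K T y g y'" for \<sigma> T y g y' v
    proof -
      have "g \<in> carrier \<Gamma>" "y' \<in> topspace A.X" "flow T y = act g y'" using that(2) KX by (auto simp: A.step_def)
      then show ?thesis using A.Pi_act[OF _ _ that(1), of g y' v] A.Pi_flow[of \<sigma> T y] by simp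
    qed
    show "norm (\<rho> 0 (inv\<^bsub>\<Gamma>\<^esub> g) *v (A.Pi \<sigma> y *v v)) \<le> D * exp (- c * \<bar>T\<bar>) * norm (A.Pi \<sigma> y *v v)"
      if "\<sigma> \<in> {1, -1}" "A.step K T y g y'" "0 \<le> \<sigma> * T" for \<sigma> T y g y' v
    proof -
      have "y \<in> K" "y' \<in> K" "g \<in> carrier \<Gamma>" "flow T y = act g y'" using that(2) by (simp_all add: A.step_def)
      then show ?thesis by (rule D(2)[rule_format, OF that(1) _ _ _ _ that(3)])
    qed
    show "\<exists>\<nu>. neutral (A.Pi 1 y) (A.Pi (-1) y) \<nu>" if "y \<in> K" for y
      using A.frame_ex A.neutral_frame KX that by blast
    show "norm \<nu> \<le> 2 * b + 2" if "y \<in> K" "neutral (A.Pi 1 y) (A.Pi (-1) y) \<nu>" for y \<nu>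
      by (rule A.neutral_norm_le[OF _ _ b(1) that(2)]) (use b(2) that(1) in auto)
  qed
  obtain \<epsilon> where \<epsilon>: "0 < \<epsilon>" "\<epsilon> \<le> 1"
    and fin: "\<And>t R. 0 < \<bar>t\<bar> \<Longrightarrow> \<bar>t\<bar> < \<epsilon> \<Longrightarrow>
      finite {g \<in> carrier \<Gamma>. \<exists>v. nnform v v = -1 \<and> norm v \<le> R \<and> norm (\<rho> t g *v v) \<le> R}"
    using neutral_dynamics.finite_bounded_returns[OF dyn] by blast
  show ?thesis
  proof (intro exI[of _ \<epsilon>] conjI \<epsilon> allI impI)
    fix t assume "0 < \<bar>t\<bar> \<and> \<bar>t\<bar> < \<epsilon>"
    then show "acts_properly (\<rho> t ` carrier \<Gamma>) (top_of_set (Hnn :: 'n dvec set)) (*v)"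
      by (intro acts_properly_Hnn fin) auto
  qed
qed

end
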